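(* Let $b\colon(0,\infty)\to[0,\infty)$ be a nonincreasing function that is not identically zero. Let $X$ be a rearrangement-invariant space such that $\min\{1,b^{-1}\}\in X'$. Then $T_b\colon X\to(\Upsilon_{b^{-1},X'})'$. Furthermore, the space $(\Upsilon_{b^{-1},X'})'$ is the optimal range partner of $X$ with respect to $T_b$ in the class of rearrangement-invariant spaces. Moreover, if $X$ is a rearrangement-invariant space with $\min\{1,b^{-1}\}\notin X'$, then no range partner of $X$ with respect to $T_b$ exists in the class of rearrangement-invariant spaces.
   Context: $\mathcal M(0,\infty)$ is the set of Lebesgue measurable $f\colon(0,\infty)\to[-\infty,\infty]$ and $\mathcal M_+(0,\infty)$ the subset of $[0,\infty]$-valued functions; $\lambda$ is Lebesgue measure. Convention: $0\cdot\infty=0$. The nonincreasing rearrangement of $f$ is $f^*(x):=\inf\{t\in[0,\infty):\lambda(\{|f|>t\})\le x\}$, $x\in[0,\infty)$. A rearrangement-invariant norm is a functional $\rho\colon\mathcal M_+(0,\infty)\to[0,\infty]$ such that for all $f,g,f_j\in\mathcal M_+(0,\infty)$ and $a\in[0,\infty)$: (P1) $\rho(f)=0$ iff $f=0$ a.e., $\rho(af)=a\rho(f)$, $\rho(f+g)\le\rho(f)+\rho(g)$; (P2) $f\le g$ a.e. implies $\rho(f)\le\rho(g)$; (P3) $f_j\nearrow f$ a.e. implies $\rho(f_j)\nearrow\rho(f)$; (P4) $\rho(\chi_G)<\infty$ for every $G\subset(0,\infty)$ of finite measure; (P5) for every $G\subset(0,\infty)$ of finite measure there is a constant $C_G$ with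 $\int_Gf\le C_G\rho(f)$ for all $f$; (P6) $\rho(f)=\rho(g)$ whenever $f^*=g^*$. The corresponding rearrangement-invariant space is $X=\{f\in\mathcal M(0,\infty):\rho(|f|)<\infty\}$, with $\|f\|_X:=\rho(|f|)$ for $f\in\mathcal M(0,\infty)$. The associate space $X'$ is given by $\|f\|_{X'}:=\sup\{\int_0^\infty|fg|:g\in X,\|g\|_X\le1\}$, $X'=\{f\in\mathcal M(0,\infty):\|f\|_{X'}<\infty\}$. For a nonincreasing $b\colon(0,\infty)\to[0,\infty)$, not identically zero, put $b(0):=\lim_{t\to0+}b(t)\in(0,\infty]$. The generalized inverse is $b^{-1}(t):=\sup\{s\in(0,\infty):b(s)\ge t\}$ for $t\in(0,b(0))$ and $b^{-1}(t):=0$ for $t\in[b(0),\infty)$. The operator $T_b$ is $T_bf(t):=\int_0^{b(t)}f^*$, $t\in(0,\infty)$, $f\in\mathcal M(0,\infty)$, and $T_{b^{-1}}$ is defined in the same way with $b^{-1}$ in place of $b$ (when $b^{-1}(t)=\infty$, this means $\int_0^\infty f^*$). For a nonincreasing not identically zero function $\beta$ and a rearrangement-invariant space $Z$ with $\min\{1,\beta\}\in Z$, $\Upsilon_{\beta,Z}:=\{f\in\mathcal M(0,\infty):\|T_\beta f\|_Z<\infty\}$ with $\|f\|_{\Upsilon_{\beta,Z}}:=\|T_\beta f\|_Z$ (this is a rearrangement-invariant space). $T\colon X\to Y$ means that $T$ is bounded: there is $C\in(0,\infty)$ with $\|Tf\|_Y\le C\|f\|_X$ for all $f\in X$. $Y\hookrightarrow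 Z$ means there is $C\in(0,\infty)$ with $\|f\|_Z\le C\|f\|_Y$ for all $f\in Y$. $Y$ is a range partner of $X$ with respect to $T$ if $T\colon X\to Y$; it is the optimal range partner in a class of spaces if it belongs to the class, is a range partner, and $Y\hookrightarrow Z$ for every range partner $Z$ of $X$ with respect to $T$ in that class. *)

theory Defs
  imports "HOL-Analysis.Analysis"
begin

text \<open>
  Functions on $(0,\infty)$ are total functions \<open>real \<Rightarrow> ereal\<close> of which only the values on
  \<open>{0<..}\<close> matter: measurability, integrals and almost-everywhere statements all refer to the
  measure \<open>pos_leb\<close>. On \<open>ereal\<close> and \<open>ennreal\<close> the library has \<open>0 * \<infinity> = 0\<close>.
\<close>

type_synonym fn = "real \<Rightarrow> ereal"

abbreviation pos_leb :: "real measure" where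
  "pos_leb \<equiv> lebesgue_on {0<..}"

definition meas_fns :: "fn set" where
  "meas_fns = borel_measurable pos_leb"

definition nonneg_meas_fns :: "fn set" where
  "nonneg_meas_fns = {f \<in> meas_fns. \<forall>t>0. 0 \<le> f t}"

text \<open>Nonincreasing rearrangement; the infimum of the empty set is \<open>\<infinity>\<close>.\<close>

definition rearr :: "fn \<Rightarrow> fn" where
  "rearr f x = Inf {ereal t | t. 0 \<le> t \<and>
     emeasure pos_leb {s \<in> {0<..}. ereal t < \<bar>f s\<bar>} \<le> ennreal x}"

definition ri_norm :: "(fn \<Rightarrow> ennreal) \<Rightarrow> bool" where
  "ri_norm \<rho> \<longleftrightarrow>
     (\<forall>f\<in>nonneg_meas_fns. \<rho> f = 0 \<longleftrightarrow> (AE t in pos_leb. f t = 0)) \<and>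
     (\<forall>f\<in>nonneg_meas_fns. \<forall>a\<ge>0. \<rho> (\<lambda>t. ereal a * f t) = ennreal a * \<rho> f) \<and>
     (\<forall>f\<in>nonneg_meas_fns. \<forall>g\<in>nonneg_meas_fns. \<rho> (\<lambda>t. f t + g t) \<le> \<rho> f + \<rho> g) \<and>
     (\<forall>f\<in>nonneg_meas_fns. \<forall>g\<in>nonneg_meas_fns.
        (AE t in pos_leb. f t \<le> g t) \<longrightarrow> \<rho> f \<le> \<rho> g) \<and>
     (\<forall>F f. (\<forall>j::nat. F j \<in> nonneg_meas_fns) \<and> f \<in> nonneg_meas_fns \<and>
        (AE t in pos_leb. incseq (\<lambda>j. F j t) \<and> (\<lambda>j. F j t) \<longlonglongrightarrow> f t) \<longrightarrow>
        incseq (\<lambda>j. \<rho> (F j)) \<and> (\<lambda>j. \<rho> (F j)) \<longlonglongrightarrow> \<rho> f) \<and>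
     (\<forall>G\<in>fmeasurable pos_leb. \<rho> (indicator G) < \<infinity>) \<and>
     (\<forall>G\<in>fmeasurable pos_leb. \<exists>C>0. \<forall>f\<in>nonneg_meas_fns.
        (\<integral>\<^sup>+t\<in>G. e2ennreal (f t) \<partial>pos_leb) \<le> ennreal C * \<rho> f) \<and>
     (\<forall>f\<in>nonneg_meas_fns. \<forall>g\<in>nonneg_meas_fns.
        (\<forall>x\<ge>0. rearr f x = rearr g x) \<longrightarrow> \<rho> f = \<rho> g)"

text \<open>
  A function space is represented by its norm, an \<open>[0,\<infinity>]\<close>-valued functional on
  \<open>meas_fns\<close>; the space itself is the set on which this functional is finite.
\<close>

type_synonym fn_space = "fn \<Rightarrow> ennreal"

definition elems :: "fn_space \<Rightarrow> fn set" where
  "elems X = {f \<in> meas_fns. X f < \<infinity>}"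

definition ri_space :: "fn_space \<Rightarrow> bool" where
  "ri_space X \<longleftrightarrow> (\<exists>\<rho>. ri_norm \<rho> \<and> (\<forall>f\<in>meas_fns. X f = \<rho> (\<lambda>t. \<bar>f t\<bar>)))"

definition associate :: "fn_space \<Rightarrow> fn_space" where
  "associate X f =
     (SUP g\<in>{g \<in> elems X. X g \<le> 1}. \<integral>\<^sup>+t. e2ennreal \<bar>f t * g t\<bar> \<partial>pos_leb)"

text \<open>The value at \<open>t > 0\<close>; the limit plays the role of \<open>b(0)\<close> and may be \<open>\<infinity>\<close>.\<close>

definition gen_inverse :: "(real \<Rightarrow> real) \<Rightarrow> fn" where
  "gen_inverse b t =
     (if ereal t < Lim (at_right 0) (\<lambda>s. ereal (b s))
      then Sup {ereal s | s. 0 < s \<and> t \<le> b s} else 0)"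

definition T_op :: "fn \<Rightarrow> fn \<Rightarrow> fn" where
  "T_op \<beta> f t = enn2ereal (\<integral>\<^sup>+s\<in>{s. ereal s < \<beta> t}. e2ennreal (rearr f s) \<partial>pos_leb)"

definition Upsilon :: "fn \<Rightarrow> fn_space \<Rightarrow> fn_space" where
  "Upsilon \<beta> Z f = Z (T_op \<beta> f)"

definition bounded_op :: "(fn \<Rightarrow> fn) \<Rightarrow> fn_space \<Rightarrow> fn_space \<Rightarrow> bool" where
  "bounded_op T X Y \<longleftrightarrow> (\<exists>C>0. \<forall>f\<in>elems X. Y (T f) \<le> ennreal C * X f)"

definition embeds :: "fn_space \<Rightarrow> fn_space \<Rightarrow> bool" where
  "embeds Y Z \<longleftrightarrow> (\<exists>C>0. \<forall>f\<in>elems Y. Z f \<le> ennreal C * Y f)"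

definition range_partner :: "(fn \<Rightarrow> fn) \<Rightarrow> fn_space \<Rightarrow> fn_space \<Rightarrow> bool" where
  "range_partner T X Y \<longleftrightarrow> bounded_op T X Y"

definition optimal_range_partner ::
    "fn_space set \<Rightarrow> (fn \<Rightarrow> fn) \<Rightarrow> fn_space \<Rightarrow> fn_space \<Rightarrow> bool" where
  "optimal_range_partner \<C> T X Y \<longleftrightarrow>
     Y \<in> \<C> \<and> range_partner T X Y \<and> (\<forall>Z\<in>\<C>. range_partner T X Z \<longrightarrow> embeds Y Z)"

end

theory Submission imports Defs begin

text \<open>
  For nonnegative \<open>u\<close>, \<open>v\<close> the operators \<open>T\<^sub>b\<close> and \<open>T\<^sub>\<beta>\<close> with \<open>\<beta> = b\<^sup>-\<^sup>1\<close> are adjoint on rearrangements: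
  \<open>\<integral> T\<^sub>b u v\<^sup>* = \<integral> u\<^sup>* T\<^sub>\<beta> v\<close>. With the Hardy-Littlewood inequality for one nonincreasing factor this gives the
  boundedness of \<open>T\<^sub>b\<close> into the associate of \<open>\<Upsilon>\<^bsub>\<beta>,X'\<^esub>\<close>, and it shows that \<open>T\<^sub>b : X \<rightarrow> Z\<close> implies
  \<open>\<parallel>T\<^sub>\<beta> v\<parallel>\<^bsub>X'\<^esub> \<le> C \<parallel>v\<parallel>\<^bsub>Z'\<^esub>\<close>. Optimality follows by duality from \<open>\<parallel>w\<parallel>\<^bsub>Z\<^esub> \<le> \<parallel>w\<parallel>\<^bsub>Z''\<^esub>\<close>, and nonexistence from
  \<open>v = \<chi>\<^bsub>(0,1)\<^esub>\<close>, for which \<open>T\<^sub>\<beta> v = min 1 \<beta>\<close>.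

  Replacing \<open>u\<close> on a set of finite measure by its mean does not increase a rearrangement-invariant norm:
  the mean is approximated by the average of the cyclic shifts of a sorted equipartition, and these
  shifts are equimeasurable. Averaging over the level sets of simple functions reduces \<open>\<parallel>w\<parallel>\<^bsub>Z\<^esub> \<le> \<parallel>w\<parallel>\<^bsub>Z''\<^esub>\<close> to
  the finite-dimensional Hahn-Banach theorem, and it yields the rearrangement invariance of associate norms.
\<close>

section \<open>Lebesgue measure on the half-line\<close>

text \<open>The obstacle is the rearrangement invariance of associate norms. They are suprema over
  test functions in fixed positions, while equimeasurability compares only distributions, so a test
  function has to be carried from the level sets of one function to those of another. Averaging does
  this without a measure-preserving map: a function that is constant on finitely many disjoint sets
  may be placed on any disjoint sets of the same measures. Simple functions that lie strictly below
  \<open>u\<close> on their pieces leave room to find these places in the level sets of the other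
  function. The same averaging turns a functional on finitely many coefficients into a function of
  associate norm at most 1, because pairing with a piecewise constant function sees only the means
  of the other factor. The work is done for [0,\<infinity>]-valued functions and their distribution
  functions; extended real functions, \<open>rearr\<close> and the spaces of the statement are
  translated afterwards.\<close>

lemma emeasure_pos_leb:
  assumes "E \<in> sets pos_leb"
  shows "emeasure pos_leb E = emeasure lebesgue E"
  using assms by (simp add: emeasure_restrict_space sets_restrict_space_iff)

lemma sets_pos_leb_iff: "E \<in> sets pos_leb \<longleftrightarrow> E \<in> sets lebesgue \<and> E \<subseteq> {0<..}"
  by (auto simp: sets_restrict_space_iff)

lemma borel_measurable_id_pos_leb [measurable]: "(\<lambda>x. x) \<in> borel_measurable pos_leb"
  using id_borel_measurable_lebesgue_on[of "{0<..}"] by (simp add: id_def)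

lemma emeasure_pos_leb_Ioc:
  assumes "0 \<le> x" "x \<le> y"
  shows "emeasure pos_leb {x<..y} = ennreal (y - x)"
  using assms by (subst emeasure_pos_leb) (auto simp: sets_pos_leb_iff)

lemma emeasure_pos_leb_Ioo:
  assumes "0 \<le> x" "x \<le> y"
  shows "emeasure pos_leb {x<..<y} = ennreal (y - x)"
  using assms by (subst emeasure_pos_leb) (auto simp: sets_pos_leb_iff)

interpretation pos_leb: sigma_finite_measure pos_leb
proof (standard, intro exI[of _ "range (\<lambda>n. {0<..<real n})"] conjI ballI)
  show "\<Union> (range (\<lambda>n. {0<..<real n})) = space pos_leb"
    using reals_Archimedean2 by auto
qed (auto simp: sets_pos_leb_iff emeasure_pos_leb_Ioo)

interpretation pos_leb2: pair_sigma_finite pos_leb pos_leb ..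

text \<open>Serves twice: \<open>less_decr_iff\<close> turns the level sets of \<open>decr u\<close>
  into such intervals, which makes \<open>decr u\<close> equimeasurable with \<open>u\<close>, and
  the layer cake formula writes a function value as the length of such an interval, infinite values
  included.\<close>

lemma emeasure_pos_leb_less: "emeasure pos_leb {x. 0 < x \<and> ennreal x < c} = c"
proof (cases c)
  case (real r)
  have "{x. 0 < x \<and> ennreal x < c} = {0<..<r}"
    using real by (auto simp: ennreal_less_iff)
  then show ?thesis using real emeasure_pos_leb_Ioo[of 0 r] by simp
next
  case top
  have "c \<le> emeasure pos_leb {x. 0 < x \<and> ennreal x < c}"
  proof -
    have "ennreal (real n) \<le> emeasure pos_leb {x. 0 < x \<and> ennreal x < c}" for n
    proof -
      have "emeasure pos_leb {0<..<real n} \<le> emeasure pos_leb {x. 0 < x \<and> ennreal x < c}"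
        using top by (intro emeasure_mono) (auto simp: sets_pos_leb_iff greaterThan_def)
      then show ?thesis by (simp add: emeasure_pos_leb_Ioo)
    qed
    then have "emeasure pos_leb {x. 0 < x \<and> ennreal x < c} = top"
      by (metis ennreal_Ex_less_of_nat ennreal_of_nat_eq_real_of_nat leD top.not_eq_extremum)
    then show ?thesis by simp
  qed
  then show ?thesis using top by (simp add: top_unique)
qed

text \<open>Lebesgue measure has no atoms: the measure of \<open>E \<inter> {0<..y}\<close> is
  1-Lipschitz in \<open>y\<close>, starts at 0 and tends to the measure of \<open>E\<close>, so the
  intermediate value theorem applies below the full measure.\<close>

lemma exists_subset_emeasure:
  assumes E: "E \<in> sets pos_leb" and le: "\<delta> \<le> emeasure pos_leb E" and fin: "\<delta> < \<infinity>"
  shows "\<exists>G\<in>sets pos_leb. G \<subseteq> E \<and> emeasure pos_leb G = \<delta>"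
proof (cases "\<delta> = emeasure pos_leb E")
  case True
  then show ?thesis using E by blast
next
  case False
  with le have less: "\<delta> < emeasure pos_leb E" by simp
  define F where "F y = E \<inter> {0<..y}" for y
  have F [measurable]: "F y \<in> sets pos_leb" for y
    unfolding F_def using E by (auto simp: sets_pos_leb_iff)
  have F_fin: "emeasure pos_leb (F y) < \<infinity>" for y
  proof (cases "0 \<le> y")
    case True
    have "emeasure pos_leb (F y) \<le> emeasure pos_leb {0<..y}"
      by (rule emeasure_mono) (auto simp: F_def sets_pos_leb_iff)
    then show ?thesis
      using emeasure_pos_leb_Ioc[of 0 y] True by (simp add: le_less_trans)
  qed (simp add: F_def)
  have "(\<lambda>n. emeasure pos_leb (F (real n))) \<longlonglongrightarrow> emeasure pos_leb (\<Union>n. F (real n))"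
    by (rule Lim_emeasure_incseq) (use F in \<open>auto simp: incseq_def F_def\<close>)
  moreover have "(\<Union>n. F (real n)) = E"
    using E real_arch_simple by (fastforce simp: F_def sets_pos_leb_iff)
  ultimately have "(\<lambda>n. emeasure pos_leb (F (real n))) \<longlonglongrightarrow> emeasure pos_leb E" by simp
  from order_tendstoD(1)[OF this less] obtain n where n: "\<delta> < emeasure pos_leb (F (real n))"
    by (meson eventually_sequentially order_refl)
  have F_step: "measure pos_leb (F z) \<le> measure pos_leb (F y) + (z - y)" if "0 \<le> y" "y \<le> z" for y z
  proof -
    have "emeasure pos_leb (F z) \<le> emeasure pos_leb (F y \<union> {y<..z})"
      using that E by (intro emeasure_mono sets.Un F) (auto simp: F_def sets_pos_leb_iff)
    also have "\<dots> \<le> emeasure pos_leb (F y) + emeasure pos_leb {y<..z}"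
      using that by (intro emeasure_subadditive F) (auto simp: sets_pos_leb_iff)
    finally have "emeasure pos_leb (F z) \<le> emeasure pos_leb (F y) + ennreal (z - y)"
      using that by (simp add: emeasure_pos_leb_Ioc)
    then show ?thesis
      using that F_fin[of y] F_fin[of z]
      by (simp add: emeasure_eq_ennreal_measure less_top flip: ennreal_plus)
  qed
  have F_mono: "measure pos_leb (F y) \<le> measure pos_leb (F z)" if "y \<le> z" for y z
    using that F_fin[of z] by (intro measure_mono_fmeasurable) (auto simp: F_def fmeasurable_def E[unfolded sets_pos_leb_iff] sets_pos_leb_iff)
  have "continuous_on {0..real n} (\<lambda>y. measure pos_leb (F y))"
  proof (rule continuous_onI)
    fix x e :: real assume "x \<in> {0..real n}" "0 < e"
    then show "\<exists>d>0. \<forall>x'\<in>{0..real n}. dist x' x < d \<longrightarrow>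
        dist (measure pos_leb (F x')) (measure pos_leb (F x)) \<le> e"
    proof (intro exI[of _ e] conjI ballI impI)
      fix y assume "y \<in> {0..real n}" "dist y x < e"
      then show "dist (measure pos_leb (F y)) (measure pos_leb (F x)) \<le> e"
        using F_step[of x y] F_step[of y x] F_mono[of x y] F_mono[of y x] \<open>x \<in> _\<close>
        by (cases "x \<le> y") (auto simp: dist_real_def)
    qed
  qed
  moreover have "measure pos_leb (F 0) \<le> enn2real \<delta>" by (simp add: F_def)
  moreover have "enn2real \<delta> \<le> measure pos_leb (F (real n))"
    using n F_fin[of n] by (simp add: measure_def enn2real_mono less_imp_le)
  ultimately obtain y where "measure pos_leb (F y) = enn2real \<delta>"
    using IVT'[of "\<lambda>y. measure pos_leb (F y)" 0 "enn2real \<delta>" "real n"] by auto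
  then have "emeasure pos_leb (F y) = \<delta>"
    using F_fin[of y] fin by (simp add: emeasure_eq_ennreal_measure less_top)
  then show ?thesis using F[of y] by (auto simp: F_def)
qed

lemma exists_emeasure_between:
  assumes "A \<in> sets pos_leb" "E \<in> sets pos_leb" "A \<subseteq> E"
    and "emeasure pos_leb A \<le> \<delta>" "\<delta> \<le> emeasure pos_leb E" "\<delta> < \<infinity>"
  shows "\<exists>G\<in>sets pos_leb. A \<subseteq> G \<and> G \<subseteq> E \<and> emeasure pos_leb G = \<delta>"
proof -
  have A_fin: "emeasure pos_leb A \<noteq> \<infinity>" using assms(4,6) by auto
  have "\<delta> - emeasure pos_leb A \<le> emeasure pos_leb (E - A)"
    using assms A_fin by (subst emeasure_Diff) (auto intro: ennreal_minus_mono)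
  then obtain G where G: "G \<in> sets pos_leb" "G \<subseteq> E - A" "emeasure pos_leb G = \<delta> - emeasure pos_leb A"
    using exists_subset_emeasure[of "E - A" "\<delta> - emeasure pos_leb A"] assms
    by (auto simp: le_less_trans[OF diff_le_self_ennreal])
  have "emeasure pos_leb (A \<union> G) = \<delta>"
    using plus_emeasure[of A pos_leb G] G assms A_fin
    by (auto simp: add_diff_inverse_ennreal)
  then show ?thesis using G assms by (intro bexI[of _ "A \<union> G"]) auto
qed

section \<open>Distribution functions and decreasing rearrangements\<close>

definition distr_fn :: "(real \<Rightarrow> ennreal) \<Rightarrow> ennreal \<Rightarrow> ennreal" where
  "distr_fn u t = emeasure pos_leb {x. 0 < x \<and> t < u x}"

text \<open>The rearrangement of a [0,\<infinity>]-valued function. Thresholds range over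
  \<open>ennreal\<close>, where \<infinity> always qualifies, so the infimum is over a nonempty set;
  \<open>rearr_eq_decr\<close> gives the link to \<open>rearr\<close>.\<close>

definition decr :: "(real \<Rightarrow> ennreal) \<Rightarrow> real \<Rightarrow> ennreal" where
  "decr u x = Inf {t. distr_fn u t \<le> ennreal x}"

lemma level_set_pos_leb [measurable]:
  fixes u :: "real \<Rightarrow> ennreal"
  assumes [measurable]: "u \<in> borel_measurable pos_leb"
  shows "{x. 0 < x \<and> t < u x} \<in> sets pos_leb"
proof -
  have "{x \<in> space pos_leb. t < u x} \<in> sets pos_leb" by measurable
  then show ?thesis by simp
qed

lemma distr_fn_mono_AE:
  assumes "u \<in> borel_measurable pos_leb" "v \<in> borel_measurable pos_leb" "AE x in pos_leb. u x \<le> v x"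
  shows "distr_fn u t \<le> distr_fn v t"
  unfolding distr_fn_def using assms by (intro emeasure_mono_AE) (auto elim!: eventually_mono)

lemma distr_fn_antimono:
  assumes "u \<in> borel_measurable pos_leb" "s \<le> t"
  shows "distr_fn u t \<le> distr_fn u s"
  unfolding distr_fn_def using assms by (intro emeasure_mono) auto

lemma distr_fn_SUP:
  fixes U :: "nat \<Rightarrow> real \<Rightarrow> ennreal"
  assumes "\<And>j. U j \<in> borel_measurable pos_leb" "incseq U"
  shows "distr_fn (\<lambda>x. SUP j. U j x) t = (SUP j. distr_fn (U j) t)"
proof -
  have "{x. 0 < x \<and> t < (SUP j. U j x)} = (\<Union>j. {x. 0 < x \<and> t < U j x})"
    by (auto simp: less_SUP_iff)
  moreover have "incseq (\<lambda>j. {x. 0 < x \<and> t < U j x})"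
    using assms(2) by (auto simp: incseq_def le_fun_def intro: less_le_trans)
  ultimately show ?thesis
    unfolding distr_fn_def using assms(1)
    by (subst SUP_emeasure_incseq) auto
qed

text \<open>The direction from right to left is the right-continuity of the distribution function.
  With strict inequalities on both sides the equivalence has no exceptions at jumps, so facts about
  \<open>decr\<close> can be checked level by level.\<close>

lemma less_decr_iff:
  assumes u: "u \<in> borel_measurable pos_leb"
  shows "t < decr u x \<longleftrightarrow> ennreal x < distr_fn u t"
proof
  assume "t < decr u x"
  show "ennreal x < distr_fn u t"
  proof (rule ccontr)
    assume "\<not> ennreal x < distr_fn u t"
    then have "decr u x \<le> t" unfolding decr_def by (intro Inf_lower) auto
    with \<open>t < decr u x\<close> show False by simp
  qed
next
  assume less: "ennreal x < distr_fn u t"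
  show "t < decr u x"
  proof (rule ccontr)
    assume "\<not> t < decr u x"
    then have le: "decr u x \<le> t" by simp
    \<comment> \<open>The level set for the threshold \<infinity> is empty. Finiteness of
      \<open>t\<close> lets the thresholds \<open>e n\<close> exceed it strictly while decreasing to
      it.\<close>
    have "t < top" using less by (auto simp: less_top[symmetric] distr_fn_def)
    define e where "e n = t + ennreal (1 / real (Suc n))" for n
    have "distr_fn u (e n) \<le> ennreal x" for n
    proof -
      have "t < e n" using \<open>t < top\<close> by (simp add: e_def ennreal_add_left_cancel_less flip: less_top)
      with le have "decr u x < e n" by simp
      then obtain s where "distr_fn u s \<le> ennreal x" "s < e n"
        unfolding decr_def Inf_less_iff by auto
      with distr_fn_antimono[OF u, of s "e n"] show ?thesis by (meson less_imp_le order_trans)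
    qed
    moreover have "distr_fn u t = (SUP n. distr_fn u (e n))"
    proof -
      have lim: "e \<longlonglongrightarrow> t + 0"
        unfolding e_def
        by (intro tendsto_add tendsto_const)
           (use LIMSEQ_inverse_real_of_nat in \<open>auto simp: tendsto_ennreal_iff inverse_eq_divide simp flip: ennreal_0\<close>)
      have "{x. 0 < x \<and> t < u x} = (\<Union>n. {x. 0 < x \<and> e n < u x})"
      proof safe
        fix y assume "t < u y" "0 < y"
        then have "\<exists>n. e n < u y"
          using order_tendstoD(2)[OF lim, of "u y"] by (auto simp: eventually_sequentially)
        then show "y \<in> (\<Union>n. {x. 0 < x \<and> e n < u x})" using \<open>0 < y\<close> by auto
      next
        fix y n assume "e n < u y"
        moreover have "t \<le> e n" by (simp add: e_def)
        ultimately show "t < u y" by simp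
      qed
      moreover have "incseq (\<lambda>n. {x. 0 < x \<and> e n < u x})"
      proof -
        have "e n \<le> e m" if "m \<le> n" for m n
          using that by (auto simp: e_def frac_le intro!: add_left_mono ennreal_leI)
        then show ?thesis by (auto simp: incseq_def intro: le_less_trans)
      qed
      ultimately show ?thesis
        unfolding distr_fn_def using u by (subst SUP_emeasure_incseq) auto
    qed
    ultimately have "distr_fn u t \<le> ennreal x" by (simp add: SUP_le_iff)
    with less show False by simp
  qed
qed

lemma decr_antimono: "x \<le> y \<Longrightarrow> decr u y \<le> decr u x"
  unfolding decr_def by (intro Inf_superset_mono) (auto intro: order_trans ennreal_leI)

lemma borel_measurable_pos_leb_antimono:
  fixes f :: "real \<Rightarrow> 'a :: {linorder_topology, second_countable_topology}"
  assumes "\<And>x y. 0 < x \<Longrightarrow> x \<le> y \<Longrightarrow> f y \<le> f x"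
  shows "f \<in> borel_measurable pos_leb"
proof (rule borel_measurableI_greater)
  fix a
  let ?S = "{x. 0 < x \<and> a < f x}"
  have "is_interval ?S"
    unfolding is_interval_1 using assms by (auto intro: less_le_trans)
  then have "?S \<in> sets borel"
    by (rule real_interval_borel_measurable)
  then show "{x \<in> space pos_leb. a < f x} \<in> sets pos_leb"
    by (auto simp: sets_pos_leb_iff)
qed

lemma measurable_decr [measurable]: "decr u \<in> borel_measurable pos_leb"
  by (rule borel_measurable_pos_leb_antimono) (simp add: decr_antimono)

lemma distr_fn_decr [simp]:
  assumes "u \<in> borel_measurable pos_leb"
  shows "distr_fn (decr u) t = distr_fn u t"
  using emeasure_pos_leb_less[of "distr_fn u t"]
  by (simp add: distr_fn_def[of "decr u"] less_decr_iff[OF assms])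

lemma decr_mono: "(\<And>t. distr_fn u t \<le> distr_fn v t) \<Longrightarrow> decr u x \<le> decr v x"
  unfolding decr_def by (intro Inf_superset_mono) (auto intro: order_trans)

lemma decr_SUP:
  fixes U :: "nat \<Rightarrow> real \<Rightarrow> ennreal"
  assumes U [measurable]: "\<And>j. U j \<in> borel_measurable pos_leb" and inc: "incseq U"
  shows "decr (\<lambda>x. SUP j. U j x) x = (SUP j. decr (U j) x)"
proof -
  have "t < decr (\<lambda>x. SUP j. U j x) x \<longleftrightarrow> t < (SUP j. decr (U j) x)" for t
    by (simp add: less_decr_iff distr_fn_SUP[OF U inc] less_SUP_iff)
  then show ?thesis by (metis linorder_neqE nless_le)
qed

text \<open>Each value \<open>v x\<close> is the length of the interval of all \<open>t\<close>
  below it; Tonelli does the rest. The weight \<open>u\<close> lets the Hardy-Littlewood inequality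
  be reduced to the level sets of \<open>v\<close>.\<close>

lemma nn_integral_layer_cake_weighted:
  assumes [measurable]: "u \<in> borel_measurable pos_leb" "v \<in> borel_measurable pos_leb"
  shows "(\<integral>\<^sup>+x. v x * u x \<partial>pos_leb) =
    (\<integral>\<^sup>+t. (\<integral>\<^sup>+x. u x * indicator {x. 0 < x \<and> ennreal t < v x} x \<partial>pos_leb) \<partial>pos_leb)"
proof -
  have "v x = (\<integral>\<^sup>+t. indicator {t. 0 < t \<and> ennreal t < v x} t \<partial>pos_leb)" for x
    by (subst nn_integral_indicator) (auto simp: emeasure_pos_leb_less sets_pos_leb_iff)
  then have "(\<integral>\<^sup>+x. v x * u x \<partial>pos_leb) =
    (\<integral>\<^sup>+x. (\<integral>\<^sup>+t. indicator {t. 0 < t \<and> ennreal t < v x} t \<partial>pos_leb) * u x \<partial>pos_leb)"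
    by simp
  also have "\<dots> = (\<integral>\<^sup>+x. (\<integral>\<^sup>+t. u x * indicator {t. ennreal t < v x} t \<partial>pos_leb) \<partial>pos_leb)"
    by (intro nn_integral_cong, subst nn_integral_multc[symmetric])
       (auto intro!: nn_integral_cong simp: indicator_def)
  also have "\<dots> = (\<integral>\<^sup>+t. (\<integral>\<^sup>+x. u x * indicator {t. ennreal t < v x} t \<partial>pos_leb) \<partial>pos_leb)"
    by (rule pos_leb2.Fubini'[symmetric]) measurable
  also have "\<dots> = (\<integral>\<^sup>+t. (\<integral>\<^sup>+x. u x * indicator {x. 0 < x \<and> ennreal t < v x} x \<partial>pos_leb) \<partial>pos_leb)"
    by (intro nn_integral_cong) (auto simp: indicator_def)
  finally show ?thesis .
qed

lemma nn_integral_distr_fn: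
  assumes [measurable]: "v \<in> borel_measurable pos_leb"
  shows "(\<integral>\<^sup>+x. v x \<partial>pos_leb) = (\<integral>\<^sup>+t. distr_fn v (ennreal t) \<partial>pos_leb)"
  using nn_integral_layer_cake_weighted[of "\<lambda>_. 1" v] by (simp add: distr_fn_def)

lemma nn_integral_mono_distr_fn:
  assumes "u \<in> borel_measurable pos_leb" "v \<in> borel_measurable pos_leb"
    and "\<And>t. distr_fn u t \<le> distr_fn v t"
  shows "(\<integral>\<^sup>+x. u x \<partial>pos_leb) \<le> (\<integral>\<^sup>+x. v x \<partial>pos_leb)"
  unfolding nn_integral_distr_fn[OF assms(1)] nn_integral_distr_fn[OF assms(2)]
  by (rule nn_integral_mono) (rule assms(3))

text \<open>The restriction of \<open>u\<close> to \<open>E\<close> has level sets of measure at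
  most the minimum of the measure of \<open>E\<close> and \<open>distr_fn u\<close>, and this
  minimum is exactly the distribution function of \<open>decr u\<close> cut off at the measure of
  \<open>E\<close>.\<close>

lemma nn_integral_le_decr:
  assumes u [measurable]: "u \<in> borel_measurable pos_leb" and E [measurable]: "E \<in> sets pos_leb"
  shows "(\<integral>\<^sup>+x\<in>E. u x \<partial>pos_leb) \<le> (\<integral>\<^sup>+x\<in>{x. ennreal x < emeasure pos_leb E}. decr u x \<partial>pos_leb)"
proof (rule nn_integral_mono_distr_fn)
  let ?J = "{x. ennreal x < emeasure pos_leb E}"
  fix t
  have "distr_fn (\<lambda>x. u x * indicator E x) t \<le> min (emeasure pos_leb E) (distr_fn u t)"
    unfolding distr_fn_def by (intro min.boundedI emeasure_mono) (auto simp: indicator_def split: if_splits)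
  also have "\<dots> = distr_fn (\<lambda>x. decr u x * indicator ?J x) t"
  proof -
    have "{x. 0 < x \<and> t < decr u x * indicator ?J x} = {x. 0 < x \<and> ennreal x < min (emeasure pos_leb E) (distr_fn u t)}"
      by (auto simp: indicator_def less_decr_iff)
    then show ?thesis by (simp only: distr_fn_def emeasure_pos_leb_less)
  qed
  finally show "distr_fn (\<lambda>x. u x * indicator E x) t \<le> distr_fn (\<lambda>x. decr u x * indicator ?J x) t" .
qed measurable

text \<open>Level sets of a nonincreasing function are initial intervals, so the layer cake formula
  reduces this to characteristic functions.\<close>

lemma Hardy_Littlewood_antimono:
  assumes [measurable]: "u \<in> borel_measurable pos_leb"
    and anti: "\<And>x y. 0 < x \<Longrightarrow> x \<le> y \<Longrightarrow> v y \<le> v x"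
  shows "(\<integral>\<^sup>+x. v x * u x \<partial>pos_leb) \<le> (\<integral>\<^sup>+x. v x * decr u x \<partial>pos_leb)"
proof -
  have [measurable]: "v \<in> borel_measurable pos_leb"
    using anti by (rule borel_measurable_pos_leb_antimono)
  let ?E = "\<lambda>t. {x. 0 < x \<and> ennreal t < v x}"
  have level: "(\<integral>\<^sup>+x\<in>?E t. u x \<partial>pos_leb) \<le> (\<integral>\<^sup>+x\<in>?E t. decr u x \<partial>pos_leb)" for t
  proof -
    \<comment> \<open>The initial interval of the same measure lies inside the level set: a point
      \<open>x\<close> outside confines the level set of the nonincreasing \<open>v\<close> to
      \<open>{0<..<x}\<close>, so its measure is at most \<open>x\<close>.\<close>
    have *: "x \<in> ?E t" if "0 < x" "ennreal x < emeasure pos_leb (?E t)" for x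
    proof (rule ccontr)
      assume "x \<notin> ?E t"
      then have "?E t \<subseteq> {0<..<x}"
        using that anti by (auto simp: not_less) (meson leD le_less_trans linorder_not_less order_trans)
      then have "emeasure pos_leb (?E t) \<le> emeasure pos_leb {0<..<x}"
        by (intro emeasure_mono) (auto simp: sets_pos_leb_iff)
      with that show False by (simp add: emeasure_pos_leb_Ioo)
    qed
    have "(\<integral>\<^sup>+x\<in>?E t. u x \<partial>pos_leb) \<le> (\<integral>\<^sup>+x\<in>{x. ennreal x < emeasure pos_leb (?E t)}. decr u x \<partial>pos_leb)"
      by (rule nn_integral_le_decr) auto
    also have "\<dots> \<le> (\<integral>\<^sup>+x\<in>?E t. decr u x \<partial>pos_leb)"
      using * by (intro nn_integral_mono) (auto simp: indicator_def)
    finally show ?thesis .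
  qed
  have "(\<integral>\<^sup>+t. (\<integral>\<^sup>+x\<in>?E t. u x \<partial>pos_leb) \<partial>pos_leb) \<le>
      (\<integral>\<^sup>+t. (\<integral>\<^sup>+x\<in>?E t. decr u x \<partial>pos_leb) \<partial>pos_leb)"
    by (rule nn_integral_mono) (rule level)
  then show ?thesis
    by (simp only: nn_integral_layer_cake_weighted[of u v] nn_integral_layer_cake_weighted[of "decr u" v]
      measurable_decr assms(1) \<open>v \<in> borel_measurable pos_leb\<close>)
qed

section \<open>Sets of prescribed measure\<close>

text \<open>With \<open>c\<close> the value at \<delta> of the rearrangement of \<open>u\<close> on
  \<open>F\<close>, the part of \<open>F\<close> where \<open>u > c\<close> has measure at most
  \<delta> and the part where \<open>u \<ge> c\<close> has measure at least \<delta>. Any set of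
  measure \<delta> between the two will do; ties at \<open>c\<close> are cut arbitrarily.\<close>

lemma exists_top_part:
  fixes u :: "real \<Rightarrow> ennreal"
  assumes u [measurable]: "u \<in> borel_measurable pos_leb" and F [measurable]: "F \<in> sets pos_leb"
    and fin: "emeasure pos_leb F < \<infinity>" and le: "\<delta> \<le> emeasure pos_leb F"
  shows "\<exists>G\<in>sets pos_leb. G \<subseteq> F \<and> emeasure pos_leb G = \<delta> \<and> (\<forall>x\<in>G. \<forall>y\<in>F - G. u y \<le> u x)"
proof -
  have F_pos: "F \<subseteq> {0<..}" using F by (simp add: sets_pos_leb_iff)
  define w where "w x = u x * indicator F x" for x
  have [measurable]: "w \<in> borel_measurable pos_leb" unfolding w_def by measurable
  have \<delta>_fin: "\<delta> < \<infinity>" using le fin by (rule le_less_trans)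
  define c where "c = decr w (enn2real \<delta>)"
  have less_c: "t < c \<longleftrightarrow> \<delta> < distr_fn w t" for t
    unfolding c_def using \<delta>_fin by (simp add: less_decr_iff)
  have [measurable]: "{x \<in> F. c < u x} \<in> sets pos_leb" "{x \<in> F. c \<le> u x} \<in> sets pos_leb"
  proof -
    have "{x \<in> space pos_leb. c < u x} \<inter> F \<in> sets pos_leb" "{x \<in> space pos_leb. c \<le> u x} \<inter> F \<in> sets pos_leb"
      by measurable
    moreover have "{x \<in> space pos_leb. c < u x} \<inter> F = {x \<in> F. c < u x}" "{x \<in> space pos_leb. c \<le> u x} \<inter> F = {x \<in> F. c \<le> u x}"
      using F_pos by auto
    ultimately show "{x \<in> F. c < u x} \<in> sets pos_leb" "{x \<in> F. c \<le> u x} \<in> sets pos_leb" by simp_all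
  qed
  have w_level: "{x. 0 < x \<and> t < w x} = {x \<in> F. t < u x}" for t
    using F_pos by (auto simp: w_def indicator_def split: if_splits)
  have lower: "emeasure pos_leb {x \<in> F. c < u x} \<le> \<delta>"
    using less_c[of c] by (simp add: distr_fn_def w_level)
  have upper: "\<delta> \<le> emeasure pos_leb {x \<in> F. c \<le> u x}"
  proof (cases "c = 0")
    case True
    then show ?thesis using le by simp
  next
    case False
    then have "0 \<in> {..<c}" by (simp add: zero_less_iff_neq_zero)
    then have "{..<c} \<noteq> {}" by blast
    from ennreal_Sup_countable_SUP[OF this] obtain s where s: "incseq s" "range s \<subseteq> {..<c}" "Sup {..<c} = (SUP n. s n)"
      by blast
    have s_less: "s n < c" for n using s(2) by auto
    have s_sup: "(SUP n. s n) = c" using s(3) by (simp add: Sup_lessThan)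
    have s_meas: "{x \<in> F. s n < u x} \<in> sets pos_leb" for n
      using level_set_pos_leb[of w "s n"] by (simp add: w_level)
    \<comment> \<open>Strict thresholds increasing to \<open>c\<close> describe the nonstrict level
      set as a decreasing intersection; the finite measure of \<open>F\<close> gives continuity from
      above.\<close>
    have "{x \<in> F. c \<le> u x} = (\<Inter>n. {x \<in> F. s n < u x})"
      using s_less by (auto intro: less_le_trans) (metis SUP_least less_imp_le s_sup)
    moreover have "decseq (\<lambda>n. {x \<in> F. s n < u x})"
      using s(1) by (auto simp: decseq_def incseq_def intro: le_less_trans)
    moreover have "emeasure pos_leb {x \<in> F. s n < u x} \<noteq> \<infinity>" for n
    proof -
      have "emeasure pos_leb {x \<in> F. s n < u x} \<le> emeasure pos_leb F" by (intro emeasure_mono) auto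
      with fin show ?thesis by auto
    qed
    ultimately have "emeasure pos_leb {x \<in> F. c \<le> u x} = (INF n. emeasure pos_leb {x \<in> F. s n < u x})"
      using s_meas by (subst INF_emeasure_decseq) auto
    moreover have "\<delta> \<le> emeasure pos_leb {x \<in> F. s n < u x}" for n
      using less_c[of "s n"] s_less[of n] by (simp add: distr_fn_def w_level)
    ultimately show ?thesis by (simp add: INF_greatest)
  qed
  obtain G where "G \<in> sets pos_leb" "{x \<in> F. c < u x} \<subseteq> G" "G \<subseteq> {x \<in> F. c \<le> u x}" "emeasure pos_leb G = \<delta>"
    using exists_emeasure_between[OF _ _ _ lower upper \<delta>_fin] by (fastforce intro: less_imp_le)
  moreover from this have "\<forall>x\<in>G. \<forall>y\<in>F - G. u y \<le> u x"
    by (metis (no_types, lifting) Diff_iff linorder_not_less mem_Collect_eq order_trans subsetD)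
  ultimately show ?thesis by blast
qed

text \<open>Top parts of measure \<delta> are peeled off one after the other. The guard
  \<open>0 < n\<close> reflects that for \<open>n = 0\<close> the set \<open>F\<close> is null but
  possibly nonempty.\<close>

lemma exists_sorted_partition:
  fixes u :: "real \<Rightarrow> ennreal"
  assumes u [measurable]: "u \<in> borel_measurable pos_leb" and "F \<in> sets pos_leb"
    and "emeasure pos_leb F = of_nat n * \<delta>" "\<delta> < \<infinity>"
  shows "\<exists>G. (\<forall>j<n. G j \<in> sets pos_leb \<and> emeasure pos_leb (G j) = \<delta>) \<and>
    disjoint_family_on G {..<n} \<and> (0 < n \<longrightarrow> (\<Union>j<n. G j) = F) \<and>
    (\<forall>i j. i < j \<longrightarrow> j < n \<longrightarrow> (\<forall>x\<in>G i. \<forall>y\<in>G j. u y \<le> u x))"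
  using assms(2,3)
proof (induction n arbitrary: F)
  case 0
  then show ?case by (auto simp: disjoint_family_on_def)
next
  case (Suc n)
  show ?case
  proof (cases "n = 0")
    \<comment> \<open>The last part is the entire remainder, so that the parts cover
      \<open>F\<close> exactly and not merely up to a null set.\<close>
    case True
    with Suc.prems show ?thesis by (intro exI[of _ "\<lambda>_. F"]) (auto simp: disjoint_family_on_def)
  next
    case False
    have fin: "emeasure pos_leb F < \<infinity>" using Suc.prems assms(4) by (simp add: ennreal_mult_less_top of_nat_less_top flip: of_nat_Suc)
    have "1 * \<delta> \<le> of_nat (Suc n) * \<delta>" by (intro mult_right_mono) auto
    then have "\<delta> \<le> emeasure pos_leb F" using Suc.prems by simp
    from exists_top_part[OF u Suc.prems(1) fin this] obtain A where
      A: "A \<in> sets pos_leb" "A \<subseteq> F" "emeasure pos_leb A = \<delta>" "\<forall>x\<in>A. \<forall>y\<in>F - A. u y \<le> u x" by blast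
    have "emeasure pos_leb (F - A) = of_nat n * \<delta>"
      using A Suc.prems assms(4) by (subst emeasure_Diff) (auto simp: distrib_right)
    from Suc.IH[OF _ this] obtain G where G: "\<forall>j<n. G j \<in> sets pos_leb \<and> emeasure pos_leb (G j) = \<delta>"
      "disjoint_family_on G {..<n}" "(\<Union>j<n. G j) = F - A"
      "\<forall>i j. i < j \<longrightarrow> j < n \<longrightarrow> (\<forall>x\<in>G i. \<forall>y\<in>G j. u y \<le> u x)"
      using A(1) Suc.prems(1) False by auto
    have G_sub: "G j \<subseteq> F - A" if "j < n" for j using G(3) that by blast
    let ?G = "case_nat A G"
    have "disjoint_family_on ?G {..<Suc n}"
      unfolding disjoint_family_on_def
    proof (intro ballI impI)
      fix i j assume "i \<in> {..<Suc n}" "j \<in> {..<Suc n}" "i \<noteq> j"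
      then show "?G i \<inter> ?G j = {}"
        using G_sub G(2) by (cases i; cases j) (auto simp: disjoint_family_on_def)
    qed
    moreover have "(\<Union>j<Suc n. ?G j) = F"
      using G(3) A(2) by (simp add: lessThan_Suc_eq_insert_0 image_image) blast
    moreover have "\<forall>j<Suc n. ?G j \<in> sets pos_leb \<and> emeasure pos_leb (?G j) = \<delta>"
      using G(1) A by (auto split: nat.split)
    moreover have "\<forall>i j. i < j \<longrightarrow> j < Suc n \<longrightarrow> (\<forall>x\<in>?G i. \<forall>y\<in>?G j. u y \<le> u x)"
    proof (intro allI impI ballI)
      fix i j x y assume "i < j" "j < Suc n" "x \<in> ?G i" "y \<in> ?G j"
      then show "u y \<le> u x"
        using G(4) A(4) G_sub[of "j - 1"] by (cases i; cases j) (simp_all, blast)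
    qed
    ultimately show ?thesis by (intro exI[of _ ?G]) auto
  qed
qed

text \<open>A greedy choice from the largest value down. When the smallest value \<open>b\<close> is
  added, all sets chosen so far lie in the level set of \<open>b\<close>, since their values exceed
  \<open>b\<close>, and the bound on the sum of the \<open>m a'\<close> leaves enough measure there
  for one more set.\<close>

lemma exists_disjoint_subsets_levels:
  fixes g :: "real \<Rightarrow> ennreal" and A :: "ennreal set"
  assumes "finite A" and g [measurable]: "g \<in> borel_measurable pos_leb" and "\<And>a. a \<in> A \<Longrightarrow> m a < \<infinity>"
    and "\<And>a. a \<in> A \<Longrightarrow> (\<Sum>a'\<in>{a'\<in>A. a \<le> a'}. m a') \<le> distr_fn g a"
  shows "\<exists>H. (\<forall>a\<in>A. H a \<in> sets pos_leb \<and> emeasure pos_leb (H a) = m a \<and> (\<forall>x\<in>H a. a < g x)) \<and>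
    disjoint_family_on H A"
  using assms(1,3,4)
proof (induction A rule: finite_linorder_min_induct)
  case empty
  then show ?case by (simp add: disjoint_family_on_def)
next
  case (insert b A)
  have "\<exists>H. (\<forall>a\<in>A. H a \<in> sets pos_leb \<and> emeasure pos_leb (H a) = m a \<and> (\<forall>x\<in>H a. a < g x)) \<and> disjoint_family_on H A"
  proof (rule insert.IH)
    fix a assume "a \<in> A"
    then have "{a' \<in> insert b A. a \<le> a'} = {a' \<in> A. a \<le> a'}" using insert.hyps by auto
    then show "(\<Sum>a'\<in>{a'\<in>A. a \<le> a'}. m a') \<le> distr_fn g a" using insert.prems(2)[of a] \<open>a \<in> A\<close> by simp
  qed (use insert.prems in auto)
  then obtain H where H: "\<And>a. a \<in> A \<Longrightarrow> H a \<in> sets pos_leb" "\<And>a. a \<in> A \<Longrightarrow> emeasure pos_leb (H a) = m a"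
    "\<And>a x. a \<in> A \<Longrightarrow> x \<in> H a \<Longrightarrow> a < g x" "disjoint_family_on H A" by blast
  let ?U = "\<Union>a\<in>A. H a"
  have U: "?U \<in> sets pos_leb" using H(1) insert.hyps(1) by auto
  have U_sub: "?U \<subseteq> {x. 0 < x \<and> b < g x}"
  proof safe
    fix x a assume *: "a \<in> A" "x \<in> H a"
    then show "0 < x" using H(1)[of a] by (auto simp: sets_pos_leb_iff)
    show "b < g x" using H(3)[OF *] insert.hyps(2) * by (auto intro: less_trans)
  qed
  have U_eq: "emeasure pos_leb ?U = (\<Sum>a\<in>A. m a)"
    using H insert.hyps(1) by (subst sum_emeasure[symmetric]) auto
  have U_fin: "emeasure pos_leb ?U \<noteq> \<infinity>"
    unfolding U_eq using insert.prems(1) insert.hyps(1) by (simp add: less_top)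
  have "b \<notin> A" using insert.hyps(2) by auto
  have "{a' \<in> insert b A. b \<le> a'} = insert b A" using insert.hyps(2) by auto
  then have "m b + emeasure pos_leb ?U \<le> distr_fn g b"
    using insert.prems(2)[of b] U_eq insert.hyps(1) \<open>b \<notin> A\<close> by simp
  then have "m b \<le> distr_fn g b - emeasure pos_leb ?U"
    using ennreal_minus_mono[of "m b + emeasure pos_leb ?U" "distr_fn g b" "emeasure pos_leb ?U" "emeasure pos_leb ?U"] U_fin
    by simp
  also have "\<dots> = emeasure pos_leb ({x. 0 < x \<and> b < g x} - ?U)"
    using U U_sub U_fin by (subst emeasure_Diff) (auto simp: distr_fn_def)
  finally obtain B where B: "B \<in> sets pos_leb" "B \<subseteq> {x. 0 < x \<and> b < g x} - ?U" "emeasure pos_leb B = m b"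
    using exists_subset_emeasure[of "{x. 0 < x \<and> b < g x} - ?U" "m b"] U insert.prems(1) by auto
  have "disjoint_family_on (H(b := B)) (insert b A)"
    unfolding disjoint_family_on_def
  proof (intro ballI impI)
    fix i j assume "i \<in> insert b A" "j \<in> insert b A" "i \<noteq> j"
    then show "(H(b := B)) i \<inter> (H(b := B)) j = {}"
      using B(2) H(4) by (auto simp: disjoint_family_on_def)
  qed
  then show ?case using H(1-3) B \<open>b \<notin> A\<close>
    by (intro exI[of _ "H(b := B)"] conjI) (blast | force)+
qed

section \<open>Averaging\<close>

text \<open>The axioms (P1)-(P6) for [0,\<infinity>]-valued functions, with monotone limits taken
  pointwise everywhere and (P6) expressed by distribution functions. By \<open>ri_space_iff\<close>
  exactly the rearrangement-invariant spaces arise from such norms.\<close>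

locale ri_fn_norm =
  fixes N :: "(real \<Rightarrow> ennreal) \<Rightarrow> ennreal"
  assumes eq_0_iff: "u \<in> borel_measurable pos_leb \<Longrightarrow> N u = 0 \<longleftrightarrow> (AE x in pos_leb. u x = 0)"
    and scale_real: "u \<in> borel_measurable pos_leb \<Longrightarrow> 0 \<le> a \<Longrightarrow> N (\<lambda>x. ennreal a * u x) = ennreal a * N u"
    and add_le: "u \<in> borel_measurable pos_leb \<Longrightarrow> v \<in> borel_measurable pos_leb \<Longrightarrow>
      N (\<lambda>x. u x + v x) \<le> N u + N v"
    and mono_AE: "u \<in> borel_measurable pos_leb \<Longrightarrow> v \<in> borel_measurable pos_leb \<Longrightarrow>
      (AE x in pos_leb. u x \<le> v x) \<Longrightarrow> N u \<le> N v"
    and SUP_eq: "(\<And>j::nat. U j \<in> borel_measurable pos_leb) \<Longrightarrow> incseq U \<Longrightarrow>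
      N (\<lambda>x. SUP j. U j x) = (SUP j. N (U j))"
    and indicator_finite: "G \<in> sets pos_leb \<Longrightarrow> emeasure pos_leb G < \<infinity> \<Longrightarrow> N (indicator G) < \<infinity>"
    and local_L1: "G \<in> sets pos_leb \<Longrightarrow> emeasure pos_leb G < \<infinity> \<Longrightarrow>
      \<exists>C<\<infinity>. \<forall>u\<in>borel_measurable pos_leb. (\<integral>\<^sup>+x\<in>G. u x \<partial>pos_leb) \<le> C * N u"
    and rearr_invariant: "u \<in> borel_measurable pos_leb \<Longrightarrow> v \<in> borel_measurable pos_leb \<Longrightarrow>
      (\<And>t. distr_fn u t = distr_fn v t) \<Longrightarrow> N u = N v"
begin

lemma mono:
  "u \<in> borel_measurable pos_leb \<Longrightarrow> v \<in> borel_measurable pos_leb \<Longrightarrow> (\<And>x. 0 < x \<Longrightarrow> u x \<le> v x) \<Longrightarrow> N u \<le> N v"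
  by (rule mono_AE) (auto intro!: AE_I2)

lemma cong_AE:
  "u \<in> borel_measurable pos_leb \<Longrightarrow> v \<in> borel_measurable pos_leb \<Longrightarrow> (AE x in pos_leb. u x = v x) \<Longrightarrow> N u = N v"
  by (intro antisym mono_AE) (auto elim: eventually_mono)

lemma cong:
  "u \<in> borel_measurable pos_leb \<Longrightarrow> v \<in> borel_measurable pos_leb \<Longrightarrow> (\<And>x. 0 < x \<Longrightarrow> u x = v x) \<Longrightarrow> N u = N v"
  by (rule cong_AE) (auto intro!: AE_I2)

lemma zero [simp]: "N (\<lambda>_. 0) = 0"
  by (subst eq_0_iff) auto

text \<open>An infinite factor occurs when a head integral is pulled out of a norm. It is the
  monotone limit of the factors \<open>n\<close>, so (P3) covers it.\<close>

lemma scale: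
  assumes u [measurable]: "u \<in> borel_measurable pos_leb"
  shows "N (\<lambda>x. c * u x) = c * N u"
proof (cases c)
  case (real r)
  then show ?thesis using scale_real[OF u] by simp
next
  case top
  have *: "c * z = (SUP n. of_nat n * z)" for z :: ennreal
    using top by (simp add: SUP_mult_right_ennreal[symmetric] ennreal_SUP_of_nat_eq_top)
  have "N (\<lambda>x. c * u x) = N (\<lambda>x. SUP n. of_nat n * u x)" by (simp only: *)
  also have "\<dots> = (SUP n. N (\<lambda>x. of_nat n * u x))"
    by (rule SUP_eq) (auto simp: incseq_def le_fun_def intro: mult_right_mono)
  also have "\<dots> = (SUP n. of_nat n * N u)"
    using scale_real[OF u] by (simp add: ennreal_of_nat_eq_real_of_nat)
  finally show ?thesis by (simp only: *)
qed

lemma sum_le: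
  assumes "\<And>i. i \<in> I \<Longrightarrow> U i \<in> borel_measurable pos_leb"
  shows "N (\<lambda>x. \<Sum>i\<in>I. U i x) \<le> (\<Sum>i\<in>I. N (U i))"
  using assms
proof (induction I rule: infinite_finite_induct)
  case (insert i I)
  have "N (\<lambda>x. \<Sum>j\<in>insert i I. U j x) = N (\<lambda>x. U i x + (\<Sum>j\<in>I. U j x))"
    using insert.hyps by simp
  also have "\<dots> \<le> N (U i) + N (\<lambda>x. \<Sum>j\<in>I. U j x)"
    using insert.prems by (intro add_le borel_measurable_sum) auto
  also have "\<dots> \<le> N (U i) + (\<Sum>j\<in>I. N (U j))"
    using insert by (intro add_left_mono) auto
  finally show ?case using insert.hyps by simp
qed auto

end

declare Bochner_Integration.sum_mult_indicator [simp del]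

section \<open>Cyclic shifts and sums over disjoint families\<close>

lemma sum_mod_shift:
  fixes f :: "nat \<Rightarrow> 'a :: comm_monoid_add"
  assumes "0 < n"
  shows "(\<Sum>j<n. f ((j + r) mod n)) = (\<Sum>j<n. f j)"
proof (rule sum.reindex_bij_betw)
  have "inj_on (\<lambda>j. (j + r) mod n) {..<n}"
  proof (rule linorder_inj_onI')
    fix i j assume *: "i \<in> {..<n}" "j \<in> {..<n}" "i < j"
    show "(i + r) mod n \<noteq> (j + r) mod n"
    proof
      assume "(i + r) mod n = (j + r) mod n"
      then have "n dvd (j + r) - (i + r)"
        using * mod_eq_dvd_iff_nat[of "i + r" "j + r" n] by simp
      then show False using * by (auto dest: dvd_imp_le)
    qed
  qed
  moreover have "(\<lambda>j. (j + r) mod n) ` {..<n} \<subseteq> {..<n}" using assms by auto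
  ultimately show "bij_betw (\<lambda>j. (j + r) mod n) {..<n} {..<n}"
    by (simp add: bij_betw_def endo_inj_surj)
qed

lemma disjoint_family_sum_indicator:
  fixes c :: "'i \<Rightarrow> 'a :: semiring_1"
  assumes "finite A" "disjoint_family_on E A" "a \<in> A" "x \<in> E a"
  shows "(\<Sum>i\<in>A. c i * indicator (E i) x) = c a"
proof -
  have "c i * indicator (E i) x = (if i = a then c i else 0)" if "i \<in> A" for i
    using assms that by (auto simp: disjoint_family_on_def indicator_def)
  then have "(\<Sum>i\<in>A. c i * indicator (E i) x) = (\<Sum>i\<in>A. if i = a then c i else 0)" by simp
  then show ?thesis using assms by simp
qed

lemma set_nn_integral_finite_UN:
  fixes u :: "'a \<Rightarrow> ennreal"
  assumes [measurable]: "u \<in> borel_measurable M" and fin: "finite A" and disj: "disjoint_family_on E A"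
    and E: "\<And>a. a \<in> A \<Longrightarrow> E a \<in> sets M"
  shows "(\<integral>\<^sup>+x\<in>(\<Union>a\<in>A. E a). u x \<partial>M) = (\<Sum>a\<in>A. \<integral>\<^sup>+x\<in>E a. u x \<partial>M)"
proof -
  have [measurable]: "E a \<in> sets M" if "a \<in> A" for a using E that .
  have "(\<integral>\<^sup>+x\<in>(\<Union>a\<in>A. E a). u x \<partial>M) = (\<integral>\<^sup>+x. (\<Sum>a\<in>A. u x * indicator (E a) x) \<partial>M)"
  proof (intro nn_integral_cong)
    fix x
    show "u x * indicator (\<Union>a\<in>A. E a) x = (\<Sum>a\<in>A. u x * indicator (E a) x)"
    proof (cases "x \<in> (\<Union>a\<in>A. E a)")
      case True
      then obtain a where "a \<in> A" "x \<in> E a" by blast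
      then show ?thesis using True disjoint_family_sum_indicator[OF fin disj, of a x "\<lambda>_. u x"] by simp
    next
      case False
      then show ?thesis by (auto intro!: sum.neutral[symmetric])
    qed
  qed
  also have "\<dots> = (\<Sum>a\<in>A. \<integral>\<^sup>+x\<in>E a. u x \<partial>M)"
    by (rule nn_integral_sum) measurable
  finally show ?thesis .
qed

lemma distr_fn_sum_indicator:
  fixes c :: "'i \<Rightarrow> ennreal"
  assumes "finite A" "disjoint_family_on E A" and E: "\<And>a. a \<in> A \<Longrightarrow> E a \<in> sets pos_leb"
  shows "distr_fn (\<lambda>x. \<Sum>a\<in>A. c a * indicator (E a) x) t = (\<Sum>a\<in>A. if t < c a then emeasure pos_leb (E a) else 0)"
proof -
  have *: "{x. 0 < x \<and> t < (\<Sum>a\<in>A. c a * indicator (E a) x)} = (\<Union>a\<in>{a\<in>A. t < c a}. E a)" (is "?L = ?R")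
  proof (intro antisym subsetI)
    fix x assume x: "x \<in> ?L"
    have "\<exists>a\<in>A. x \<in> E a"
    proof (rule ccontr)
      assume "\<not> (\<exists>a\<in>A. x \<in> E a)"
      then have "(\<Sum>a\<in>A. c a * indicator (E a) x) = 0" by (intro sum.neutral) auto
      then show False using x by simp
    qed
    then show "x \<in> ?R" using x disjoint_family_sum_indicator[OF assms(1,2), of _ x c] by auto
  next
    fix x assume "x \<in> ?R"
    then show "x \<in> ?L"
      using E disjoint_family_sum_indicator[OF assms(1,2), of _ x c] by (auto simp: sets_pos_leb_iff)
  qed
  have "distr_fn (\<lambda>x. \<Sum>a\<in>A. c a * indicator (E a) x) t = (\<Sum>a\<in>{a\<in>A. t < c a}. emeasure pos_leb (E a))"
    unfolding distr_fn_def *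
    using assms by (subst sum_emeasure) (auto intro: disjoint_family_on_mono)
  also have "\<dots> = (\<Sum>a\<in>A. if t < c a then emeasure pos_leb (E a) else 0)"
    using assms(1) by (intro sum.mono_neutral_cong_left) auto
  finally show ?thesis .
qed

text \<open>On a null set this is 0 / 0 = 0, so null sets need not be excluded from families of
  averaged sets.\<close>

definition avg :: "(real \<Rightarrow> ennreal) \<Rightarrow> real set \<Rightarrow> ennreal" where
  "avg u F = (\<integral>\<^sup>+x\<in>F. u x \<partial>pos_leb) / emeasure pos_leb F"

lemma avg_mult:
  assumes "u \<in> borel_measurable pos_leb" "F \<in> sets pos_leb" "emeasure pos_leb F < \<infinity>"
  shows "avg u F * emeasure pos_leb F = (\<integral>\<^sup>+x\<in>F. u x \<partial>pos_leb)"
proof (cases "emeasure pos_leb F = 0")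
  case True
  have "(\<integral>\<^sup>+x\<in>F. u x \<partial>pos_leb) = 0"
    using True assms(1,2) by (simp add: nn_integral_null_set null_sets_def)
  then show ?thesis using True by simp
next
  case False
  then show ?thesis
    using assms by (simp add: avg_def ennreal_divide_times divide_eq_0_iff ennreal_mult_divide_eq less_top)
qed

lemma measurable_replace_on [measurable (raw)]:
  assumes [measurable]: "u \<in> borel_measurable pos_leb" "v \<in> borel_measurable pos_leb" "F \<in> sets pos_leb"
  shows "(\<lambda>x. if x \<in> F then u x else v x) \<in> borel_measurable pos_leb"
  by measurable

context ri_fn_norm
begin

text \<open>The shifted functions take on the \<open>M\<close> parts the infima of \<open>u\<close>
  rather than \<open>u\<close> itself. Since the partition is sorted, \<open>u\<close> on a part is
  at most the infimum over the preceding part; passing to infima therefore costs only the bound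
  \<open>B\<close> on the first part, which is \<open>B / M\<close> in the mean and disappears as
  \<open>M\<close> grows.\<close>

lemma average_le_bounded:
  assumes u [measurable]: "u \<in> borel_measurable pos_leb" and F [measurable]: "F \<in> sets pos_leb"
    and fin: "emeasure pos_leb F < \<infinity>" and bound: "\<And>x. x \<in> F \<Longrightarrow> u x \<le> ennreal B" and "0 \<le> B"
  shows "N (\<lambda>x. if x \<in> F then avg u F else u x) \<le> N u"
proof (cases "emeasure pos_leb F = 0")
  case True
  have "AE x in pos_leb. x \<notin> F" using True F by (intro AE_not_in) (auto simp: null_sets_def)
  then show ?thesis by (intro mono_AE) (auto elim!: eventually_mono)
next
  case False
  have step: "N (\<lambda>x. if x \<in> F then avg u F else u x) \<le> N u + ennreal (B / real M) * N (indicator F)"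
    if M: "0 < M" for M
  proof -
    define \<delta> where "\<delta> = emeasure pos_leb F / of_nat M"
    have \<delta>: "of_nat M * \<delta> = emeasure pos_leb F" "\<delta> < \<infinity>"
    proof -
      obtain r where "0 \<le> r" "emeasure pos_leb F = ennreal r"
        using fin by (cases "emeasure pos_leb F") auto
      then show "of_nat M * \<delta> = emeasure pos_leb F" "\<delta> < \<infinity>"
        using M by (auto simp: \<delta>_def divide_ennreal ennreal_of_nat_eq_real_of_nat simp flip: ennreal_mult)
    qed
    have \<delta>0: "\<delta> \<noteq> 0" using False \<delta>(1) by auto
    from exists_sorted_partition[OF u F \<delta>(1)[symmetric] \<delta>(2)] M obtain G where
      G: "\<And>j. j < M \<Longrightarrow> G j \<in> sets pos_leb" "\<And>j. j < M \<Longrightarrow> emeasure pos_leb (G j) = \<delta>"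
        "disjoint_family_on G {..<M}" "(\<Union>j<M. G j) = F"
        "\<And>i j x y. i < j \<Longrightarrow> j < M \<Longrightarrow> x \<in> G i \<Longrightarrow> y \<in> G j \<Longrightarrow> u y \<le> u x" by blast
    have [measurable]: "G j \<in> sets pos_leb" if "j \<in> {..<M}" for j using G(1) that by simp
    define m where "m j = (INF x\<in>G j. u x)" for j
    \<comment> \<open>\<open>w r\<close> puts the infimum of part \<open>j + r\<close> modulo
      \<open>M\<close> on part \<open>j\<close>. In particular \<open>w 0\<close> lies below
      \<open>u\<close>, and the mean of the \<open>w r\<close> over all \<open>r\<close> has the
      constant value \<open>c\<close> on \<open>F\<close>.\<close>
    define w where "w r x = (if x \<in> F then 0 else u x) + (\<Sum>j<M. m ((j + r) mod M) * indicator (G j) x)" for r x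
    have w_meas [measurable]: "w r \<in> borel_measurable pos_leb" for r
      unfolding w_def by measurable
    have w_on: "w r x = m ((j + r) mod M)" if "j < M" "x \<in> G j" for r x j
      using that G(4) disjoint_family_sum_indicator[OF _ G(3), of j x "\<lambda>j. m ((j + r) mod M)"]
      by (auto simp: w_def)
    have w_off: "w r x = u x" if "x \<notin> F" for r x
    proof -
      have "(\<Sum>j<M. m ((j + r) mod M) * indicator (G j) x) = 0"
        using that G(4) by (intro sum.neutral) (auto simp: indicator_def)
      then show ?thesis using that by (simp add: w_def)
    qed
    have distr_w: "distr_fn (w r) t = distr_fn (\<lambda>x. if x \<in> F then 0 else u x) t + (\<Sum>j<M. if t < m j then \<delta> else 0)" for r t
    proof -
      define s where "s x = (\<Sum>j<M. m ((j + r) mod M) * indicator (G j) x)" for x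
      have [measurable]: "s \<in> borel_measurable pos_leb" unfolding s_def by measurable
      have w_s: "w r x = (if x \<in> F then 0 else u x) + s x" for x by (simp add: w_def s_def)
      have s_off: "s x = 0" if "x \<notin> F" for x
        unfolding s_def using that G(4) by (intro sum.neutral) (auto simp: indicator_def)
      then have "{x. 0 < x \<and> t < w r x} = {x. 0 < x \<and> t < (if x \<in> F then 0 else u x)} \<union> {x. 0 < x \<and> t < s x}"
        by (auto simp: w_s)
      moreover have "{x. 0 < x \<and> t < (if x \<in> F then 0 else u x)} \<inter> {x. 0 < x \<and> t < s x} = {}"
        using s_off by auto
      ultimately have "distr_fn (w r) t = distr_fn (\<lambda>x. if x \<in> F then 0 else u x) t + distr_fn s t"
        unfolding distr_fn_def by (subst plus_emeasure) (auto intro!: level_set_pos_leb)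
      also have "distr_fn s t = (\<Sum>j<M. if t < m ((j + r) mod M) then \<delta> else 0)"
        unfolding s_def using G by (subst distr_fn_sum_indicator) (auto intro!: sum.cong)
      also have "\<dots> = (\<Sum>j<M. if t < m j then \<delta> else 0)"
        by (rule sum_mod_shift[OF M, of "\<lambda>j. if t < m j then \<delta> else 0"])
      finally show ?thesis .
    qed
    have N_w: "N (w r) \<le> N u" for r
    proof -
      have "N (w r) = N (w 0)" by (intro rearr_invariant) (auto simp: distr_w)
      also have "\<dots> \<le> N u"
      proof (rule mono)
        fix x :: real
        show "w 0 x \<le> u x"
        proof (cases "x \<in> F")
          case True
          then obtain j where "j < M" "x \<in> G j" using G(4) by auto
          then show ?thesis by (simp add: w_on m_def INF_lower)
        qed (simp add: w_off)
      qed auto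
      finally show ?thesis .
    qed
    define c where "c = (\<Sum>j<M. m j) / of_nat M"
    have avg_le: "avg u F \<le> c + ennreal (B / real M)"
    proof -
      have "(\<integral>\<^sup>+x\<in>F. u x \<partial>pos_leb) = (\<Sum>j<M. \<integral>\<^sup>+x\<in>G j. u x \<partial>pos_leb)"
        using G(1) unfolding G(4)[symmetric] by (intro set_nn_integral_finite_UN G(3)) auto
      also have "\<dots> \<le> (\<Sum>j<M. (if j = 0 then ennreal B else m (j - 1)) * \<delta>)"
      proof (rule sum_mono)
        fix j assume "j \<in> {..<M}"
        then have j: "j < M" by simp
        have "u x \<le> (if j = 0 then ennreal B else m (j - 1))" if "x \<in> G j" for x
          using that j G(4) bound G(5)[of "j - 1" j _ x] by (auto simp: m_def intro!: INF_greatest)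
        then have "(\<integral>\<^sup>+x\<in>G j. u x \<partial>pos_leb) \<le> (\<integral>\<^sup>+x. (if j = 0 then ennreal B else m (j - 1)) * indicator (G j) x \<partial>pos_leb)"
          by (intro nn_integral_mono) (auto simp: indicator_def)
        then show "(\<integral>\<^sup>+x\<in>G j. u x \<partial>pos_leb) \<le> (if j = 0 then ennreal B else m (j - 1)) * \<delta>"
          using G(1,2)[OF j] by (simp add: nn_integral_cmult_indicator)
      qed
      also have "\<dots> = (\<Sum>j<M. if j = 0 then ennreal B else m (j - 1)) * \<delta>"
        by (simp add: sum_distrib_right)
      \<comment> \<open>After the index shift the infimum over the last part is missing on the left;
        leaving it in on the right only enlarges the bound.\<close>
      also have "(\<Sum>j<M. if j = 0 then ennreal B else m (j - 1)) \<le> ennreal B + (\<Sum>j<M. m j)"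
      proof -
        obtain k where k: "M = Suc k" using M gr0_implies_Suc by blast
        show ?thesis unfolding k by (subst sum.lessThan_Suc_shift) (auto intro!: add_left_mono)
      qed
      finally have "(\<integral>\<^sup>+x\<in>F. u x \<partial>pos_leb) \<le> (ennreal B + (\<Sum>j<M. m j)) * \<delta>"
        by (simp add: mult_right_mono)
      then have "avg u F * (of_nat M * \<delta>) \<le> (ennreal B + (\<Sum>j<M. m j)) * \<delta>"
        using avg_mult[OF u F fin] \<delta>(1) by simp
      then have "(avg u F * of_nat M) * \<delta> \<le> (ennreal B + (\<Sum>j<M. m j)) * \<delta>"
        by (simp add: mult.assoc)
      then have "avg u F * of_nat M \<le> ennreal B + (\<Sum>j<M. m j)"
        using \<delta>0 \<delta>(2) by (simp add: ennreal_mult_le_mult_iff mult.commute[of _ \<delta>] less_top)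
      then have "avg u F * of_nat M / of_nat M \<le> (ennreal B + (\<Sum>j<M. m j)) / of_nat M"
        by (rule divide_right_mono_ennreal)
      then show ?thesis
        using M \<open>0 \<le> B\<close> by (simp add: ennreal_mult_divide_eq c_def add_divide_distrib_ennreal add.commute divide_ennreal ennreal_of_nat_eq_real_of_nat)
    qed
    have "N (\<lambda>x. if x \<in> F then c else u x) = N (\<lambda>x. ennreal (1 / real M) * (\<Sum>r<M. w r x))"
    proof (rule cong)
      fix x :: real
      show "(if x \<in> F then c else u x) = ennreal (1 / real M) * (\<Sum>r<M. w r x)"
      proof (cases "x \<in> F")
        case True
        then obtain j where j: "j < M" "x \<in> G j" using G(4) by auto
        then have "(\<Sum>r<M. w r x) = (\<Sum>r<M. m r)"
          using sum_mod_shift[OF M, of m j] by (simp add: w_on add.commute)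
        then show ?thesis using True M
          by (simp add: c_def divide_ennreal_def inverse_ennreal ennreal_of_nat_eq_real_of_nat inverse_eq_divide mult.commute)
      next
        case False
        have "ennreal (1 / real M) * of_nat M = 1"
          using M by (simp add: ennreal_of_nat_eq_real_of_nat flip: ennreal_mult)
        then show ?thesis using False by (simp add: w_off mult.assoc[symmetric])
      qed
    qed measurable
    also have "\<dots> = ennreal (1 / real M) * N (\<lambda>x. \<Sum>r<M. w r x)"
      by (rule scale) measurable
    also have "\<dots> \<le> ennreal (1 / real M) * (\<Sum>r<M. N (w r))"
      by (intro mult_left_mono sum_le) auto
    also have "\<dots> \<le> ennreal (1 / real M) * (\<Sum>r<M. N u)"
      by (intro mult_left_mono sum_mono N_w) auto
    also have "\<dots> = N u"
    proof -
      have "ennreal (1 / real M) * of_nat M = 1"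
        using M by (simp add: ennreal_of_nat_eq_real_of_nat flip: ennreal_mult)
      then show ?thesis by (simp add: mult.assoc[symmetric])
    qed
    finally have c_le: "N (\<lambda>x. if x \<in> F then c else u x) \<le> N u" .
    have "N (\<lambda>x. if x \<in> F then avg u F else u x) \<le>
        N (\<lambda>x. (if x \<in> F then c else u x) + ennreal (B / real M) * indicator F x)"
      using avg_le by (intro mono) auto
    also have "\<dots> \<le> N (\<lambda>x. if x \<in> F then c else u x) + N (\<lambda>x. ennreal (B / real M) * indicator F x)"
      by (intro add_le) auto
    also have "\<dots> \<le> N u + ennreal (B / real M) * N (indicator F)"
      using c_le by (auto simp: scale intro: add_right_mono)
    finally show ?thesis .
  qed
  \<comment> \<open>(P4) makes the norm of the indicator of \<open>F\<close> finite, so that the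
    error term tends to 0.\<close>
  have lim: "(\<lambda>M. N u + ennreal (B / real M) * N (indicator F)) \<longlonglongrightarrow> N u + ennreal 0 * N (indicator F)"
    using indicator_finite[OF F fin]
    by (intro tendsto_add tendsto_const tendsto_mult_ennreal tendsto_ennrealI lim_const_over_n) auto
  have "N (\<lambda>x. if x \<in> F then avg u F else u x) \<le> N u + ennreal 0 * N (indicator F)"
    by (rule LIMSEQ_le_const[OF lim], rule exI[of _ 1]) (simp add: step)
  then show ?thesis by simp
qed

text \<open>Truncation at \<open>n\<close>, performed on \<open>F\<close> only, reduces to the
  bounded case; the mean and the norm both pass to the monotone limit.\<close>

lemma average_le:
  assumes u [measurable]: "u \<in> borel_measurable pos_leb" and F [measurable]: "F \<in> sets pos_leb"
    and fin: "emeasure pos_leb F < \<infinity>"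
  shows "N (\<lambda>x. if x \<in> F then avg u F else u x) \<le> N u"
proof -
  define U where "U n x = (if x \<in> F then min (of_nat n) (u x) else u x)" for n x
  have [measurable]: "U n \<in> borel_measurable pos_leb" for n unfolding U_def by measurable
  have "incseq U" by (auto simp: incseq_def U_def le_fun_def min_def)
    (meson dual_order.trans of_nat_le_iff linorder_le_cases)+
  have U_SUP: "(SUP n. U n x) = u x" if "x \<in> F" for x
  proof -
    have "(SUP n. min (of_nat n) (u x)) = min (SUP n. of_nat n) (u x)"
      by (simp add: SUP_inf[symmetric] flip: inf_min) 
    then show ?thesis using that by (simp add: U_def ennreal_SUP_of_nat_eq_top)
  qed
  have "avg u F = (SUP n. avg (U n) F)"
  proof -
    have "(\<integral>\<^sup>+x\<in>F. u x \<partial>pos_leb) = (\<integral>\<^sup>+x. (SUP n. U n x * indicator F x) \<partial>pos_leb)"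
      by (intro nn_integral_cong) (auto simp: indicator_def U_SUP)
    also have "\<dots> = (SUP n. \<integral>\<^sup>+x\<in>F. U n x \<partial>pos_leb)"
      using \<open>incseq U\<close> by (intro nn_integral_monotone_convergence_SUP) (auto simp: incseq_def le_fun_def indicator_def)
    finally show ?thesis unfolding avg_def by (simp add: SUP_divide_ennreal)
  qed
  then have "N (\<lambda>x. if x \<in> F then avg u F else u x) = N (\<lambda>x. SUP n. if x \<in> F then avg (U n) F else u x)"
    by (intro arg_cong[where f = N]) auto
  also have "\<dots> = (SUP n. N (\<lambda>x. if x \<in> F then avg (U n) F else u x))"
  proof (rule SUP_eq)
    have "avg (U m) F \<le> avg (U n) F" if "m \<le> n" for m n
      unfolding avg_def using \<open>incseq U\<close> that
      by (intro divide_right_mono_ennreal nn_integral_mono mult_right_mono) (auto simp: incseq_def le_fun_def)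
    then show "incseq (\<lambda>n x. if x \<in> F then avg (U n) F else u x)"
      by (auto simp: incseq_def le_fun_def)
  qed measurable
  also have "\<dots> \<le> N u"
  proof (rule SUP_least)
    fix n
    have "N (\<lambda>x. if x \<in> F then avg (U n) F else u x) = N (\<lambda>x. if x \<in> F then avg (U n) F else U n x)"
      by (intro arg_cong[where f = N]) (auto simp: U_def)
    also have "\<dots> \<le> N (U n)"
      by (rule average_le_bounded[where B = "real n"]) (use fin in \<open>auto simp: U_def ennreal_of_nat_eq_real_of_nat\<close>)
    also have "\<dots> \<le> N u"
      by (rule mono) (auto simp: U_def)
    finally show "N (\<lambda>x. if x \<in> F then avg (U n) F else u x) \<le> N u" .
  qed
  finally show ?thesis .
qed

text \<open>The sets are averaged one at a time. By disjointness the function is still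
  \<open>u\<close> on a set whose turn has not come, so its mean there is unaffected. The induction
  carries \<open>u\<close> along off the sets; dropping this part at the end can only decrease the
  norm.\<close>

lemma average_family_le:
  assumes "finite A" and u [measurable]: "u \<in> borel_measurable pos_leb"
    and "\<And>a. a \<in> A \<Longrightarrow> E a \<in> sets pos_leb" "\<And>a. a \<in> A \<Longrightarrow> emeasure pos_leb (E a) < \<infinity>"
    and "disjoint_family_on E A"
  shows "N (\<lambda>x. \<Sum>a\<in>A. avg u (E a) * indicator (E a) x) \<le> N u"
proof -
  have "N (\<lambda>x. (if x \<in> (\<Union>a\<in>A. E a) then 0 else u x) + (\<Sum>a\<in>A. avg u (E a) * indicator (E a) x)) \<le> N u"
    using assms(1,3-5)
  proof (induction A)
    case empty
    then show ?case by simp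
  next
    case (insert b A)
    define w where "w = (\<lambda>x. (if x \<in> (\<Union>a\<in>A. E a) then 0 else u x) + (\<Sum>a\<in>A. avg u (E a) * indicator (E a) x))"
    have sets: "E a \<in> sets pos_leb" if "a \<in> insert b A" for a using insert.prems(1) that .
    have [measurable]: "(\<Union>a\<in>A. E a) \<in> sets pos_leb" using insert.prems insert.hyps by auto
    have w_meas [measurable]: "w \<in> borel_measurable pos_leb"
      unfolding w_def using sets
      by (intro borel_measurable_add borel_measurable_sum measurable_replace_on u) auto
    have w_le: "N w \<le> N u"
      unfolding w_def using insert by (intro insert.IH) (auto intro: disjoint_family_on_mono)
    have b_disj: "x \<notin> E a" if "x \<in> E b" "a \<in> A" for x a
      using insert.prems(3) insert.hyps that by (auto simp: disjoint_family_on_def)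
    have w_b: "w x = u x" if "x \<in> E b" for x
    proof -
      have "(\<Sum>a\<in>A. avg u (E a) * indicator (E a) x) = 0"
        using b_disj[OF that] by (intro sum.neutral) auto
      then show ?thesis using b_disj[OF that] by (auto simp: w_def)
    qed
    have "avg w (E b) = avg u (E b)"
      unfolding avg_def using w_b by (intro arg_cong2[where f = "(/)"] nn_integral_cong) (auto simp: indicator_def)
    then have "(\<lambda>x. (if x \<in> (\<Union>a\<in>insert b A. E a) then 0 else u x) + (\<Sum>a\<in>insert b A. avg u (E a) * indicator (E a) x))
        = (\<lambda>x. if x \<in> E b then avg w (E b) else w x)"
    proof (intro ext)
      fix x
      assume *: "avg w (E b) = avg u (E b)"
      have "(\<Sum>a\<in>A. avg u (E a) * indicator (E a) x) = 0" if "x \<in> E b"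
        using b_disj[OF that] by (intro sum.neutral) auto
      then show "(if x \<in> (\<Union>a\<in>insert b A. E a) then 0 else u x) + (\<Sum>a\<in>insert b A. avg u (E a) * indicator (E a) x)
        = (if x \<in> E b then avg w (E b) else w x)"
        using insert.hyps * by (auto simp: w_def)
    qed
    moreover have "N (\<lambda>x. if x \<in> E b then avg w (E b) else w x) \<le> N w"
      using insert.prems by (intro average_le w_meas) auto
    ultimately show ?case using w_le by (metis order_trans)
  qed
  moreover have "N (\<lambda>x. \<Sum>a\<in>A. avg u (E a) * indicator (E a) x) \<le>
      N (\<lambda>x. (if x \<in> (\<Union>a\<in>A. E a) then 0 else u x) + (\<Sum>a\<in>A. avg u (E a) * indicator (E a) x))"
    using assms by (intro mono borel_measurable_add borel_measurable_sum measurable_replace_on) auto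
  ultimately show ?thesis by simp
qed

lemma equimeasurable_sum_indicator:
  assumes "finite A" "disjoint_family_on E A" "disjoint_family_on H A"
    and "\<And>a. a \<in> A \<Longrightarrow> E a \<in> sets pos_leb" "\<And>a. a \<in> A \<Longrightarrow> H a \<in> sets pos_leb"
    and "\<And>a. a \<in> A \<Longrightarrow> emeasure pos_leb (H a) = emeasure pos_leb (E a)"
  shows "N (\<lambda>x. \<Sum>a\<in>A. c a * indicator (H a) x) = N (\<lambda>x. \<Sum>a\<in>A. c a * indicator (E a) x)"
proof (rule rearr_invariant)
  fix t
  show "distr_fn (\<lambda>x. \<Sum>a\<in>A. c a * indicator (H a) x) t = distr_fn (\<lambda>x. \<Sum>a\<in>A. c a * indicator (E a) x) t"
    using assms(6)
    by (simp only: distr_fn_sum_indicator[OF assms(1,3,5)] distr_fn_sum_indicator[OF assms(1,2,4)] cong: sum.cong)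
qed (use assms in \<open>intro borel_measurable_sum borel_measurable_times_ennreal borel_measurable_const borel_measurable_indicator; blast\<close>)+

end

section \<open>Associate norms\<close>

lemma Ioo_sets_pos_leb [simp, measurable]: "{0<..<x} \<in> sets pos_leb"
  by (auto simp: sets_pos_leb_iff)

text \<open>The values serve as indices of their pieces. The strict bound \<open>a < u x\<close>
  puts all pieces with values at least \<open>a\<close> inside the strict level set of
  \<open>u\<close> at \<open>a\<close>, as the counting condition of
  \<open>exists_disjoint_subsets_levels\<close> requires.\<close>

definition simple_minorant :: "(real \<Rightarrow> ennreal) \<Rightarrow> (real \<Rightarrow> ennreal) \<Rightarrow> bool" where
  "simple_minorant s u \<longleftrightarrow> (\<exists>A E. finite A \<and>
    (\<forall>a\<in>A. a < \<infinity> \<and> E a \<in> sets pos_leb \<and> emeasure pos_leb (E a) < \<infinity> \<and> (\<forall>x\<in>E a. a < u x)) \<and>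
    disjoint_family_on E A \<and> s = (\<lambda>x. \<Sum>a\<in>A. a * indicator (E a) x))"

lemma measurable_simple_minorant: "simple_minorant s u \<Longrightarrow> s \<in> borel_measurable pos_leb"
  by (auto simp: simple_minorant_def intro!: borel_measurable_sum)

text \<open>Multiplying by n/(n+1) makes nonzero values strictly smaller than \<open>u\<close>, and
  cutting off at \<open>n\<close> gives the pieces finite measure. Both modifications are monotone
  in \<open>n\<close> and disappear in the limit.\<close>

lemma simple_approximation:
  fixes u :: "real \<Rightarrow> ennreal"
  assumes u [measurable]: "u \<in> borel_measurable pos_leb"
  shows "\<exists>S. incseq S \<and> (\<forall>x>0. (SUP n. S n x) = u x) \<and> (\<forall>n::nat. simple_minorant (S n) u)"
proof -
  obtain f :: "nat \<Rightarrow> real \<Rightarrow> ennreal" where f: "\<And>i. simple_function pos_leb (f i)" "incseq f"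
      "\<And>i x. f i x < top" "\<And>x. (SUP i. f i x) = u x"
    using borel_measurable_implies_simple_function_sequence'[OF u] by blast
  define \<theta> where "\<theta> n = ennreal (real n / real (Suc n))" for n
  define S where "S n x = \<theta> n * f n x * indicator {0<..<real n} x" for n x
  have [measurable]: "f n \<in> borel_measurable pos_leb" for n
    using f(1) by (rule borel_measurable_simple_function)
  have [measurable]: "S n \<in> borel_measurable pos_leb" for n unfolding S_def by measurable
  have "incseq S"
  proof -
    have "\<theta> m \<le> \<theta> n" if "m \<le> n" for m n
      using that by (auto simp: \<theta>_def field_simps intro!: ennreal_leI)
    then show ?thesis
      using f(2) unfolding incseq_def le_fun_def S_def
      by (intro allI impI mult_mono) (auto simp: indicator_def)
  qed
  moreover have "(SUP n. S n x) = u x" if "0 < x" for x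
  proof -
    have "(\<lambda>n. f n x) \<longlonglongrightarrow> u x"
      using LIMSEQ_SUP[of "\<lambda>n. f n x"] f(2,4) by (auto simp: incseq_def le_fun_def)
    moreover have "\<theta> \<longlonglongrightarrow> ennreal 1"
      unfolding \<theta>_def by (intro tendsto_ennrealI LIMSEQ_n_over_Suc_n)
    ultimately have "(\<lambda>n. \<theta> n * f n x) \<longlonglongrightarrow> ennreal 1 * u x"
      by (intro tendsto_mult_ennreal) auto
    moreover obtain n0 where "x < real n0" using reals_Archimedean2 by blast
    then have "\<forall>\<^sub>F n in sequentially. \<theta> n * f n x = S n x"
      using that by (auto simp: eventually_sequentially S_def intro!: exI[of _ n0])
    ultimately have "(\<lambda>n. S n x) \<longlonglongrightarrow> u x"
      by (simp add: Lim_transform_eventually)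
    moreover have "(\<lambda>n. S n x) \<longlonglongrightarrow> (SUP n. S n x)"
      using \<open>incseq S\<close> by (intro LIMSEQ_SUP) (auto simp: incseq_def le_fun_def)
    ultimately show ?thesis by (rule LIMSEQ_unique[rotated])
  qed
  moreover have "simple_minorant (S n) u" for n
    unfolding simple_minorant_def
  proof (intro exI conjI ballI)
    let ?A = "S n ` {0<..} - {0}" and ?E = "\<lambda>a. {x. 0 < x \<and> S n x = a}"
    have "S n ` {0<..} \<subseteq> insert 0 ((\<lambda>y. \<theta> n * y) ` (f n ` {0<..}))"
      by (auto simp: S_def indicator_def)
    moreover have "finite (f n ` {0<..})" using simple_functionD(1)[OF f(1)[of n]] by simp
    ultimately show "finite ?A" by (meson finite_Diff finite_imageI finite_insert finite_subset)
    show disj: "disjoint_family_on ?E ?A" by (auto simp: disjoint_family_on_def)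
    show "S n = (\<lambda>x. \<Sum>a\<in>?A. a * indicator (?E a) x)"
    proof
      fix x
      show "S n x = (\<Sum>a\<in>?A. a * indicator (?E a) x)"
      proof (cases "S n x = 0")
        case True
        then show ?thesis by (auto intro!: sum.neutral[symmetric])
      next
        case False
        then have "0 < x" by (auto simp: S_def indicator_def split: if_splits)
        with False have "S n x \<in> ?A" "x \<in> ?E (S n x)" by auto
        from disjoint_family_sum_indicator[OF \<open>finite ?A\<close> disj this, of "\<lambda>a. a"] show ?thesis by simp
      qed
    qed
    fix a assume a: "a \<in> ?A"
    show "a < \<infinity>"
      using a f(3) by (auto simp: S_def \<theta>_def ennreal_mult_less_top indicator_def split: if_splits)
    have "{x \<in> space pos_leb. S n x = a} \<in> sets pos_leb" by measurable
    then show E: "?E a \<in> sets pos_leb" by simp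
    have "?E a \<subseteq> {0<..<real n}"
      using a by (auto simp: S_def indicator_def split: if_splits)
    then have "emeasure pos_leb (?E a) \<le> emeasure pos_leb {0<..<real n}"
      by (intro emeasure_mono) auto
    then show "emeasure pos_leb (?E a) < \<infinity>"
      by (simp add: emeasure_pos_leb_Ioo le_less_trans)
    fix x assume x: "x \<in> ?E a"
    then have S: "S n x = a" "a \<noteq> 0" using a by auto
    then have eq: "a = \<theta> n * f n x" by (auto simp: S_def indicator_def split: if_splits)
    obtain r where r: "f n x = ennreal r" "0 \<le> r" using f(3)[of n x] by (cases "f n x") auto
    have "r \<noteq> 0" using S eq r by auto
    then have "a < f n x"
      unfolding eq r \<theta>_def using r(2) by (subst ennreal_mult[symmetric]) (auto intro!: ennreal_lessI simp: field_simps)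
    also have "f n x \<le> u x" unfolding f(4)[symmetric] by (rule SUP_upper) simp
    finally show "a < u x" .
  qed
  ultimately show ?thesis by (intro exI[of _ S]) simp
qed

lemma nn_integral_sum_indicator_mult:
  assumes [measurable]: "u \<in> borel_measurable pos_leb" and "\<And>a. a \<in> A \<Longrightarrow> E a \<in> sets pos_leb"
  shows "(\<integral>\<^sup>+x. (\<Sum>a\<in>A. c a * indicator (E a) x) * u x \<partial>pos_leb) =
    (\<Sum>a\<in>A. c a * (\<integral>\<^sup>+x\<in>E a. u x \<partial>pos_leb))"
proof -
  have [measurable]: "E a \<in> sets pos_leb" if "a \<in> A" for a using assms(2) that .
  have "(\<integral>\<^sup>+x. (\<Sum>a\<in>A. c a * indicator (E a) x) * u x \<partial>pos_leb) =
      (\<integral>\<^sup>+x. (\<Sum>a\<in>A. c a * (u x * indicator (E a) x)) \<partial>pos_leb)"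
    by (simp add: sum_distrib_left sum_distrib_right mult_ac)
  also have "\<dots> = (\<Sum>a\<in>A. \<integral>\<^sup>+x. c a * (u x * indicator (E a) x) \<partial>pos_leb)"
    by (rule nn_integral_sum) measurable
  also have "\<dots> = (\<Sum>a\<in>A. c a * (\<integral>\<^sup>+x\<in>E a. u x \<partial>pos_leb))"
    by (intro sum.cong refl nn_integral_cmult) measurable
  finally show ?thesis .
qed

lemma AE_eq_0_if_locally:
  fixes v :: "real \<Rightarrow> ennreal"
  assumes [measurable]: "v \<in> borel_measurable pos_leb"
    and zero: "\<And>n. (\<integral>\<^sup>+x\<in>{0<..<real n}. v x \<partial>pos_leb) = 0"
  shows "AE x in pos_leb. v x = 0"
proof -
  have "AE x in pos_leb. x \<in> {0<..<real n} \<longrightarrow> v x = 0" for n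
  proof -
    have "AE x in pos_leb. v x * indicator {0<..<real n} x = 0"
      using zero[of n] by (subst (asm) nn_integral_0_iff_AE) auto
    then show ?thesis by (auto elim!: eventually_mono simp: indicator_def)
  qed
  then have "AE x in pos_leb. \<forall>n. x \<in> {0<..<real n} \<longrightarrow> v x = 0"
    unfolding AE_all_countable ..
  then show ?thesis
  proof (rule AE_mp, intro AE_I2 impI)
    fix x assume "x \<in> space pos_leb" and n: "\<forall>n. x \<in> {0<..<real n} \<longrightarrow> v x = 0"
    moreover obtain n where "x < real n" using reals_Archimedean2 by blast
    ultimately show "v x = 0" by auto
  qed
qed

section \<open>Associate norms of [0,\<infinity>]-valued functions\<close>

definition assoc :: "((real \<Rightarrow> ennreal) \<Rightarrow> ennreal) \<Rightarrow> (real \<Rightarrow> ennreal) \<Rightarrow> ennreal" where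
  "assoc N v = (SUP u\<in>{u \<in> borel_measurable pos_leb. N u \<le> 1}. \<integral>\<^sup>+x. u x * v x \<partial>pos_leb)"

lemma assoc_upper:
  "u \<in> borel_measurable pos_leb \<Longrightarrow> N u \<le> 1 \<Longrightarrow> (\<integral>\<^sup>+x. u x * v x \<partial>pos_leb) \<le> assoc N v"
  unfolding assoc_def by (rule SUP_upper) simp

lemma assoc_least:
  "(\<And>u. u \<in> borel_measurable pos_leb \<Longrightarrow> N u \<le> 1 \<Longrightarrow> (\<integral>\<^sup>+x. u x * v x \<partial>pos_leb) \<le> c) \<Longrightarrow> assoc N v \<le> c"
  unfolding assoc_def by (rule SUP_least) simp

context ri_fn_norm
begin

lemma Hoelder:
  assumes u [measurable]: "u \<in> borel_measurable pos_leb" and v [measurable]: "v \<in> borel_measurable pos_leb"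
    and fin: "N u < \<infinity>"
  shows "(\<integral>\<^sup>+x. u x * v x \<partial>pos_leb) \<le> N u * assoc N v"
proof (cases "N u = 0")
  \<comment> \<open>Here the right-hand side is 0 even if \<open>assoc N v\<close> is infinite, so
    the integral has to vanish outright.\<close>
  case True
  then have "AE x in pos_leb. u x = 0" using eq_0_iff[OF u] by simp
  then have "(\<integral>\<^sup>+x. u x * v x \<partial>pos_leb) = (\<integral>\<^sup>+x. 0 \<partial>pos_leb)"
    by (intro nn_integral_cong_AE) (auto elim: eventually_mono)
  then show ?thesis by simp
next
  case False
  then obtain r where r: "N u = ennreal r" "0 < r" using fin by (cases "N u") (auto simp: order_le_less)
  have "N (\<lambda>x. ennreal (1 / r) * u x) = 1"
    unfolding scale[OF u] r(1) using r(2) by (simp flip: ennreal_mult)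
  then have "(\<integral>\<^sup>+x. ennreal (1 / r) * u x * v x \<partial>pos_leb) \<le> assoc N v"
    by (intro assoc_upper) auto
  then have "ennreal (1 / r) * (\<integral>\<^sup>+x. u x * v x \<partial>pos_leb) \<le> assoc N v"
    by (simp add: mult.assoc nn_integral_cmult)
  then have "ennreal r * (ennreal (1 / r) * (\<integral>\<^sup>+x. u x * v x \<partial>pos_leb)) \<le> ennreal r * assoc N v"
    by (intro mult_left_mono) auto
  moreover have "ennreal r * ennreal (1 / r) = 1" using r(2) by (simp flip: ennreal_mult)
  ultimately show ?thesis by (simp add: r mult.assoc[symmetric])
qed

text \<open>Test functions for \<open>u\<close> are transported to \<open>v\<close> by averaging over the level sets of a simple
  minorant of \<open>u\<close> and moving these averages to disjoint sets of the same measure on which \<open>v\<close> is large.\<close>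

lemma assoc_mono_distr_fn:
  assumes u [measurable]: "u \<in> borel_measurable pos_leb" and v [measurable]: "v \<in> borel_measurable pos_leb"
    and le: "\<And>t. distr_fn u t \<le> distr_fn v t"
  shows "assoc N u \<le> assoc N v"
proof (rule assoc_least)
  fix h assume h [measurable]: "h \<in> borel_measurable pos_leb" and "N h \<le> 1"
  from simple_approximation[OF u] obtain S where
    S_all: "incseq S \<and> (\<forall>x>0. (SUP n. S n x) = u x) \<and> (\<forall>n. simple_minorant (S n) u)" ..
  then have S: "incseq S" "\<And>x. 0 < x \<Longrightarrow> (SUP n. S n x) = u x" "\<And>n. simple_minorant (S n) u"
    by simp_all
  have S_meas [measurable]: "S n \<in> borel_measurable pos_leb" for n
    using S(3) by (rule measurable_simple_minorant)
  have S_le: "(\<integral>\<^sup>+x. S n x * h x \<partial>pos_leb) \<le> assoc N v" for n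
  proof -
    from S(3)[of n, unfolded simple_minorant_def] obtain A E where
      raw: "finite A \<and> (\<forall>a\<in>A. a < \<infinity> \<and> E a \<in> sets pos_leb \<and> emeasure pos_leb (E a) < \<infinity> \<and> (\<forall>x\<in>E a. a < u x)) \<and>
        disjoint_family_on E A \<and> S n = (\<lambda>x. \<Sum>a\<in>A. a * indicator (E a) x)"
      by (elim exE) (rule that)
    note AE_sets = raw[THEN conjunct2, THEN conjunct1, rule_format]
    have AE: "finite A" "\<And>a. a \<in> A \<Longrightarrow> E a \<in> sets pos_leb" "\<And>a. a \<in> A \<Longrightarrow> emeasure pos_leb (E a) < \<infinity>"
      "\<And>a x. a \<in> A \<Longrightarrow> x \<in> E a \<Longrightarrow> a < u x" "disjoint_family_on E A" "S n = (\<lambda>x. \<Sum>a\<in>A. a * indicator (E a) x)"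
      using raw AE_sets by blast+
    have "\<exists>H. (\<forall>a\<in>A. H a \<in> sets pos_leb \<and> emeasure pos_leb (H a) = emeasure pos_leb (E a) \<and> (\<forall>x\<in>H a. a < v x)) \<and>
        disjoint_family_on H A"
    proof (rule exists_disjoint_subsets_levels[OF AE(1) v AE(3)])
      fix a assume a: "a \<in> A"
      let ?B = "{a' \<in> A. a \<le> a'}"
      \<comment> \<open>The pieces with values at least \<open>a\<close> are disjoint subsets of the
        level set of \<open>u\<close> at \<open>a\<close>; hence there is room for them in the
        corresponding level set of \<open>v\<close>.\<close>
      have "(\<Sum>a'\<in>?B. emeasure pos_leb (E a')) = emeasure pos_leb (\<Union>a'\<in>?B. E a')"
        using AE(1,2,5) by (intro sum_emeasure) (auto intro: disjoint_family_on_mono)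
      also have "\<dots> \<le> distr_fn u a"
        unfolding distr_fn_def
        using AE(2,4) by (intro emeasure_mono level_set_pos_leb u) (auto simp: sets_pos_leb_iff intro: le_less_trans)
      also have "\<dots> \<le> distr_fn v a" by (rule le)
      finally show "(\<Sum>a'\<in>?B. emeasure pos_leb (E a')) \<le> distr_fn v a" .
    qed
    then obtain H where H: "\<And>a. a \<in> A \<Longrightarrow> H a \<in> sets pos_leb"
      "\<And>a. a \<in> A \<Longrightarrow> emeasure pos_leb (H a) = emeasure pos_leb (E a)"
      "\<And>a x. a \<in> A \<Longrightarrow> x \<in> H a \<Longrightarrow> a < v x" "disjoint_family_on H A" by metis
    let ?k = "\<lambda>x. \<Sum>a\<in>A. avg h (E a) * indicator (H a) x"
    have k_meas: "?k \<in> borel_measurable pos_leb"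
      using H(1) by (intro borel_measurable_sum borel_measurable_times_ennreal) auto
    have "N ?k = N (\<lambda>x. \<Sum>a\<in>A. avg h (E a) * indicator (E a) x)"
      using AE H by (intro equimeasurable_sum_indicator) auto
    also have "\<dots> \<le> N h"
      by (rule average_family_le[OF AE(1) h AE(2,3,5)])
    finally have k: "N ?k \<le> 1" using \<open>N h \<le> 1\<close> by simp
    have "(\<integral>\<^sup>+x. S n x * h x \<partial>pos_leb) = (\<Sum>a\<in>A. a * (\<integral>\<^sup>+x\<in>E a. h x \<partial>pos_leb))"
      unfolding AE(6) by (rule nn_integral_sum_indicator_mult[OF h AE(2)])
    also have "\<dots> = (\<Sum>a\<in>A. avg h (E a) * (a * emeasure pos_leb (H a)))"
      using AE H avg_mult[OF h] by (intro sum.cong) (auto simp: mult_ac)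
    also have "\<dots> \<le> (\<Sum>a\<in>A. avg h (E a) * (\<integral>\<^sup>+x\<in>H a. v x \<partial>pos_leb))"
    proof (intro sum_mono mult_left_mono)
      fix a assume a: "a \<in> A"
      have "a * emeasure pos_leb (H a) = (\<integral>\<^sup>+x. a * indicator (H a) x \<partial>pos_leb)"
        using H(1)[OF a] by (simp add: nn_integral_cmult_indicator)
      also have "\<dots> \<le> (\<integral>\<^sup>+x\<in>H a. v x \<partial>pos_leb)"
        using H(3)[OF a] by (intro nn_integral_mono) (auto simp: indicator_def less_imp_le)
      finally show "a * emeasure pos_leb (H a) \<le> (\<integral>\<^sup>+x\<in>H a. v x \<partial>pos_leb)" .
    qed simp
    also have "\<dots> = (\<integral>\<^sup>+x. ?k x * v x \<partial>pos_leb)"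
      by (rule nn_integral_sum_indicator_mult[OF v H(1), symmetric])
    also have "\<dots> \<le> assoc N v" using assoc_upper[of ?k N v, OF k_meas k] .
    finally show ?thesis .
  qed
  have "(\<integral>\<^sup>+x. h x * u x \<partial>pos_leb) = (\<integral>\<^sup>+x. (SUP n. S n x * h x) \<partial>pos_leb)"
    by (intro nn_integral_cong) (simp add: S(2)[symmetric] SUP_mult_left_ennreal mult.commute)
  also have "\<dots> = (SUP n. \<integral>\<^sup>+x. S n x * h x \<partial>pos_leb)"
    using S(1) by (intro nn_integral_monotone_convergence_SUP) (auto simp: incseq_def le_fun_def intro: mult_right_mono)
  also have "\<dots> \<le> assoc N v" by (intro SUP_least S_le)
  finally show "(\<integral>\<^sup>+x. h x * u x \<partial>pos_leb) \<le> assoc N v" .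
qed

lemma indicator_le_Hoelder:
  assumes v: "v \<in> borel_measurable pos_leb" and G: "G \<in> sets pos_leb" "emeasure pos_leb G < \<infinity>"
  shows "(\<integral>\<^sup>+x\<in>G. v x \<partial>pos_leb) \<le> N (indicator G) * assoc N v"
proof -
  have "(\<integral>\<^sup>+x\<in>G. v x \<partial>pos_leb) = (\<integral>\<^sup>+x. indicator G x * v x \<partial>pos_leb)"
    by (simp add: mult.commute)
  also have "\<dots> \<le> N (indicator G) * assoc N v"
    using assms by (intro Hoelder indicator_finite) auto
  finally show ?thesis .
qed

text \<open>Duality exchanges (P4) and (P5): the local integrability constant of \<open>N\<close>
  bounds the associate norm of an indicator, and the norm of the indicator is the local constant of
  the associate norm. Definiteness also comes from pairing with indicators, and invariance from
  \<open>assoc_mono_distr_fn\<close>.\<close>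

lemma ri_fn_norm_assoc: "ri_fn_norm (assoc N)"
proof
  fix v :: "real \<Rightarrow> ennreal" assume v [measurable]: "v \<in> borel_measurable pos_leb"
  show "assoc N v = 0 \<longleftrightarrow> (AE x in pos_leb. v x = 0)"
  proof
    assume *: "assoc N v = 0"
    have "(\<integral>\<^sup>+x\<in>{0<..<real n}. v x \<partial>pos_leb) = 0" for n
      using indicator_le_Hoelder[OF v, of "{0<..<real n}"] * by (simp add: emeasure_pos_leb_Ioo)
    then show "AE x in pos_leb. v x = 0" by (rule AE_eq_0_if_locally[OF v])
  next
    assume *: "AE x in pos_leb. v x = 0"
    have "(\<integral>\<^sup>+x. u x * v x \<partial>pos_leb) = (\<integral>\<^sup>+x. 0 \<partial>pos_leb)" for u
      using * by (intro nn_integral_cong_AE) (auto elim: eventually_mono)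
    then have "assoc N v \<le> 0" by (intro assoc_least) simp
    then show "assoc N v = 0" by simp
  qed
  fix a :: real assume "0 \<le> a"
  have "assoc N (\<lambda>x. ennreal a * v x) = (SUP u\<in>{u \<in> borel_measurable pos_leb. N u \<le> 1}. ennreal a * (\<integral>\<^sup>+x. u x * v x \<partial>pos_leb))"
    unfolding assoc_def by (intro SUP_cong refl, subst nn_integral_cmult[symmetric]) (auto simp: mult_ac)
  then show "assoc N (\<lambda>x. ennreal a * v x) = ennreal a * assoc N v"
    unfolding assoc_def by (simp add: SUP_mult_left_ennreal)
next
  fix u v :: "real \<Rightarrow> ennreal"
  assume [measurable]: "u \<in> borel_measurable pos_leb" "v \<in> borel_measurable pos_leb"
  show "assoc N (\<lambda>x. u x + v x) \<le> assoc N u + assoc N v"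
  proof (rule assoc_least)
    fix h assume [measurable]: "h \<in> borel_measurable pos_leb" and "N h \<le> 1"
    have "(\<integral>\<^sup>+x. h x * (u x + v x) \<partial>pos_leb) = (\<integral>\<^sup>+x. h x * u x \<partial>pos_leb) + (\<integral>\<^sup>+x. h x * v x \<partial>pos_leb)"
      by (simp add: distrib_left nn_integral_add)
    also have "\<dots> \<le> assoc N u + assoc N v"
      using \<open>N h \<le> 1\<close> by (intro add_mono assoc_upper) auto
    finally show "(\<integral>\<^sup>+x. h x * (u x + v x) \<partial>pos_leb) \<le> assoc N u + assoc N v" .
  qed
next
  fix u v :: "real \<Rightarrow> ennreal" assume *: "AE x in pos_leb. u x \<le> v x"
  show "assoc N u \<le> assoc N v"
  proof (rule assoc_least)
    fix h assume "h \<in> borel_measurable pos_leb" "N h \<le> 1"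
    have "(\<integral>\<^sup>+x. h x * u x \<partial>pos_leb) \<le> (\<integral>\<^sup>+x. h x * v x \<partial>pos_leb)"
      using * by (intro nn_integral_mono_AE) (auto elim!: eventually_mono intro: mult_left_mono)
    also have "\<dots> \<le> assoc N v" by (rule assoc_upper) fact+
    finally show "(\<integral>\<^sup>+x. h x * u x \<partial>pos_leb) \<le> assoc N v" .
  qed
next
  fix U :: "nat \<Rightarrow> real \<Rightarrow> ennreal"
  assume [measurable]: "\<And>j. U j \<in> borel_measurable pos_leb" and inc: "incseq U"
  have "assoc N (\<lambda>x. SUP j. U j x) = (SUP u\<in>{u \<in> borel_measurable pos_leb. N u \<le> 1}. SUP j. \<integral>\<^sup>+x. u x * U j x \<partial>pos_leb)"
    unfolding assoc_def
  proof (intro SUP_cong refl)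
    fix u assume "u \<in> {u \<in> borel_measurable pos_leb. N u \<le> 1}"
    then have [measurable]: "u \<in> borel_measurable pos_leb" by simp
    show "(\<integral>\<^sup>+x. u x * (SUP j. U j x) \<partial>pos_leb) = (SUP j. \<integral>\<^sup>+x. u x * U j x \<partial>pos_leb)"
      unfolding SUP_mult_left_ennreal using inc
      by (intro nn_integral_monotone_convergence_SUP) (auto simp: incseq_def le_fun_def intro: mult_left_mono)
  qed
  also have "\<dots> = (SUP j. assoc N (U j))"
    unfolding assoc_def by (rule SUP_commute)
  finally show "assoc N (\<lambda>x. SUP j. U j x) = (SUP j. assoc N (U j))" .
next
  fix G assume G [measurable]: "G \<in> sets pos_leb" and fin: "emeasure pos_leb G < \<infinity>"
  obtain C where C: "C < \<infinity>" "\<forall>u\<in>borel_measurable pos_leb. (\<integral>\<^sup>+x\<in>G. u x \<partial>pos_leb) \<le> C * N u"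
    using local_L1[OF G fin] by blast
  have "assoc N (indicator G) \<le> C"
  proof (rule assoc_least)
    fix u assume "u \<in> borel_measurable pos_leb" "N u \<le> 1"
    then have "(\<integral>\<^sup>+x\<in>G. u x \<partial>pos_leb) \<le> C * N u" using C(2) by blast
    also have "\<dots> \<le> C * 1" using \<open>N u \<le> 1\<close> by (intro mult_left_mono) auto
    finally show "(\<integral>\<^sup>+x\<in>G. u x \<partial>pos_leb) \<le> C" by simp
  qed
  with C(1) show "assoc N (indicator G) < \<infinity>" by (rule le_less_trans[rotated])
  show "\<exists>C<\<infinity>. \<forall>u\<in>borel_measurable pos_leb. (\<integral>\<^sup>+x\<in>G. u x \<partial>pos_leb) \<le> C * assoc N u"
    using indicator_le_Hoelder[OF _ G fin] indicator_finite[OF G fin] by blast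
next
  fix u v :: "real \<Rightarrow> ennreal"
  assume "u \<in> borel_measurable pos_leb" "v \<in> borel_measurable pos_leb" "\<And>t. distr_fn u t = distr_fn v t"
  then show "assoc N u = assoc N v" by (intro antisym assoc_mono_distr_fn) auto
qed

end

section \<open>The second associate norm\<close>

text \<open>Vectors are functions vanishing off \<open>A\<close>, and \<open>c\<close> is a linear
  functional dominated by the sublinear \<open>p\<close> and touching it at
  \<open>a\<close>.\<close>

lemma finite_Hahn_Banach:
  fixes p :: "('i \<Rightarrow> real) \<Rightarrow> real"
  assumes fin: "finite A"
    and sub: "\<And>f g. p (\<lambda>i. f i + g i) \<le> p f + p g"
    and hom: "\<And>t f. 0 \<le> t \<Longrightarrow> p (\<lambda>i. t * f i) = t * p f"
    and a: "\<And>i. i \<notin> A \<Longrightarrow> a i = 0"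
  shows "\<exists>c. (\<Sum>i\<in>A. c i * a i) = p a \<and> (\<forall>d. (\<forall>i. i \<notin> A \<longrightarrow> d i = 0) \<longrightarrow> (\<Sum>i\<in>A. c i * d i) \<le> p d)"
proof -
  have zero: "p (\<lambda>i. 0) = 0" using hom[of 0 "\<lambda>_. 0"] by simp
  \<comment> \<open>The extension starts on the line through \<open>a\<close> and adds one
    coordinate at a time. Pairs \<open>(d, s)\<close> stand for \<open>d + s * a\<close> although
    this representation is not unique: domination by \<open>p\<close>, with \<open>p 0 = 0\<close>,
    enforces consistency.\<close>
  have ex: "\<exists>c. \<forall>d s. (\<forall>i. i \<notin> A \<longrightarrow> d i = 0) \<longrightarrow> (\<Sum>i\<in>A. c i * d i) + s * p a \<le> p (\<lambda>i. d i + s * a i)"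
    using fin
  proof (induction A)
    case empty
    have "s * p a \<le> p (\<lambda>i. s * a i)" for s
    proof (cases "0 \<le> s")
      case True
      then show ?thesis by (simp add: hom)
    next
      case False
      have "0 \<le> p (\<lambda>i. s * a i) + p (\<lambda>i. (- s) * a i)"
        using sub[of "\<lambda>i. s * a i" "\<lambda>i. (- s) * a i"] by (simp add: zero)
      then show ?thesis using False hom[of "- s" a] by simp
    qed
    moreover have "(\<lambda>i. d i + s * a i) = (\<lambda>i. s * a i)" if "\<forall>i. d i = 0" for d s using that by simp
    ultimately show ?case by simp
  next
    case (insert b B)
    define supp where "supp d \<longleftrightarrow> (\<forall>i. i \<notin> B \<longrightarrow> d i = 0)" for d :: "'i \<Rightarrow> real"
    from insert.IH obtain c where c: "\<And>d s. supp d \<Longrightarrow> (\<Sum>i\<in>B. c i * d i) + s * p a \<le> p (\<lambda>i. d i + s * a i)"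
      unfolding supp_def by blast
    define L where "L d s = (\<Sum>i\<in>B. c i * d i) + s * p a" for d s
    define e :: "'i \<Rightarrow> real" where "e i = of_bool (i = b)" for i
    \<comment> \<open>Every lower bound for the value of the extended functional at the new unit
      vector \<open>e\<close> is at most every upper bound; \<open>z\<close> is then taken as the
      supremum of the lower bounds.\<close>
    have key: "L d s - p (\<lambda>i. d i + s * a i - e i) \<le> p (\<lambda>i. d' i + s' * a i + e i) - L d' s'"
      if "supp d" "supp d'" for d d' s s'
    proof -
      have "L d s + L d' s' = L (\<lambda>i. d i + d' i) (s + s')"
        by (simp add: L_def algebra_simps sum.distrib)
      also have "\<dots> \<le> p (\<lambda>i. (d i + d' i) + (s + s') * a i)"
        unfolding L_def using that by (intro c) (auto simp: supp_def)
      also have "\<dots> \<le> p (\<lambda>i. d i + s * a i - e i) + p (\<lambda>i. d' i + s' * a i + e i)"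
        using sub[of "\<lambda>i. d i + s * a i - e i" "\<lambda>i. d' i + s' * a i + e i"] by (simp add: algebra_simps)
      finally show ?thesis by simp
    qed
    define z where "z = (SUP (d, s)\<in>{(d, s). supp d}. L d s - p (\<lambda>i. d i + s * a i - e i))"
    have supp0: "supp (\<lambda>_. 0)" by (simp add: supp_def)
    have bdd: "bdd_above ((\<lambda>(d, s). L d s - p (\<lambda>i. d i + s * a i - e i)) ` {(d, s). supp d})"
      using key[OF _ supp0, where s' = 0] by (intro bdd_aboveI[where M = "p (\<lambda>i. 0 + 0 * a i + e i) - L (\<lambda>_. 0) 0"]) auto
    have lower: "L d s - p (\<lambda>i. d i + s * a i - e i) \<le> z" if "supp d" for d s
      unfolding z_def using that by (intro cSUP_upper2[OF bdd, of "(d, s)"]) auto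
    have upper: "z \<le> p (\<lambda>i. d' i + s' * a i + e i) - L d' s'" if "supp d'" for d' s'
      unfolding z_def using that key supp0 by (intro cSUP_least) auto
    have ext: "L d s + r * z \<le> p (\<lambda>i. d i + s * a i + r * e i)" if d: "supp d" for d s r
    proof -
      have L_scale: "L (\<lambda>i. t * d i) (t * s) = t * L d s" for t
        by (simp add: L_def sum_distrib_left algebra_simps)
      consider "r = 0" | "0 < r" | "r < 0" by linarith
      then show ?thesis
      proof cases
        case 1
        then show ?thesis using c[OF d, of s] by (simp add: L_def)
      next
        case 2
        have "z \<le> p (\<lambda>i. (1 / r) * d i + (1 / r * s) * a i + e i) - L (\<lambda>i. (1 / r) * d i) (1 / r * s)"
          using d by (intro upper) (auto simp: supp_def)
        then have "r * z \<le> r * p (\<lambda>i. (1 / r) * d i + (1 / r * s) * a i + e i) - r * (1 / r * L d s)"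
          using 2 unfolding L_scale right_diff_distrib[symmetric] by (intro mult_left_mono) auto
        also have "r * p (\<lambda>i. (1 / r) * d i + (1 / r * s) * a i + e i) = p (\<lambda>i. d i + s * a i + r * e i)"
          using 2 by (subst hom[symmetric]) (auto simp: algebra_simps)
        finally show ?thesis using 2 by simp
      next
        case 3
        define t where "t = - r"
        have t: "0 < t" "r = - t" using 3 by (auto simp: t_def)
        have "L (\<lambda>i. (1 / t) * d i) (1 / t * s) - p (\<lambda>i. (1 / t) * d i + (1 / t * s) * a i - e i) \<le> z"
          using d by (intro lower) (auto simp: supp_def)
        then have "t * (1 / t * L d s) - t * p (\<lambda>i. (1 / t) * d i + (1 / t * s) * a i - e i) \<le> t * z"
          using t unfolding L_scale right_diff_distrib[symmetric] by (intro mult_left_mono) auto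
        also have "t * p (\<lambda>i. (1 / t) * d i + (1 / t * s) * a i - e i) = p (\<lambda>i. d i + s * a i - t * e i)"
          using t by (subst hom[symmetric]) (auto simp: algebra_simps)
        finally show ?thesis using t by simp
      qed
    qed
    show ?case
    proof (intro exI[of _ "c(b := z)"] allI impI)
      fix d s assume d: "\<forall>i. i \<notin> insert b B \<longrightarrow> d i = (0::real)"
      define d0 where "d0 = d(b := 0)"
      have "supp d0" using d by (auto simp: supp_def d0_def)
      have d_eq: "d i = d0 i + d b * e i" for i by (auto simp: d0_def e_def)
      have "(\<Sum>i\<in>insert b B. (c(b := z)) i * d i) = z * d b + (\<Sum>i\<in>B. c i * d0 i)"
      proof -
        have "(\<Sum>i\<in>B. (c(b := z)) i * d i) = (\<Sum>i\<in>B. c i * d0 i)"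
          using insert.hyps(2) by (intro sum.cong) (auto simp: d0_def)
        then show ?thesis using insert.hyps by simp
      qed
      then have "(\<Sum>i\<in>insert b B. (c(b := z)) i * d i) + s * p a = L d0 s + d b * z"
        by (simp add: L_def)
      also have "\<dots> \<le> p (\<lambda>i. d0 i + s * a i + d b * e i)" by (rule ext[OF \<open>supp d0\<close>])
      also have "(\<lambda>i. d0 i + s * a i + d b * e i) = (\<lambda>i. d i + s * a i)" by (subst d_eq) (simp add: algebra_simps)
      finally show "(\<Sum>i\<in>insert b B. (c(b := z)) i * d i) + s * p a \<le> p (\<lambda>i. d i + s * a i)" .
    qed
  qed
  then obtain c where c: "\<And>d s. (\<forall>i. i \<notin> A \<longrightarrow> d i = 0) \<Longrightarrow> (\<Sum>i\<in>A. c i * d i) + s * p a \<le> p (\<lambda>i. d i + s * a i)"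
    by blast
  show ?thesis
  proof (intro exI[of _ c] conjI allI impI)
    \<comment> \<open>The pairs \<open>(a, 0)\<close> and \<open>(- a, 1)\<close> yield the two
      inequalities.\<close>
    show "(\<Sum>i\<in>A. c i * a i) = p a"
      using c[of a 0] c[of "\<lambda>i. - a i" 1] a by (simp add: sum_negf zero)
    fix d :: "'i \<Rightarrow> real" assume "\<forall>i. i \<notin> A \<longrightarrow> d i = 0"
    then show "(\<Sum>i\<in>A. c i * d i) \<le> p d" using c[of d 0] by simp
  qed
qed

context ri_fn_norm
begin

text \<open>On coefficient vectors the norm of the simple function with values
  \<open>\<bar>d a\<bar>\<close> on \<open>E a\<close> is a finite seminorm. A functional supporting
  it at the values of \<open>s\<close> becomes the density \<open>g\<close>, equal to
  \<open>\<bar>c a\<bar> / \<mu> a\<close> on \<open>E a\<close>. Pairing \<open>g\<close> with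
  \<open>h\<close> involves only the means of \<open>h\<close>, whose norm as a simple function is
  at most \<open>N h\<close> by averaging.\<close>

lemma simple_le_assoc_assoc:
  assumes fin: "finite A" and E: "\<And>a. a \<in> A \<Longrightarrow> E a \<in> sets pos_leb" "\<And>a. a \<in> A \<Longrightarrow> emeasure pos_leb (E a) < \<infinity>"
    and disj: "disjoint_family_on E A" and A_fin: "\<And>a. a \<in> A \<Longrightarrow> a < \<infinity>"
    and s: "s = (\<lambda>x. \<Sum>a\<in>A. a * indicator (E a) x)"
  shows "\<exists>g\<in>borel_measurable pos_leb. assoc N g \<le> 1 \<and> N s \<le> (\<integral>\<^sup>+x. g x * s x \<partial>pos_leb)"
proof -
  define \<mu> where "\<mu> a = measure pos_leb (E a)" for a
  have \<mu>: "emeasure pos_leb (E a) = ennreal (\<mu> a)" "0 \<le> \<mu> a" if "a \<in> A" for a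
    using E(2)[OF that] by (auto simp: \<mu>_def emeasure_eq_ennreal_measure less_top)
  define P where "P d = N (\<lambda>x. \<Sum>a\<in>A. ennreal \<bar>d a\<bar> * indicator (E a) x)" for d
  define p where "p d = enn2real (P d)" for d
  have meas [measurable]: "(\<lambda>x. \<Sum>a\<in>A. c a * indicator (E a) x) \<in> borel_measurable pos_leb" for c :: "ennreal \<Rightarrow> ennreal"
    using E(1) by (intro borel_measurable_sum borel_measurable_times_ennreal) auto
  have P_fin: "P d < \<infinity>" for d
  proof -
    have "P d \<le> (\<Sum>a\<in>A. N (\<lambda>x. ennreal \<bar>d a\<bar> * indicator (E a) x))"
      unfolding P_def using E(1) by (intro sum_le borel_measurable_times_ennreal) auto
    also have "\<dots> < \<infinity>"
      using fin E indicator_finite by (auto simp: scale ennreal_mult_less_top)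
    finally show ?thesis .
  qed
  then have P_p: "P d = ennreal (p d)" for d by (simp add: p_def less_top)
  have p_nonneg: "0 \<le> p d" for d by (simp add: p_def)
  have p_le: "p d \<le> p e" if "P d \<le> P e" for d e
    using that p_nonneg by (simp add: P_p)
  have p_sub: "p (\<lambda>i. f i + g i) \<le> p f + p g" for f g
  proof -
    have "P (\<lambda>i. f i + g i) \<le> N (\<lambda>x. (\<Sum>a\<in>A. ennreal \<bar>f a\<bar> * indicator (E a) x) + (\<Sum>a\<in>A. ennreal \<bar>g a\<bar> * indicator (E a) x))"
      unfolding P_def
    proof (rule mono)
      fix x
      show "(\<Sum>a\<in>A. ennreal \<bar>f a + g a\<bar> * indicator (E a) x) \<le>
          (\<Sum>a\<in>A. ennreal \<bar>f a\<bar> * indicator (E a) x) + (\<Sum>a\<in>A. ennreal \<bar>g a\<bar> * indicator (E a) x)"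
        unfolding sum.distrib[symmetric] distrib_right[symmetric]
        by (intro sum_mono mult_right_mono) (auto simp flip: ennreal_plus intro!: ennreal_leI)
    qed measurable
    also have "\<dots> \<le> P f + P g" unfolding P_def by (intro add_le) measurable
    finally show ?thesis using p_nonneg by (simp add: P_p flip: ennreal_plus)
  qed
  have p_hom: "p (\<lambda>i. t * f i) = t * p f" if "0 \<le> t" for t f
  proof -
    have "P (\<lambda>i. t * f i) = N (\<lambda>x. ennreal t * (\<Sum>a\<in>A. ennreal \<bar>f a\<bar> * indicator (E a) x))"
      unfolding P_def using that by (simp add: sum_distrib_left abs_mult ennreal_mult mult_ac)
    also have "\<dots> = ennreal t * P f" unfolding P_def by (intro scale) measurable
    finally show ?thesis using that p_nonneg by (simp add: P_p flip: ennreal_mult)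
  qed
  define \<alpha> where "\<alpha> a = (if a \<in> A then enn2real a else 0)" for a
  obtain c where c: "(\<Sum>i\<in>A. c i * \<alpha> i) = p \<alpha>" "\<And>d. (\<forall>i. i \<notin> A \<longrightarrow> d i = 0) \<Longrightarrow> (\<Sum>i\<in>A. c i * d i) \<le> p d"
    using finite_Hahn_Banach[of A p \<alpha>, OF fin p_sub p_hom] by (auto simp: \<alpha>_def)
  \<comment> \<open>Coefficients on null pieces do not change the seminorm, so the functional
    ignores them. The default value of a division by \<open>\<mu> a = 0\<close> in \<open>g\<close>
    then loses nothing.\<close>
  have c0: "c a = 0" if a: "a \<in> A" "\<mu> a = 0" for a
  proof -
    have "c a * r \<le> 0" for r
    proof -
      let ?d = "\<lambda>i. if i = a then r else 0"
      have "AE x in pos_leb. x \<notin> E a"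
        using E(1) \<mu>(1)[OF a(1)] a by (intro AE_not_in) (auto simp: null_sets_def)
      then have "AE x in pos_leb. (\<Sum>i\<in>A. ennreal \<bar>?d i\<bar> * indicator (E i) x) = 0"
        by (rule eventually_mono) (auto intro!: sum.neutral)
      then have "P ?d = 0" unfolding P_def by (simp add: eq_0_iff[OF meas])
      then have "p ?d = 0" by (simp add: p_def)
      moreover have "(\<Sum>i\<in>A. c i * ?d i) = c a * r"
        using fin a by (simp add: if_distrib[of "\<lambda>z. _ * z"] cong: if_cong)
      ultimately show ?thesis using c(2)[of ?d] a by auto
    qed
    from this[of 1] this[of "- 1"] show ?thesis by simp
  qed
  define g where "g x = (\<Sum>a\<in>A. ennreal (\<bar>c a\<bar> / \<mu> a) * indicator (E a) x)" for x
  have g [measurable]: "g \<in> borel_measurable pos_leb" unfolding g_def by measurable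
  have g_int: "(\<integral>\<^sup>+x. g x * h x \<partial>pos_leb) = (\<Sum>a\<in>A. ennreal \<bar>c a\<bar> * avg h (E a))"
    if h: "h \<in> borel_measurable pos_leb" for h
  proof -
    have "(\<integral>\<^sup>+x. g x * h x \<partial>pos_leb) = (\<Sum>a\<in>A. ennreal (\<bar>c a\<bar> / \<mu> a) * (\<integral>\<^sup>+x\<in>E a. h x \<partial>pos_leb))"
      unfolding g_def by (rule nn_integral_sum_indicator_mult[OF h E(1)])
    also have "\<dots> = (\<Sum>a\<in>A. ennreal \<bar>c a\<bar> * avg h (E a))"
    proof (intro sum.cong refl)
      fix a assume a: "a \<in> A"
      have "(\<integral>\<^sup>+x\<in>E a. h x \<partial>pos_leb) = ennreal (\<mu> a) * avg h (E a)"
        using avg_mult[OF h E(1,2)[OF a]] \<mu>[OF a] by (simp add: mult.commute)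
      then show "ennreal (\<bar>c a\<bar> / \<mu> a) * (\<integral>\<^sup>+x\<in>E a. h x \<partial>pos_leb) = ennreal \<bar>c a\<bar> * avg h (E a)"
        using \<mu>[OF a] c0[OF a] by (cases "\<mu> a = 0") (auto simp: mult.assoc[symmetric] simp flip: ennreal_mult)
    qed
    finally show ?thesis .
  qed
  have "assoc N g \<le> 1"
  proof (rule assoc_least)
    fix h assume h [measurable]: "h \<in> borel_measurable pos_leb" and "N h \<le> 1"
    \<comment> \<open>(P5) makes the means finite, so that they can be used as real coefficients in
      the Hahn-Banach bound.\<close>
    have avg_fin: "avg h (E a) < \<infinity>" if a: "a \<in> A" for a
    proof -
      obtain C where "C < \<infinity>" "(\<integral>\<^sup>+x\<in>E a. h x \<partial>pos_leb) \<le> C * N h"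
        using local_L1[OF E(1,2)[OF a]] h by blast
      moreover from this have "C * N h < \<infinity>"
        using \<open>N h \<le> 1\<close> by (auto simp: ennreal_mult_less_top intro: le_less_trans)
      ultimately have "(\<integral>\<^sup>+x\<in>E a. h x \<partial>pos_leb) < \<infinity>" by simp
      then have "avg h (E a) * ennreal (\<mu> a) < \<infinity>"
        using avg_mult[OF h E(1,2)[OF a]] \<mu>[OF a] by simp
      moreover have "avg h (E a) = 0" if "\<mu> a = 0"
        using avg_mult[OF h E(1,2)[OF a]] \<mu>[OF a] that by (simp add: avg_def)
      ultimately show ?thesis
        using \<mu>[OF a] by (cases "\<mu> a = 0") (auto simp: ennreal_mult_less_top)
    qed
    \<comment> \<open>The seminorm sees only absolute values. Giving the means the signs of
      \<open>c\<close> therefore makes every product \<open>c a * d a\<close> nonnegative without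
      changing the norm.\<close>
    define d where "d a = (if a \<in> A then sgn (c a) * enn2real (avg h (E a)) else 0)" for a
    have "P d \<le> N (\<lambda>x. \<Sum>a\<in>A. avg h (E a) * indicator (E a) x)"
      unfolding P_def
    proof (rule mono)
      fix x
      have "ennreal \<bar>d a\<bar> \<le> avg h (E a)" if "a \<in> A" for a
        using that avg_fin[OF that] by (auto simp: d_def abs_mult abs_sgn_eq less_top)
      then show "(\<Sum>a\<in>A. ennreal \<bar>d a\<bar> * indicator (E a) x) \<le> (\<Sum>a\<in>A. avg h (E a) * indicator (E a) x)"
        by (intro sum_mono mult_right_mono) auto
    qed measurable
    also have "\<dots> \<le> N h" by (rule average_family_le[OF fin h E disj])
    finally have "P d \<le> 1" using \<open>N h \<le> 1\<close> by simp
    then have "p d \<le> 1" by (simp add: P_p)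
    have "(\<integral>\<^sup>+x. h x * g x \<partial>pos_leb) = (\<Sum>a\<in>A. ennreal \<bar>c a\<bar> * avg h (E a))"
      using g_int[OF h] by (simp add: mult.commute)
    also have "\<dots> = (\<Sum>a\<in>A. ennreal (c a * d a))"
    proof (intro sum.cong refl)
      fix a assume a: "a \<in> A"
      have "c a * d a = \<bar>c a\<bar> * enn2real (avg h (E a))"
        using a by (simp add: d_def mult.assoc[symmetric] abs_sgn)
      then show "ennreal \<bar>c a\<bar> * avg h (E a) = ennreal (c a * d a)"
        using avg_fin[OF a] by (simp add: ennreal_mult less_top)
    qed
    also have "\<dots> = ennreal (\<Sum>a\<in>A. c a * d a)"
      by (intro sum_ennreal) (auto simp: d_def mult.assoc[symmetric] simp flip: abs_sgn)
    also have "\<dots> \<le> ennreal 1"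
      using c(2)[of d] \<open>p d \<le> 1\<close> by (intro ennreal_leI) (auto simp: d_def)
    finally show "(\<integral>\<^sup>+x. h x * g x \<partial>pos_leb) \<le> 1" by simp
  qed
  moreover have "N s \<le> (\<integral>\<^sup>+x. g x * s x \<partial>pos_leb)"
  proof -
    have s_meas: "s \<in> borel_measurable pos_leb" unfolding s by measurable
    have "N s = P \<alpha>"
      unfolding P_def s using A_fin
      by (intro arg_cong[where f = N] ext sum.cong) (auto simp: \<alpha>_def less_top)
    also have "\<dots> = ennreal (\<Sum>a\<in>A. c a * \<alpha> a)" by (simp add: P_p c(1))
    also have "\<dots> \<le> ennreal (\<Sum>a\<in>A. \<bar>c a\<bar> * \<alpha> a)"
      by (intro ennreal_leI sum_mono mult_right_mono) (auto simp: \<alpha>_def)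
    also have "\<dots> = (\<Sum>a\<in>A. ennreal (\<bar>c a\<bar> * \<alpha> a))"
      by (intro sum_ennreal[symmetric]) (auto simp: \<alpha>_def)
    also have "\<dots> = (\<Sum>a\<in>A. ennreal \<bar>c a\<bar> * avg s (E a))"
    proof (intro sum.cong refl)
      fix a assume a: "a \<in> A"
      show "ennreal (\<bar>c a\<bar> * \<alpha> a) = ennreal \<bar>c a\<bar> * avg s (E a)"
      proof (cases "\<mu> a = 0")
        case True
        then show ?thesis using c0[OF a] by simp
      next
        case False
        have "(\<integral>\<^sup>+x\<in>E a. s x \<partial>pos_leb) = (\<integral>\<^sup>+x. a * indicator (E a) x \<partial>pos_leb)"
          unfolding s using disjoint_family_sum_indicator[OF fin disj a, of _ "\<lambda>a. a"]
          by (intro nn_integral_cong) (auto simp: indicator_def)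
        also have "\<dots> = a * ennreal (\<mu> a)"
          using E(1)[OF a] \<mu>[OF a] by (simp add: nn_integral_cmult_indicator)
        finally have "avg s (E a) = a"
          using False \<mu>[OF a] by (simp add: avg_def ennreal_mult_divide_eq)
        then show ?thesis using a A_fin[OF a] by (simp add: \<alpha>_def ennreal_mult less_top)
      qed
    qed
    also have "\<dots> = (\<integral>\<^sup>+x. g x * s x \<partial>pos_leb)" by (rule g_int[OF s_meas, symmetric])
    finally show ?thesis .
  qed
  ultimately show ?thesis using g by blast
qed

lemma le_assoc_assoc:
  assumes u [measurable]: "u \<in> borel_measurable pos_leb"
  shows "N u \<le> assoc (assoc N) u"
proof -
  from simple_approximation[OF u] obtain S where
    S_all: "incseq S \<and> (\<forall>x>0. (SUP n. S n x) = u x) \<and> (\<forall>n. simple_minorant (S n) u)" ..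
  then have S: "incseq S" "\<And>x. 0 < x \<Longrightarrow> (SUP n. S n x) = u x" "\<And>n. simple_minorant (S n) u"
    by simp_all
  have S_meas [measurable]: "S n \<in> borel_measurable pos_leb" for n
    using S(3) by (rule measurable_simple_minorant)
  have "N u = N (\<lambda>x. SUP n. S n x)" by (rule cong) (auto simp: S(2))
  also have "\<dots> = (SUP n. N (S n))" by (rule SUP_eq[OF S_meas S(1)])
  also have "\<dots> \<le> assoc (assoc N) u"
  proof (rule SUP_least)
    fix n
    from S(3)[of n, unfolded simple_minorant_def] obtain A E where
      raw: "finite A \<and> (\<forall>a\<in>A. a < \<infinity> \<and> E a \<in> sets pos_leb \<and> emeasure pos_leb (E a) < \<infinity> \<and> (\<forall>x\<in>E a. a < u x)) \<and>
        disjoint_family_on E A \<and> S n = (\<lambda>x. \<Sum>a\<in>A. a * indicator (E a) x)"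
      by (elim exE) (rule that)
    have "\<exists>g\<in>borel_measurable pos_leb. assoc N g \<le> 1 \<and> N (S n) \<le> (\<integral>\<^sup>+x. g x * S n x \<partial>pos_leb)"
      using raw by (intro simple_le_assoc_assoc[of A E]) blast+
    then obtain g where g [measurable]: "g \<in> borel_measurable pos_leb" and "assoc N g \<le> 1"
      "N (S n) \<le> (\<integral>\<^sup>+x. g x * S n x \<partial>pos_leb)" by blast
    note this(3)
    also have "(\<integral>\<^sup>+x. g x * S n x \<partial>pos_leb) \<le> (\<integral>\<^sup>+x. g x * u x \<partial>pos_leb)"
      by (intro nn_integral_mono mult_left_mono) (auto simp: S(2)[symmetric] intro: SUP_upper)
    also have "\<dots> \<le> assoc (assoc N) u"
      using g \<open>assoc N g \<le> 1\<close> by (rule assoc_upper)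
    finally show "N (S n) \<le> assoc (assoc N) u" .
  qed
  finally show ?thesis .
qed

end

section \<open>Head integrals of the rearrangement\<close>

text \<open>The upper limit is extended real because the generalized inverse may be infinite;
  \<open>T_op_eq\<close> expresses \<open>T_op\<close> through it.\<close>

definition head_integral :: "(real \<Rightarrow> ennreal) \<Rightarrow> ereal \<Rightarrow> ennreal" where
  "head_integral u y = (\<integral>\<^sup>+s\<in>{s. ereal s < y}. decr u s \<partial>pos_leb)"

lemma ereal_less_iff_e2ennreal: "0 < s \<Longrightarrow> ereal s < y \<longleftrightarrow> ennreal s < e2ennreal y"
  by (cases y) (auto simp: ennreal_less_iff e2ennreal_neg not_less)

lemma measurable_indicator_less [measurable]:
  "(indicator {s. ereal s < y} :: real \<Rightarrow> ennreal) \<in> borel_measurable pos_leb"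
proof -
  have "{s \<in> space pos_leb. ereal s < y} \<in> sets pos_leb" by measurable
  then show ?thesis by (intro borel_measurable_indicator') (simp add: Int_def conj_commute)
qed

lemma nn_integral_const_less:
  "(\<integral>\<^sup>+s\<in>{s. ereal s < y}. c \<partial>pos_leb) = c * e2ennreal y"
proof -
  have "(\<integral>\<^sup>+s\<in>{s. ereal s < y}. c \<partial>pos_leb) = (\<integral>\<^sup>+s. c * indicator {s. 0 < s \<and> ennreal s < e2ennreal y} s \<partial>pos_leb)"
    by (intro nn_integral_cong) (auto simp: indicator_def ereal_less_iff_e2ennreal)
  also have "\<dots> = c * e2ennreal y"
  proof -
    have "{s \<in> space pos_leb. ennreal s < e2ennreal y} \<in> sets pos_leb" by measurable
    then show ?thesis by (subst nn_integral_cmult_indicator) (auto simp: emeasure_pos_leb_less)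
  qed
  finally show ?thesis .
qed

lemma head_integral_mono_arg: "y \<le> z \<Longrightarrow> head_integral u y \<le> head_integral u z"
  unfolding head_integral_def by (intro nn_integral_mono) (auto simp: indicator_def)

lemma head_integral_mono: "(\<And>t. distr_fn u t \<le> distr_fn v t) \<Longrightarrow> head_integral u y \<le> head_integral v y"
  unfolding head_integral_def by (intro nn_integral_mono mult_right_mono decr_mono) auto

lemma head_integral_SUP:
  fixes U :: "nat \<Rightarrow> real \<Rightarrow> ennreal"
  assumes U: "\<And>j. U j \<in> borel_measurable pos_leb" and inc: "incseq U"
  shows "head_integral (\<lambda>x. SUP j. U j x) y = (SUP j. head_integral (U j) y)"
proof -
  have "decr (U i) x \<le> decr (U j) x" if "i \<le> j" for i j x
    using inc U that by (intro decr_mono distr_fn_mono_AE) (auto simp: incseq_def le_fun_def)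
  then show ?thesis
    unfolding head_integral_def decr_SUP[OF U inc]
    by (subst nn_integral_monotone_convergence_SUP[symmetric])
       (auto simp: incseq_def le_fun_def SUP_mult_right_ennreal intro: mult_right_mono)
qed

lemma decr_scale:
  assumes u [measurable]: "u \<in> borel_measurable pos_leb" and "0 \<le> a"
  shows "decr (\<lambda>x. ennreal a * u x) x = ennreal a * decr u x"
proof (cases "a = 0")
  case True
  have "distr_fn (\<lambda>x. 0) 0 = 0" by (simp add: distr_fn_def)
  then have "decr (\<lambda>x. 0) x \<le> 0" unfolding decr_def by (intro Inf_lower) simp
  then show ?thesis using True by simp
next
  case False
  then have a: "ennreal a \<noteq> 0" "ennreal a \<noteq> top" using assms(2) by auto
  have less_iff: "ennreal a * s < ennreal a * t \<longleftrightarrow> s < t" for s t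
    using ennreal_mult_le_mult_iff[OF a, of t s] by (simp add: not_le[symmetric])
  have "t < decr (\<lambda>x. ennreal a * u x) x \<longleftrightarrow> t < ennreal a * decr u x" for t
  proof -
    obtain s where s: "t = ennreal a * s"
    proof
      show "t = ennreal a * (t / ennreal a)"
        using a by (simp add: ennreal_times_divide ennreal_mult_divide_eq mult.commute[of "ennreal a"])
    qed
    have "distr_fn (\<lambda>x. ennreal a * u x) t = distr_fn u s"
      unfolding s distr_fn_def less_iff ..
    then show ?thesis by (simp add: less_decr_iff s less_iff)
  qed
  then show ?thesis by (metis linorder_neqE nless_le)
qed

lemma nn_integral_eq_distr_fn:
  assumes "u \<in> borel_measurable pos_leb" "v \<in> borel_measurable pos_leb" "\<And>t. distr_fn u t = distr_fn v t"
  shows "(\<integral>\<^sup>+x. u x \<partial>pos_leb) = (\<integral>\<^sup>+x. v x \<partial>pos_leb)"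
  using assms by (intro antisym nn_integral_mono_distr_fn) auto

lemma nn_integral_decr_minus:
  assumes u [measurable]: "u \<in> borel_measurable pos_leb" and c: "c < \<infinity>"
  shows "(\<integral>\<^sup>+x. decr u x - c \<partial>pos_leb) = (\<integral>\<^sup>+x. u x - c \<partial>pos_leb)"
proof (rule nn_integral_eq_distr_fn)
  have shift: "distr_fn (\<lambda>x. w x - c) t = distr_fn w (t + c)" for w t
    using c by (simp add: distr_fn_def less_diff_eq_ennreal)
  fix t
  show "distr_fn (\<lambda>x. decr u x - c) t = distr_fn (\<lambda>x. u x - c) t"
    by (simp add: shift)
qed measurable

text \<open>The two sides of the formula \<open>\<integral>\<^sub>0\<^sup>y u\<^sup>* = min\<^sub>c (c y + \<integral> (u - c)\<^sub>+)\<close>, where the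
  minimum is attained at \<open>c = u\<^sup>*(y)\<close>.\<close>

lemma head_integral_le_K:
  assumes u [measurable]: "u \<in> borel_measurable pos_leb" and c: "c < \<infinity>"
  shows "head_integral u y \<le> c * e2ennreal y + (\<integral>\<^sup>+x. u x - c \<partial>pos_leb)"
proof -
  have "head_integral u y \<le> (\<integral>\<^sup>+s. c * indicator {s. ereal s < y} s + (decr u s - c) \<partial>pos_leb)"
    unfolding head_integral_def
    by (intro nn_integral_mono) (auto simp: indicator_def add_diff_self_ennreal)
  also have "\<dots> = c * e2ennreal y + (\<integral>\<^sup>+x. u x - c \<partial>pos_leb)"
    by (subst nn_integral_add) (auto simp: nn_integral_const_less nn_integral_decr_minus[OF u c])
  finally show ?thesis .
qed

lemma head_integral_eq_K:
  assumes u [measurable]: "u \<in> borel_measurable pos_leb" and c: "decr u y < \<infinity>"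
  shows "head_integral u (ereal y) = decr u y * ennreal y + (\<integral>\<^sup>+x. u x - decr u y \<partial>pos_leb)"
proof -
  let ?c = "decr u y"
  have "?c * ennreal y + (\<integral>\<^sup>+x. u x - ?c \<partial>pos_leb) =
      (\<integral>\<^sup>+s. ?c * indicator {s. ereal s < ereal y} s + (decr u s - ?c) \<partial>pos_leb)"
    using nn_integral_const_less[where y = "ereal y" and c = ?c]
    by (subst nn_integral_add) (auto simp: nn_integral_decr_minus[OF u c])
  also have "\<dots> = head_integral u (ereal y)"
    unfolding head_integral_def
    using decr_antimono[of _ y u] decr_antimono[of y _ u] le_less_trans[OF _ c]
    by (intro nn_integral_cong) (auto simp: indicator_def add_diff_inverse_ennreal diff_eq_0_iff_ennreal)
  finally show ?thesis ..
qed

lemma head_integral_nonpos: "y \<le> 0 \<Longrightarrow> head_integral u y = 0"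
  unfolding head_integral_def
  by (subst nn_integral_0_iff_AE) (auto simp: indicator_def intro!: AE_I2 dest: less_le_trans)

lemma head_integral_infty:
  assumes "u \<in> borel_measurable pos_leb"
  shows "head_integral u \<infinity> = (\<integral>\<^sup>+x. u x \<partial>pos_leb)"
  using assms by (simp add: head_integral_def nn_integral_eq_distr_fn[of "decr u" u])

text \<open>The rearrangement itself is not subadditive, but its head integrals are: take
  \<open>c = decr u r\<close> and \<open>d = decr v r\<close>, which attain the minimum for
  \<open>u\<close> and \<open>v\<close>, use \<open>c + d\<close> for the sum and compare positive
  parts. This is the triangle inequality of the norm of \<Upsilon>.\<close>

lemma head_integral_add_le:
  assumes u [measurable]: "u \<in> borel_measurable pos_leb" and v [measurable]: "v \<in> borel_measurable pos_leb"
  shows "head_integral (\<lambda>x. u x + v x) y \<le> head_integral u y + head_integral v y"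
proof (cases "y \<le> 0 \<or> y = \<infinity>")
  case True
  then show ?thesis by (auto simp: head_integral_nonpos head_integral_infty nn_integral_add)
next
  case False
  then obtain r where r: "y = ereal r" "0 < r" by (cases y) auto
  \<comment> \<open>The minimum formula needs finite constants. If the rearrangement is infinite at
    \<open>r\<close>, it is infinite on all of \<open>{0<..r}\<close>, and so is the head
    integral.\<close>
  have top: "head_integral w y = top" if w: "w \<in> borel_measurable pos_leb" "decr w r = top" for w
  proof -
    have "top * ennreal r \<le> head_integral w y"
    proof -
      have "decr w s = top" if "ereal s < y" for s
        using decr_antimono[of s r w] w(2) that r by (simp add: top_unique)
      then have "(\<integral>\<^sup>+s\<in>{s. ereal s < y}. top \<partial>pos_leb) \<le> head_integral w y"
        unfolding head_integral_def by (intro nn_integral_mono) (auto simp: indicator_def)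
      then show ?thesis using r unfolding nn_integral_const_less by simp
    qed
    then show ?thesis using r by (simp add: ennreal_top_mult top_unique)
  qed
  show ?thesis
  proof (cases "decr u r = top \<or> decr v r = top")
    case True
    then show ?thesis using top[OF u] top[OF v] by auto
  next
    case False
    let ?c = "decr u r" and ?d = "decr v r"
    have fin: "?c < \<infinity>" "?d < \<infinity>" using False by (auto simp: less_top)
    have "head_integral (\<lambda>x. u x + v x) y \<le> (?c + ?d) * ennreal r + (\<integral>\<^sup>+x. (u x + v x) - (?c + ?d) \<partial>pos_leb)"
      using head_integral_le_K[of "\<lambda>x. u x + v x" "?c + ?d" y] fin r by simp
    also have "(\<integral>\<^sup>+x. (u x + v x) - (?c + ?d) \<partial>pos_leb) \<le> (\<integral>\<^sup>+x. (u x - ?c) + (v x - ?d) \<partial>pos_leb)"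
    proof (rule nn_integral_mono)
      fix x
      have "u x + v x \<le> (?c + (u x - ?c)) + (?d + (v x - ?d))"
        by (intro add_mono) (auto simp: add_diff_self_ennreal)
      also have "\<dots> = (?c + ?d) + ((u x - ?c) + (v x - ?d))" by (simp add: add_ac)
      finally show "(u x + v x) - (?c + ?d) \<le> (u x - ?c) + (v x - ?d)"
        using fin by (subst ennreal_minus_le_iff) auto
    qed
    also have "\<dots> = (\<integral>\<^sup>+x. u x - ?c \<partial>pos_leb) + (\<integral>\<^sup>+x. v x - ?d \<partial>pos_leb)"
      by (rule nn_integral_add) measurable
    finally have "head_integral (\<lambda>x. u x + v x) y \<le>
      (?c * ennreal r + (\<integral>\<^sup>+x. u x - ?c \<partial>pos_leb)) + (?d * ennreal r + (\<integral>\<^sup>+x. v x - ?d \<partial>pos_leb))"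
      by (simp add: distrib_right add_ac add_left_mono)
    then show ?thesis using head_integral_eq_K[OF u fin(1)] head_integral_eq_K[OF v fin(2)] r by simp
  qed
qed

text \<open>The head integral is bounded by the upper limit and by the measure of \<open>G\<close>.
  This bound is what turns finiteness of the norm of \<open>min 1 \<beta>\<close> into (P4) for
  \<Upsilon>.\<close>

lemma head_integral_indicator_le:
  assumes G [measurable]: "G \<in> sets pos_leb"
  shows "head_integral (indicator G) y \<le> max 1 (emeasure pos_leb G) * min 1 (e2ennreal y)"
proof -
  have "distr_fn (indicator G) 1 = 0" by (simp add: distr_fn_def indicator_def)
  then have le1: "decr (indicator G) s \<le> 1" for s unfolding decr_def by (intro Inf_lower) simp
  have "head_integral (indicator G) y \<le> (\<integral>\<^sup>+s\<in>{s. ereal s < y}. 1 \<partial>pos_leb)"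
    unfolding head_integral_def using le1 by (intro nn_integral_mono mult_right_mono) auto
  also have "\<dots> = e2ennreal y" using nn_integral_const_less[where y = y and c = 1] by simp
  finally have 1: "head_integral (indicator G) y \<le> e2ennreal y" .
  have "head_integral (indicator G) y \<le> head_integral (indicator G) \<infinity>"
    by (rule head_integral_mono_arg) simp
  then have 2: "head_integral (indicator G) y \<le> emeasure pos_leb G"
    by (simp add: head_integral_infty)
  show ?thesis
  proof (cases "e2ennreal y \<le> 1")
    case True
    have "head_integral (indicator G) y \<le> 1 * e2ennreal y" using 1 by simp
    also have "\<dots> \<le> max 1 (emeasure pos_leb G) * e2ennreal y" by (intro mult_right_mono) auto
    finally show ?thesis using True by (simp add: min_def)
  next
    case False
    then have "min 1 (e2ennreal y) = 1" by (simp add: min_absorb1)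
    then show ?thesis using 2 by (simp add: le_max_iff_disj)
  qed
qed

lemma measurable_head_integral_antimono:
  assumes "\<And>x y. 0 < x \<Longrightarrow> x \<le> y \<Longrightarrow> \<beta> y \<le> \<beta> x"
  shows "(\<lambda>t. head_integral u (\<beta> t)) \<in> borel_measurable pos_leb"
  using assms by (intro borel_measurable_pos_leb_antimono head_integral_mono_arg)

text \<open>The hypothesis on \<open>min 1 \<beta>\<close> gives (P4). Positivity of \<beta> at
  \<open>t0\<close> gives (P5) and definiteness: \<beta> is at least some \<open>r0 > 0\<close> on
  \<open>{0<..t0}\<close>, so the norm dominates the head integral up to \<open>r0\<close> times the
  positive constant \<kappa>. Subadditivity is \<open>head_integral_add_le\<close>.\<close>

lemma (in ri_fn_norm) ri_fn_norm_head_integral: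
  assumes \<beta>: "\<And>x y. 0 < x \<Longrightarrow> x \<le> y \<Longrightarrow> \<beta> y \<le> \<beta> x"
    and fin: "N (\<lambda>t. min 1 (e2ennreal (\<beta> t))) < \<infinity>"
    and t0: "0 < t0" "0 < \<beta> t0"
  shows "ri_fn_norm (\<lambda>u. N (\<lambda>t. head_integral u (\<beta> t)))"
proof -
  have [measurable]: "(\<lambda>t. head_integral u (\<beta> t)) \<in> borel_measurable pos_leb" for u
    using \<beta> by (rule measurable_head_integral_antimono)
  have "\<beta> \<in> borel_measurable pos_leb" using \<beta> by (rule borel_measurable_pos_leb_antimono)
  then have [measurable]: "(\<lambda>t. e2ennreal (\<beta> t)) \<in> borel_measurable pos_leb" by simp
  define \<kappa> where "\<kappa> = N (indicator {0<..<t0})"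
  have \<kappa>_fin: "\<kappa> < \<infinity>"
    unfolding \<kappa>_def using t0 by (intro indicator_finite) (auto simp: emeasure_pos_leb_Ioo)
  have \<kappa>_pos: "\<kappa> \<noteq> 0"
  proof
    assume "\<kappa> = 0"
    then have "AE x in pos_leb. indicator {0<..<t0} x = (0::ennreal)"
      unfolding \<kappa>_def by (simp add: eq_0_iff)
    then have "(\<integral>\<^sup>+x. indicator {0<..<t0} x \<partial>pos_leb) = 0"
      by (subst nn_integral_0_iff_AE) auto
    then show False using t0 by (simp add: emeasure_pos_leb_Ioo)
  qed
  obtain r0 where r0: "0 < r0" "ereal r0 \<le> \<beta> t0"
    using t0(2) by (meson ereal_dense2 ereal_less(2) less_imp_le)
  have head_le: "head_integral u (ereal r0) * \<kappa> \<le> N (\<lambda>t. head_integral u (\<beta> t))" for u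
  proof -
    have "head_integral u (ereal r0) * \<kappa> = N (\<lambda>t. head_integral u (ereal r0) * indicator {0<..<t0} t)"
      unfolding \<kappa>_def by (intro scale[symmetric]) simp
    also have "\<dots> \<le> N (\<lambda>t. head_integral u (\<beta> t))"
    proof (rule mono)
      fix t :: real assume "0 < t"
      then show "head_integral u (ereal r0) * indicator {0<..<t0} t \<le> head_integral u (\<beta> t)"
        using r0 \<beta>[of t t0] by (auto simp: indicator_def intro!: head_integral_mono_arg)
    qed measurable
    finally show ?thesis .
  qed
  have local: "\<exists>C<\<infinity>. \<forall>u\<in>borel_measurable pos_leb. (\<integral>\<^sup>+x\<in>G. u x \<partial>pos_leb) \<le> C * N (\<lambda>t. head_integral u (\<beta> t))"
    if G: "G \<in> sets pos_leb" and G_fin: "emeasure pos_leb G < \<infinity>" for G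
  proof -
    obtain m where m: "emeasure pos_leb G = ennreal m" "0 \<le> m" using G_fin by (cases "emeasure pos_leb G") auto
    \<comment> \<open>\<open>G\<close> is cut into \<open>k\<close> parts of equal measure below
      \<open>r0\<close>; the integral over each part is then at most the head integral up to
      \<open>r0\<close>. The zero function in the sorted partition leaves a plain
      equipartition.\<close>
    obtain k where k: "m / r0 < real k" using reals_Archimedean2 by blast
    then have "0 < k" using m r0 by (metis divide_nonneg_pos le_less_trans of_nat_0_less_iff)
    let ?\<delta> = "ennreal (m / real k)"
    have \<delta>: "emeasure pos_leb G = of_nat k * ?\<delta>"
      using m \<open>0 < k\<close> by (simp add: ennreal_of_nat_eq_real_of_nat flip: ennreal_mult)
    have \<delta>_r0: "m / real k < r0"
      using k r0 \<open>0 < k\<close> by (simp add: field_simps)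
    obtain P where P: "\<And>j. j < k \<Longrightarrow> P j \<in> sets pos_leb" "\<And>j. j < k \<Longrightarrow> emeasure pos_leb (P j) = ?\<delta>"
      "disjoint_family_on P {..<k}" "(\<Union>j<k. P j) = G"
      using exists_sorted_partition[of "\<lambda>_. 0" G k ?\<delta>] G \<delta> \<open>0 < k\<close> by auto
    have "(\<integral>\<^sup>+x\<in>G. u x \<partial>pos_leb) \<le> (of_nat k / \<kappa>) * N (\<lambda>t. head_integral u (\<beta> t))"
      if u: "u \<in> borel_measurable pos_leb" for u
    proof -
      have "(\<integral>\<^sup>+x\<in>G. u x \<partial>pos_leb) = (\<Sum>j<k. \<integral>\<^sup>+x\<in>P j. u x \<partial>pos_leb)"
        unfolding P(4)[symmetric] using P(1) u by (intro set_nn_integral_finite_UN P(3)) auto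
      also have "\<dots> \<le> (\<Sum>j<k. head_integral u (ereal r0))"
      proof (rule sum_mono)
        fix j assume "j \<in> {..<k}"
        then have "(\<integral>\<^sup>+x\<in>P j. u x \<partial>pos_leb) \<le> (\<integral>\<^sup>+x\<in>{x. ennreal x < ?\<delta>}. decr u x \<partial>pos_leb)"
          using nn_integral_le_decr[OF u P(1), of j] P(2)[of j] by simp
        also have "\<dots> \<le> head_integral u (ereal r0)"
          unfolding head_integral_def using \<delta>_r0
          by (intro nn_integral_mono) (auto simp: indicator_def ennreal_less_iff)
        finally show "(\<integral>\<^sup>+x\<in>P j. u x \<partial>pos_leb) \<le> head_integral u (ereal r0)" .
      qed
      also have "\<dots> = of_nat k * head_integral u (ereal r0)" by simp
      also have "head_integral u (ereal r0) \<le> N (\<lambda>t. head_integral u (\<beta> t)) / \<kappa>"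
        using divide_right_mono_ennreal[OF head_le[of u], of \<kappa>] \<kappa>_pos \<kappa>_fin
        by (simp add: ennreal_mult_divide_eq)
      finally show ?thesis
        by (simp add: mult_left_mono ennreal_times_divide ennreal_divide_times)
    qed
    moreover have "of_nat k / \<kappa> < \<infinity>"
      using \<kappa>_pos by (simp add: ennreal_divide_eq_top_iff less_top[symmetric])
    ultimately show ?thesis by blast
  qed
  show ?thesis
  proof
    fix u :: "real \<Rightarrow> ennreal" assume u [measurable]: "u \<in> borel_measurable pos_leb"
    show "N (\<lambda>t. head_integral u (\<beta> t)) = 0 \<longleftrightarrow> (AE x in pos_leb. u x = 0)"
    proof
      assume *: "N (\<lambda>t. head_integral u (\<beta> t)) = 0"
      have "(\<integral>\<^sup>+x\<in>{0<..<real n}. u x \<partial>pos_leb) = 0" for n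
      proof -
        have "emeasure pos_leb {0<..<real n} < \<infinity>" by (simp add: emeasure_pos_leb_Ioo)
        from local[OF Ioo_sets_pos_leb this] obtain C where
          "\<forall>u\<in>borel_measurable pos_leb. (\<integral>\<^sup>+x\<in>{0<..<real n}. u x \<partial>pos_leb) \<le> C * N (\<lambda>t. head_integral u (\<beta> t))"
          by (elim exE conjE) (rule that)
        from bspec[OF this u]
        show ?thesis using * by simp
      qed
      then show "AE x in pos_leb. u x = 0" by (rule AE_eq_0_if_locally[OF u])
    next
      assume *: "AE x in pos_leb. u x = 0"
      have "head_integral u y = 0" for y
      proof -
        have "head_integral u y \<le> head_integral u \<infinity>" by (rule head_integral_mono_arg) simp
        also have "\<dots> = 0" using * by (simp add: head_integral_infty nn_integral_0_iff_AE)
        finally show ?thesis by simp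
      qed
      then show "N (\<lambda>t. head_integral u (\<beta> t)) = 0" by simp
    qed
    fix a :: real assume a: "0 \<le> a"
    have "head_integral (\<lambda>x. ennreal a * u x) y = ennreal a * head_integral u y" for y
      unfolding head_integral_def by (simp add: decr_scale[OF u a] mult.assoc nn_integral_cmult)
    then show "N (\<lambda>t. head_integral (\<lambda>x. ennreal a * u x) (\<beta> t)) = ennreal a * N (\<lambda>t. head_integral u (\<beta> t))"
      by (simp add: scale)
  next
    fix u v :: "real \<Rightarrow> ennreal"
    assume "u \<in> borel_measurable pos_leb" "v \<in> borel_measurable pos_leb"
    then have "N (\<lambda>t. head_integral (\<lambda>x. u x + v x) (\<beta> t)) \<le> N (\<lambda>t. head_integral u (\<beta> t) + head_integral v (\<beta> t))"
      by (intro mono head_integral_add_le) auto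
    also have "\<dots> \<le> N (\<lambda>t. head_integral u (\<beta> t)) + N (\<lambda>t. head_integral v (\<beta> t))"
      by (intro add_le) auto
    finally show "N (\<lambda>t. head_integral (\<lambda>x. u x + v x) (\<beta> t)) \<le> N (\<lambda>t. head_integral u (\<beta> t)) + N (\<lambda>t. head_integral v (\<beta> t))" .
  next
    fix u v :: "real \<Rightarrow> ennreal"
    assume "u \<in> borel_measurable pos_leb" "v \<in> borel_measurable pos_leb" "AE x in pos_leb. u x \<le> v x"
    then show "N (\<lambda>t. head_integral u (\<beta> t)) \<le> N (\<lambda>t. head_integral v (\<beta> t))"
      by (intro mono head_integral_mono distr_fn_mono_AE) auto
  next
    fix U :: "nat \<Rightarrow> real \<Rightarrow> ennreal"
    assume U: "\<And>j. U j \<in> borel_measurable pos_leb" and inc: "incseq U"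
    have "head_integral (U i) y \<le> head_integral (U j) y" if "i \<le> j" for i j y
      using inc U that by (intro head_integral_mono distr_fn_mono_AE) (auto simp: incseq_def le_fun_def)
    then show "N (\<lambda>t. head_integral (\<lambda>x. SUP j. U j x) (\<beta> t)) = (SUP j. N (\<lambda>t. head_integral (U j) (\<beta> t)))"
      unfolding head_integral_SUP[OF U inc] by (intro SUP_eq) (auto simp: incseq_def le_fun_def)
  next
    fix G assume G: "G \<in> sets pos_leb" "emeasure pos_leb G < \<infinity>"
    have "N (\<lambda>t. head_integral (indicator G) (\<beta> t)) \<le> N (\<lambda>t. max 1 (emeasure pos_leb G) * min 1 (e2ennreal (\<beta> t)))"
      using G(1) by (intro mono head_integral_indicator_le) auto
    also have "\<dots> = max 1 (emeasure pos_leb G) * N (\<lambda>t. min 1 (e2ennreal (\<beta> t)))"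
      by (rule scale) measurable
    also have "\<dots> < \<infinity>"
      using G(2) fin by (auto simp: ennreal_mult_less_top max_def)
    finally show "N (\<lambda>t. head_integral (indicator G) (\<beta> t)) < \<infinity>" .
    show "\<exists>C<\<infinity>. \<forall>u\<in>borel_measurable pos_leb. (\<integral>\<^sup>+x\<in>G. u x \<partial>pos_leb) \<le> C * N (\<lambda>t. head_integral u (\<beta> t))"
      by (rule local[OF G])
  next
    fix u v :: "real \<Rightarrow> ennreal" assume "\<And>t. distr_fn u t = distr_fn v t"
    then have "head_integral u y = head_integral v y" for y
      by (intro antisym head_integral_mono) auto
    then show "N (\<lambda>t. head_integral u (\<beta> t)) = N (\<lambda>t. head_integral v (\<beta> t))" by simp
  qed
qed

section \<open>Extended-real and nonnegative formulations\<close>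

lemma e2ennreal_mult: "0 \<le> x \<Longrightarrow> 0 \<le> y \<Longrightarrow> e2ennreal (x * y) = e2ennreal x * e2ennreal y"
  by (metis e2ennreal_enn2ereal enn2ereal_e2ennreal times_ennreal.rep_eq)

lemma e2ennreal_add: "0 \<le> x \<Longrightarrow> 0 \<le> y \<Longrightarrow> e2ennreal (x + y) = e2ennreal x + e2ennreal y"
  by (metis e2ennreal_enn2ereal enn2ereal_e2ennreal plus_ennreal.rep_eq)

lemma e2ennreal_eq_0_iff: "0 \<le> y \<Longrightarrow> e2ennreal y = 0 \<longleftrightarrow> y = 0"
  by (metis e2ennreal_enn2ereal enn2ereal_e2ennreal zero_ennreal.rep_eq)

lemma e2ennreal_one: "e2ennreal 1 = 1"
  by (metis e2ennreal_enn2ereal one_ennreal.rep_eq)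

lemma e2ennreal_min_one: "e2ennreal (min 1 y) = min 1 (e2ennreal y)"
  using min_of_mono[of e2ennreal 1 y] by (simp add: mono_def e2ennreal_mono e2ennreal_one)

lemma emeasure_level_abs:
  assumes "0 \<le> t"
  shows "emeasure pos_leb {s \<in> {0<..}. ereal t < \<bar>f s\<bar>} = distr_fn (\<lambda>x. e2ennreal \<bar>f x\<bar>) (ennreal t)"
proof -
  have "ereal t < \<bar>y\<bar> \<longleftrightarrow> ennreal t < e2ennreal \<bar>y\<bar>" for y :: ereal
    using assms by (cases y) (auto simp: ennreal_less_iff)
  then show ?thesis unfolding distr_fn_def by (intro arg_cong[where f = "emeasure pos_leb"]) auto
qed

lemma rearr_eq_decr:
  assumes f: "f \<in> meas_fns"
  shows "rearr f x = enn2ereal (decr (\<lambda>x. e2ennreal \<bar>f x\<bar>) x)"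
proof -
  let ?u = "\<lambda>x. e2ennreal \<bar>f x\<bar>"
  have u: "?u \<in> borel_measurable pos_leb" using f unfolding meas_fns_def by measurable
  have rearr: "rearr f x = Inf {ereal t | t. 0 \<le> t \<and> distr_fn ?u (ennreal t) \<le> ennreal x}"
    unfolding rearr_def by (intro arg_cong[where f = Inf] Collect_cong) (metis emeasure_level_abs)
  show ?thesis
  proof (rule antisym)
    show "enn2ereal (decr ?u x) \<le> rearr f x"
      unfolding rearr
    proof (rule Inf_greatest, safe)
      fix t :: real assume t: "0 \<le> t" "distr_fn ?u (ennreal t) \<le> ennreal x"
      then have "decr ?u x \<le> ennreal t" unfolding decr_def by (intro Inf_lower) simp
      then have "enn2ereal (decr ?u x) \<le> enn2ereal (ennreal t)" by (simp add: less_eq_ennreal.rep_eq)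
      then show "enn2ereal (decr ?u x) \<le> ereal t" using t by simp
    qed
    show "rearr f x \<le> enn2ereal (decr ?u x)"
    proof (cases "decr ?u x")
      case (real r)
      \<comment> \<open>The infimum defining \<open>decr\<close> is attained. When finite, it is
        thus one of the real thresholds over which \<open>rearr\<close> takes its infimum.\<close>
      have "distr_fn ?u (decr ?u x) \<le> ennreal x" using less_decr_iff[OF u, of "decr ?u x" x] by simp
      then show ?thesis unfolding rearr using real by (intro Inf_lower) auto
    qed (simp add: top_ennreal.rep_eq)
  qed
qed

text \<open>If the distribution functions differed at \<open>t\<close>, the smaller value would be a
  finite \<open>r\<close>, and \<open>less_decr_iff\<close> at \<open>r\<close> would give
  \<open>r < r\<close>.\<close>

lemma distr_fn_eq_if_decr_eq:
  assumes u: "u \<in> borel_measurable pos_leb" and v: "v \<in> borel_measurable pos_leb"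
    and eq: "\<And>x. 0 \<le> x \<Longrightarrow> decr u x = decr v x"
  shows "distr_fn u t = distr_fn v t"
proof -
  have *: "\<not> distr_fn w t < distr_fn w' t"
    if "w \<in> borel_measurable pos_leb" "w' \<in> borel_measurable pos_leb" "\<And>x. 0 \<le> x \<Longrightarrow> decr w x = decr w' x" for w w'
  proof
    assume less: "distr_fn w t < distr_fn w' t"
    then obtain r where r: "distr_fn w t = ennreal r" "0 \<le> r" by (cases "distr_fn w t") auto
    then have "ennreal r < distr_fn w t"
      using less less_decr_iff[OF that(1), of t r] less_decr_iff[OF that(2), of t r] that(3)[of r] by simp
    then show False using r by simp
  qed
  show ?thesis using *[OF u v eq] *[OF v u eq[symmetric]] by (meson linorder_neqE)
qed

lemma ri_norm_imp_ri_fn_norm: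
  assumes "ri_norm \<rho>"
  shows "ri_fn_norm (\<lambda>u. \<rho> (\<lambda>x. enn2ereal (u x)))"
proof -
  have nn: "(\<lambda>x. enn2ereal (u x)) \<in> nonneg_meas_fns" if "u \<in> borel_measurable pos_leb" for u
    using that by (auto simp: nonneg_meas_fns_def meas_fns_def)
  note \<rho> = assms[unfolded ri_norm_def]
  have P1: "\<forall>f\<in>nonneg_meas_fns. \<rho> f = 0 \<longleftrightarrow> (AE t in pos_leb. f t = 0)"
    and P1': "\<forall>f\<in>nonneg_meas_fns. \<forall>a\<ge>0. \<rho> (\<lambda>t. ereal a * f t) = ennreal a * \<rho> f"
    and P1'': "\<forall>f\<in>nonneg_meas_fns. \<forall>g\<in>nonneg_meas_fns. \<rho> (\<lambda>t. f t + g t) \<le> \<rho> f + \<rho> g"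
    and P2: "\<forall>f\<in>nonneg_meas_fns. \<forall>g\<in>nonneg_meas_fns. (AE t in pos_leb. f t \<le> g t) \<longrightarrow> \<rho> f \<le> \<rho> g"
    and P3: "\<forall>F f. (\<forall>j::nat. F j \<in> nonneg_meas_fns) \<and> f \<in> nonneg_meas_fns \<and>
        (AE t in pos_leb. incseq (\<lambda>j. F j t) \<and> (\<lambda>j. F j t) \<longlonglongrightarrow> f t) \<longrightarrow>
        incseq (\<lambda>j. \<rho> (F j)) \<and> (\<lambda>j. \<rho> (F j)) \<longlonglongrightarrow> \<rho> f"
    and P4: "\<forall>G\<in>fmeasurable pos_leb. \<rho> (indicator G) < \<infinity>"
    and P5: "\<forall>G\<in>fmeasurable pos_leb. \<exists>C>0. \<forall>f\<in>nonneg_meas_fns.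
        (\<integral>\<^sup>+t\<in>G. e2ennreal (f t) \<partial>pos_leb) \<le> ennreal C * \<rho> f"
    and P6: "\<forall>f\<in>nonneg_meas_fns. \<forall>g\<in>nonneg_meas_fns. (\<forall>x\<ge>0. rearr f x = rearr g x) \<longrightarrow> \<rho> f = \<rho> g"
    using \<rho> by blast+
  show ?thesis
  proof
    fix u :: "real \<Rightarrow> ennreal" assume u: "u \<in> borel_measurable pos_leb"
    have "enn2ereal y = 0 \<longleftrightarrow> y = 0" for y by (metis e2ennreal_enn2ereal zero_ennreal.rep_eq)
    then show "\<rho> (\<lambda>x. enn2ereal (u x)) = 0 \<longleftrightarrow> (AE x in pos_leb. u x = 0)"
      using bspec[OF P1 nn[OF u]] by simp
    fix a :: real assume "0 \<le> a"
    then show "\<rho> (\<lambda>x. enn2ereal (ennreal a * u x)) = ennreal a * \<rho> (\<lambda>x. enn2ereal (u x))"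
      using P1' nn[OF u] by (simp add: times_ennreal.rep_eq)
  next
    fix u v :: "real \<Rightarrow> ennreal" assume "u \<in> borel_measurable pos_leb" "v \<in> borel_measurable pos_leb"
    then show "\<rho> (\<lambda>x. enn2ereal (u x + v x)) \<le> \<rho> (\<lambda>x. enn2ereal (u x)) + \<rho> (\<lambda>x. enn2ereal (v x))"
      using P1'' nn by (simp add: plus_ennreal.rep_eq)
  next
    fix u v :: "real \<Rightarrow> ennreal" assume "u \<in> borel_measurable pos_leb" "v \<in> borel_measurable pos_leb"
      "AE x in pos_leb. u x \<le> v x"
    then show "\<rho> (\<lambda>x. enn2ereal (u x)) \<le> \<rho> (\<lambda>x. enn2ereal (v x))"
      using P2 nn by (simp add: less_eq_ennreal.rep_eq)
  next
    fix U :: "nat \<Rightarrow> real \<Rightarrow> ennreal"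
    assume U: "\<And>j. U j \<in> borel_measurable pos_leb" and inc: "incseq U"
    have "AE t in pos_leb. incseq (\<lambda>j. enn2ereal (U j t)) \<and> (\<lambda>j. enn2ereal (U j t)) \<longlonglongrightarrow> enn2ereal (SUP j. U j t)"
    proof (intro AE_I2 conjI)
      fix t
      have inc_t: "incseq (\<lambda>j. U j t)" using inc by (auto simp: incseq_def le_fun_def)
      then show "incseq (\<lambda>j. enn2ereal (U j t))" by (simp add: incseq_def less_eq_ennreal.rep_eq)
      show "(\<lambda>j. enn2ereal (U j t)) \<longlonglongrightarrow> enn2ereal (SUP j. U j t)"
        using LIMSEQ_SUP[OF inc_t] by simp
    qed
    moreover have "(\<lambda>t. SUP j. U j t) \<in> borel_measurable pos_leb" using U by measurable
    ultimately have "incseq (\<lambda>j. \<rho> (\<lambda>x. enn2ereal (U j x)))"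
      "(\<lambda>j. \<rho> (\<lambda>x. enn2ereal (U j x))) \<longlonglongrightarrow> \<rho> (\<lambda>x. enn2ereal (SUP j. U j x))"
      using P3[rule_format, of "\<lambda>j x. enn2ereal (U j x)" "\<lambda>x. enn2ereal (SUP j. U j x)"] nn U by auto
    then show "\<rho> (\<lambda>x. enn2ereal (SUP j. U j x)) = (SUP j. \<rho> (\<lambda>x. enn2ereal (U j x)))"
      using LIMSEQ_SUP LIMSEQ_unique by blast
  next
    fix G assume G: "G \<in> sets pos_leb" "emeasure pos_leb G < \<infinity>"
    then have G': "G \<in> fmeasurable pos_leb" by (simp add: fmeasurable_def)
    have "(\<lambda>x. enn2ereal (indicator G x)) = indicator G"
      by (auto simp: indicator_def zero_ennreal.rep_eq one_ennreal.rep_eq)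
    then show "\<rho> (\<lambda>x. enn2ereal (indicator G x)) < \<infinity>" using P4 G' by simp
    obtain C where "\<forall>f\<in>nonneg_meas_fns. (\<integral>\<^sup>+t\<in>G. e2ennreal (f t) \<partial>pos_leb) \<le> ennreal C * \<rho> f"
      using bspec[OF P5 G'] by blast
    then have "\<forall>u\<in>borel_measurable pos_leb. (\<integral>\<^sup>+x\<in>G. u x \<partial>pos_leb) \<le> ennreal C * \<rho> (\<lambda>x. enn2ereal (u x))"
      using nn by fastforce
    then show "\<exists>C<\<infinity>. \<forall>u\<in>borel_measurable pos_leb. (\<integral>\<^sup>+x\<in>G. u x \<partial>pos_leb) \<le> C * \<rho> (\<lambda>x. enn2ereal (u x))"
      by (intro exI[of _ "ennreal C"]) simp
  next
    fix u v :: "real \<Rightarrow> ennreal"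
    assume uv: "u \<in> borel_measurable pos_leb" "v \<in> borel_measurable pos_leb" "\<And>t. distr_fn u t = distr_fn v t"
    have "rearr (\<lambda>x. enn2ereal (u x)) x = rearr (\<lambda>x. enn2ereal (v x)) x" for x
      using uv nn by (simp add: rearr_eq_decr nonneg_meas_fns_def decr_def)
    then show "\<rho> (\<lambda>x. enn2ereal (u x)) = \<rho> (\<lambda>x. enn2ereal (v x))"
      using P6 nn uv by blast
  qed
qed

lemma (in ri_fn_norm) ri_norm_e2ennreal: "ri_norm (\<lambda>f. N (\<lambda>x. e2ennreal (f x)))"
proof -
  have meas: "(\<lambda>x. e2ennreal (f x)) \<in> borel_measurable pos_leb" if "f \<in> nonneg_meas_fns" for f
    using that unfolding nonneg_meas_fns_def meas_fns_def by auto
  have nn: "0 \<le> f x" if "f \<in> nonneg_meas_fns" "0 < x" for f x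
    using that by (simp add: nonneg_meas_fns_def)
  show ?thesis
    unfolding ri_norm_def
  proof (intro conjI ballI allI impI)
    fix f assume f: "f \<in> nonneg_meas_fns"
    have "(AE x in pos_leb. e2ennreal (f x) = 0) \<longleftrightarrow> (AE x in pos_leb. f x = 0)"
      using nn[OF f] by (intro AE_cong) (auto simp: e2ennreal_eq_0_iff)
    then show "N (\<lambda>x. e2ennreal (f x)) = 0 \<longleftrightarrow> (AE t in pos_leb. f t = 0)"
      using eq_0_iff[OF meas[OF f]] by simp
    fix a :: real assume a: "0 \<le> a"
    have "(\<lambda>x. ereal a * f x) \<in> nonneg_meas_fns"
      using f a by (auto simp: nonneg_meas_fns_def meas_fns_def)
    then have "N (\<lambda>x. e2ennreal (ereal a * f x)) = N (\<lambda>x. ennreal a * e2ennreal (f x))"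
      using f a nn[OF f] by (intro cong borel_measurable_times_ennreal meas) (auto simp: e2ennreal_mult)
    then show "N (\<lambda>x. e2ennreal (ereal a * f x)) = ennreal a * N (\<lambda>x. e2ennreal (f x))"
      using scale[OF meas[OF f]] by simp
  next
    fix f g assume f: "f \<in> nonneg_meas_fns" and g: "g \<in> nonneg_meas_fns"
    have "(\<lambda>x. f x + g x) \<in> nonneg_meas_fns"
      using f g by (auto simp: nonneg_meas_fns_def meas_fns_def)
    then have "N (\<lambda>x. e2ennreal (f x + g x)) = N (\<lambda>x. e2ennreal (f x) + e2ennreal (g x))"
      using f g nn[OF f] nn[OF g] by (intro cong borel_measurable_add meas) (auto simp: e2ennreal_add)
    then show "N (\<lambda>x. e2ennreal (f x + g x)) \<le> N (\<lambda>x. e2ennreal (f x)) + N (\<lambda>x. e2ennreal (g x))"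
      using add_le[OF meas[OF f] meas[OF g]] by simp
  next
    fix f g assume "f \<in> nonneg_meas_fns" "g \<in> nonneg_meas_fns" "AE t in pos_leb. f t \<le> g t"
    then show "N (\<lambda>x. e2ennreal (f x)) \<le> N (\<lambda>x. e2ennreal (g x))"
      by (intro mono_AE meas) (auto elim!: eventually_mono intro: e2ennreal_mono)
  next
    fix F :: "nat \<Rightarrow> fn" and f
    assume *: "(\<forall>j. F j \<in> nonneg_meas_fns) \<and> f \<in> nonneg_meas_fns \<and>
      (AE t in pos_leb. incseq (\<lambda>j. F j t) \<and> (\<lambda>j. F j t) \<longlonglongrightarrow> f t)"
    then have F: "\<And>j. F j \<in> nonneg_meas_fns" and f: "f \<in> nonneg_meas_fns"
      and lim: "AE t in pos_leb. incseq (\<lambda>j. F j t) \<and> (\<lambda>j. F j t) \<longlonglongrightarrow> f t" by auto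
    define U where "U = (\<lambda>j x. e2ennreal (F j x))"
    have U [measurable]: "U j \<in> borel_measurable pos_leb" for j unfolding U_def by (rule meas[OF F])
    have lim': "AE t in pos_leb. incseq (\<lambda>j. U j t) \<and> (SUP j. U j t) = e2ennreal (f t)"
      using lim
    proof (rule eventually_mono)
      fix t assume t: "incseq (\<lambda>j. F j t) \<and> (\<lambda>j. F j t) \<longlonglongrightarrow> f t"
      then have "incseq (\<lambda>j. U j t)" by (auto simp: incseq_def U_def intro: e2ennreal_mono)
      moreover have "(\<lambda>j. U j t) \<longlonglongrightarrow> e2ennreal (f t)"
        unfolding U_def using t by (intro tendsto_e2ennrealI) simp
      ultimately show "incseq (\<lambda>j. U j t) \<and> (SUP j. U j t) = e2ennreal (f t)"
        using LIMSEQ_SUP LIMSEQ_unique by blast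
    qed
    \<comment> \<open>(P3) provides monotonicity only almost everywhere, while \<open>SUP_eq\<close>
      asks for it everywhere. The running maxima \<open>V\<close> are monotone everywhere and agree
      with \<open>U\<close> almost everywhere.\<close>
    define V where "V j x = (SUP i\<in>{..j}. U i x)" for j :: nat and x
    have [measurable]: "V j \<in> borel_measurable pos_leb" for j unfolding V_def by measurable
    have "incseq V" unfolding V_def by (auto simp: incseq_def le_fun_def intro!: SUP_subset_mono)
    have V_U: "V j t = U j t" if "incseq (\<lambda>j. U j t)" for j t
      unfolding V_def using that by (intro antisym SUP_least SUP_upper) (auto simp: incseq_def)
    have NV: "N (V j) = N (U j)" for j
      using lim' by (intro cong_AE) (auto elim!: eventually_mono simp: V_U)
    have "AE x in pos_leb. e2ennreal (f x) = (SUP j. V j x)"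
      using lim' by (rule eventually_mono) (simp add: V_U)
    then have "N (\<lambda>x. e2ennreal (f x)) = N (\<lambda>x. SUP j. V j x)"
      by (intro cong_AE meas f) auto
    also have "\<dots> = (SUP j. N (V j))" using \<open>incseq V\<close> by (intro SUP_eq) auto
    finally have SUP: "N (\<lambda>x. e2ennreal (f x)) = (SUP j. N (U j))" by (simp add: NV)
    have inc: "incseq (\<lambda>j. N (U j))"
      unfolding NV[symmetric] using \<open>incseq V\<close> by (auto simp: incseq_def le_fun_def intro!: mono)
    then show "incseq (\<lambda>j. N (\<lambda>x. e2ennreal (F j x)))" by (simp add: U_def)
    show "(\<lambda>j. N (\<lambda>x. e2ennreal (F j x))) \<longlonglongrightarrow> N (\<lambda>x. e2ennreal (f x))"
      using LIMSEQ_SUP[OF inc] unfolding SUP by (simp add: U_def)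
  next
    fix G assume "G \<in> fmeasurable pos_leb"
    then have G: "G \<in> sets pos_leb" "emeasure pos_leb G < \<infinity>" by (auto simp: fmeasurable_def)
    have "(\<lambda>x. e2ennreal (indicator G x)) = indicator G"
      by (auto simp: indicator_def e2ennreal_one e2ennreal_eq_0_iff fun_eq_iff)
    then show "N (\<lambda>x. e2ennreal (indicator G x)) < \<infinity>" using indicator_finite[OF G] by simp
    obtain C where C: "C < \<infinity>" "\<forall>u\<in>borel_measurable pos_leb. (\<integral>\<^sup>+x\<in>G. u x \<partial>pos_leb) \<le> C * N u"
      using local_L1[OF G] by blast
    show "\<exists>C>0. \<forall>f\<in>nonneg_meas_fns. (\<integral>\<^sup>+t\<in>G. e2ennreal (f t) \<partial>pos_leb) \<le> ennreal C * N (\<lambda>x. e2ennreal (f x))"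
    proof (intro exI[of _ "enn2real C + 1"] conjI ballI)
      fix f assume f: "f \<in> nonneg_meas_fns"
      \<comment> \<open>(P5) asks for a positive real constant, while \<open>C\<close> may be
        0.\<close>
      have "C \<le> ennreal (enn2real C + 1)"
        using C(1) by (cases C) (auto intro: ennreal_leI)
      then show "(\<integral>\<^sup>+t\<in>G. e2ennreal (f t) \<partial>pos_leb) \<le> ennreal (enn2real C + 1) * N (\<lambda>x. e2ennreal (f x))"
        using bspec[OF C(2) meas[OF f]] by (meson mult_right_mono order_trans zero_le)
    qed (simp add: add_nonneg_pos)
  next
    fix f g assume f: "f \<in> nonneg_meas_fns" and g: "g \<in> nonneg_meas_fns" and eq: "\<forall>x\<ge>0. rearr f x = rearr g x"
    have abs_meas: "(\<lambda>x. e2ennreal \<bar>h x\<bar>) \<in> borel_measurable pos_leb" if "h \<in> nonneg_meas_fns" for h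
      using that unfolding nonneg_meas_fns_def meas_fns_def by auto
    have abs: "N (\<lambda>x. e2ennreal (h x)) = N (\<lambda>x. e2ennreal \<bar>h x\<bar>)" if "h \<in> nonneg_meas_fns" for h
      using nn[OF that] by (intro cong meas abs_meas that) simp
    have "N (\<lambda>x. e2ennreal \<bar>f x\<bar>) = N (\<lambda>x. e2ennreal \<bar>g x\<bar>)"
    proof (intro rearr_invariant distr_fn_eq_if_decr_eq abs_meas f g)
      fix x :: real assume "0 \<le> x"
      then have "rearr f x = rearr g x" using eq by simp
      then show "decr (\<lambda>x. e2ennreal \<bar>f x\<bar>) x = decr (\<lambda>x. e2ennreal \<bar>g x\<bar>) x"
        using f g by (simp add: rearr_eq_decr nonneg_meas_fns_def enn2ereal_inject)
    qed
    then show "N (\<lambda>x. e2ennreal (f x)) = N (\<lambda>x. e2ennreal (g x))"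
      by (simp only: abs[OF f] abs[OF g])
  qed
qed

text \<open>Agreement is required on \<open>meas_fns\<close> only, since the values of a space on
  other functions are unconstrained.\<close>

definition represents :: "((real \<Rightarrow> ennreal) \<Rightarrow> ennreal) \<Rightarrow> fn_space \<Rightarrow> bool" where
  "represents N X \<longleftrightarrow> (\<forall>f\<in>meas_fns. X f = N (\<lambda>x. e2ennreal \<bar>f x\<bar>))"

lemma ri_space_iff: "ri_space X \<longleftrightarrow> (\<exists>N. ri_fn_norm N \<and> represents N X)"
proof
  assume "ri_space X"
  then obtain \<rho> where \<rho>: "ri_norm \<rho>" "\<forall>f\<in>meas_fns. X f = \<rho> (\<lambda>t. \<bar>f t\<bar>)"
    by (auto simp: ri_space_def)
  then have "represents (\<lambda>u. \<rho> (\<lambda>x. enn2ereal (u x))) X"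
    by (simp add: represents_def enn2ereal_e2ennreal)
  then show "\<exists>N. ri_fn_norm N \<and> represents N X"
    using ri_norm_imp_ri_fn_norm[OF \<rho>(1)] by blast
next
  assume "\<exists>N. ri_fn_norm N \<and> represents N X"
  then show "ri_space X"
    using ri_fn_norm.ri_norm_e2ennreal unfolding ri_space_def represents_def by blast
qed

lemma meas_fns_enn2ereal: "u \<in> borel_measurable pos_leb \<Longrightarrow> (\<lambda>x. enn2ereal (u x)) \<in> meas_fns"
  by (simp add: meas_fns_def)

lemma measurable_e2ennreal_abs: "f \<in> meas_fns \<Longrightarrow> (\<lambda>x. e2ennreal \<bar>f x\<bar>) \<in> borel_measurable pos_leb"
  by (simp add: meas_fns_def)

lemma represents_enn2ereal:
  "represents N X \<Longrightarrow> u \<in> borel_measurable pos_leb \<Longrightarrow> X (\<lambda>x. enn2ereal (u x)) = N u"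
  by (simp add: represents_def meas_fns_enn2ereal)

section \<open>Associate spaces and \<Upsilon> in terms of [0,\<infinity>]-valued functions\<close>

lemma represents_associate:
  assumes X: "represents N X"
  shows "represents (assoc N) (associate X)"
  unfolding represents_def
proof
  fix f
  have mult: "e2ennreal \<bar>f t * g t\<bar> = e2ennreal \<bar>g t\<bar> * e2ennreal \<bar>f t\<bar>" for g :: fn and t
    by (simp add: ereal_abs_mult e2ennreal_mult mult.commute)
  show "associate X f = assoc N (\<lambda>x. e2ennreal \<bar>f x\<bar>)"
  proof (rule antisym)
    show "associate X f \<le> assoc N (\<lambda>x. e2ennreal \<bar>f x\<bar>)"
      unfolding associate_def mult
    proof (rule SUP_least)
      fix g assume "g \<in> {g \<in> elems X. X g \<le> 1}"
      then have "g \<in> meas_fns" "N (\<lambda>x. e2ennreal \<bar>g x\<bar>) \<le> 1" using X by (auto simp: elems_def represents_def)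
      then show "(\<integral>\<^sup>+t. e2ennreal \<bar>g t\<bar> * e2ennreal \<bar>f t\<bar> \<partial>pos_leb) \<le> assoc N (\<lambda>x. e2ennreal \<bar>f x\<bar>)"
        by (intro assoc_upper measurable_e2ennreal_abs)
    qed
    show "assoc N (\<lambda>x. e2ennreal \<bar>f x\<bar>) \<le> associate X f"
    proof (rule assoc_least)
      fix u assume u: "u \<in> borel_measurable pos_leb" "N u \<le> 1"
      then have "(\<lambda>x. enn2ereal (u x)) \<in> {g \<in> elems X. X g \<le> 1}"
        using represents_enn2ereal[OF X u(1)] meas_fns_enn2ereal[OF u(1)]
        by (auto simp: elems_def le_less_trans)
      then have "(\<integral>\<^sup>+t. e2ennreal \<bar>enn2ereal (u t)\<bar> * e2ennreal \<bar>f t\<bar> \<partial>pos_leb) \<le> associate X f"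
        unfolding associate_def mult by (rule SUP_upper)
      then show "(\<integral>\<^sup>+x. u x * e2ennreal \<bar>f x\<bar> \<partial>pos_leb) \<le> associate X f" by simp
    qed
  qed
qed

lemma T_op_eq:
  assumes "f \<in> meas_fns"
  shows "T_op \<beta> f t = enn2ereal (head_integral (\<lambda>x. e2ennreal \<bar>f x\<bar>) (\<beta> t))"
  using assms by (simp add: T_op_def head_integral_def rearr_eq_decr)

lemma represents_Upsilon:
  assumes X: "represents N X" and \<beta>: "\<And>x y. 0 < x \<Longrightarrow> x \<le> y \<Longrightarrow> \<beta> y \<le> \<beta> x"
  shows "represents (\<lambda>u. N (\<lambda>t. head_integral u (\<beta> t))) (Upsilon \<beta> X)"
  unfolding represents_def Upsilon_def
proof
  fix f assume f: "f \<in> meas_fns"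
  have "T_op \<beta> f = (\<lambda>t. enn2ereal (head_integral (\<lambda>x. e2ennreal \<bar>f x\<bar>) (\<beta> t)))"
    using T_op_eq[OF f] by blast
  then show "X (T_op \<beta> f) = N (\<lambda>t. head_integral (\<lambda>x. e2ennreal \<bar>f x\<bar>) (\<beta> t))"
    using represents_enn2ereal[OF X measurable_head_integral_antimono[OF \<beta>]] by simp
qed

section \<open>The generalized inverse and duality\<close>

text \<open>For nonincreasing \<open>b\<close> the limit at 0 is the supremum, so \<open>t\<close>
  lies below it exactly when some value of \<open>b\<close> exceeds \<open>t\<close>.\<close>

lemma gen_inverse_eq:
  assumes b: "antimono_on {0<..} b"
  shows "gen_inverse b t = (if \<exists>s>0. t < b s then Sup {ereal s | s. 0 < s \<and> t \<le> b s} else 0)"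
proof -
  let ?S = "SUP s\<in>{0<..}. ereal (b s)"
  have "((\<lambda>s. ereal (b s)) \<longlongrightarrow> ?S) (at_right 0)"
  proof (rule order_tendstoI)
    fix a assume "a < ?S"
    then obtain s where s: "0 < s" "a < ereal (b s)" by (auto simp: less_SUP_iff)
    have "a < ereal (b r)" if "0 < r" "r < s" for r
      using s that b by (auto simp: monotone_on_def intro: less_le_trans)
    then show "\<forall>\<^sub>F r in at_right 0. a < ereal (b r)"
      using s(1) by (auto simp: eventually_at_right_field)
  next
    fix a assume "?S < a"
    moreover have "ereal (b r) \<le> ?S" if "0 < r" for r using that by (intro SUP_upper) simp
    ultimately show "\<forall>\<^sub>F r in at_right 0. ereal (b r) < a"
      by (auto simp: eventually_at_right_field intro!: exI[of _ 1] intro: le_less_trans)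
  qed
  then have "Lim (at_right 0) (\<lambda>s. ereal (b s)) = ?S" by (intro tendsto_Lim) simp
  then show ?thesis by (auto simp: gen_inverse_def less_SUP_iff)
qed

text \<open>The last two facts are the halves of a Galois connection, each with strictness lost:
  equality \<open>s = b t\<close> occurs where \<open>b\<close> is constant, equality of
  \<open>t\<close> with the inverse at \<open>s\<close> where \<open>b\<close> jumps.\<close>

lemma
  assumes b: "antimono_on {0<..} b"
  shows gen_inverse_nonneg: "0 \<le> gen_inverse b t"
    and gen_inverse_antimono: "x \<le> y \<Longrightarrow> gen_inverse b y \<le> gen_inverse b x"
    and less_gen_inverseD: "0 < t \<Longrightarrow> ereal t < gen_inverse b s \<Longrightarrow> s \<le> b t"
    and le_gen_inverseI: "0 < t \<Longrightarrow> s < b t \<Longrightarrow> ereal t \<le> gen_inverse b s"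
proof -
  show le: "ereal t \<le> gen_inverse b s" if "0 < t" "s < b t" for t s
  proof -
    have "\<exists>r>0. s < b r" using that by blast
    moreover have "ereal t \<in> {ereal r | r. 0 < r \<and> s \<le> b r}" using that by auto
    ultimately show ?thesis by (simp add: gen_inverse_eq[OF b] Sup_upper)
  qed
  show nonneg: "0 \<le> gen_inverse b t" for t
  proof (cases "\<exists>s>0. t < b s")
    case True
    then obtain s where "0 < s" "t < b s" by blast
    then show ?thesis using le[of s t] by (meson ereal_less_eq(5) less_imp_le order_trans)
  next
    case False
    then show ?thesis by (auto simp: gen_inverse_eq[OF b])
  qed
  show "gen_inverse b y \<le> gen_inverse b x" if "x \<le> y" for x y
  proof (cases "\<exists>s>0. y < b s")
    case True
    then have "\<exists>s>0. x < b s" using that by (meson le_less_trans)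
    then show ?thesis
      unfolding gen_inverse_eq[OF b] using True that by (auto intro!: Sup_subset_mono)
  next
    case False
    then have "gen_inverse b y = 0" by (auto simp: gen_inverse_eq[OF b])
    then show ?thesis using nonneg[of x] by simp
  qed
  show "s \<le> b t" if t: "0 < t" "ereal t < gen_inverse b s" for t s
  proof -
    have "ereal t < Sup {ereal r | r. 0 < r \<and> s \<le> b r}"
      using t by (auto simp: gen_inverse_eq[OF b] split: if_splits)
    then obtain r where "0 < r" "s \<le> b r" "t < r" by (auto simp: less_Sup_iff)
    then show ?thesis using t(1) b by (auto simp: monotone_on_def intro: order_trans)
  qed
qed

lemma AE_pos_leb_neq: "AE x in pos_leb. ereal x \<noteq> c"
proof -
  have "{real_of_ereal c} \<inter> {0<..} \<in> null_sets pos_leb"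
    by (cases "0 < real_of_ereal c")
       (auto simp: null_sets_def sets_pos_leb_iff emeasure_pos_leb)
  then show ?thesis by (rule AE_I') auto
qed

text \<open>The regions \<open>s < b t\<close> and \<open>t < b\<^sup>-\<^sup>1 s\<close> differ by a set with null sections,
  which makes the two operators formally adjoint.\<close>

lemma nn_integral_gen_inverse_swap:
  fixes F G :: "real \<Rightarrow> ennreal"
  assumes b: "antimono_on {0<..} b"
    and [measurable]: "F \<in> borel_measurable pos_leb" "G \<in> borel_measurable pos_leb"
  shows "(\<integral>\<^sup>+t. (\<integral>\<^sup>+s\<in>{s. ereal s < ereal (b t)}. F s \<partial>pos_leb) * G t \<partial>pos_leb) =
    (\<integral>\<^sup>+s. (\<integral>\<^sup>+t\<in>{t. ereal t < gen_inverse b s}. G t \<partial>pos_leb) * F s \<partial>pos_leb)"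
proof -
  have b_meas [measurable]: "(\<lambda>t. ereal (b t)) \<in> borel_measurable pos_leb"
    using b by (intro borel_measurable_pos_leb_antimono) (auto simp: monotone_on_def)
  have i_meas [measurable]: "gen_inverse b \<in> borel_measurable pos_leb"
    by (intro borel_measurable_pos_leb_antimono gen_inverse_antimono[OF b])
  define f where "f s t = F s * G t * (if ereal s < ereal (b t) then 1 else 0)" for s t
  define k where "k s t = F s * G t * (if ereal t < gen_inverse b s then 1 else 0)" for s t
  have f_meas: "(\<lambda>(s, t). f s t) \<in> borel_measurable (pos_leb \<Otimes>\<^sub>M pos_leb)"
    and k_meas: "(\<lambda>(s, t). k s t) \<in> borel_measurable (pos_leb \<Otimes>\<^sub>M pos_leb)"
    unfolding f_def k_def by measurable
  have L: "(\<integral>\<^sup>+t. (\<integral>\<^sup>+s\<in>{s. ereal s < ereal (b t)}. F s \<partial>pos_leb) * G t \<partial>pos_leb) = (\<integral>\<^sup>+t. (\<integral>\<^sup>+s. f s t \<partial>pos_leb) \<partial>pos_leb)"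
    by (intro nn_integral_cong, subst nn_integral_multc[symmetric])
       (auto intro!: nn_integral_cong simp: f_def indicator_def)
  have R: "(\<integral>\<^sup>+s. (\<integral>\<^sup>+t\<in>{t. ereal t < gen_inverse b s}. G t \<partial>pos_leb) * F s \<partial>pos_leb) = (\<integral>\<^sup>+s. (\<integral>\<^sup>+t. k s t \<partial>pos_leb) \<partial>pos_leb)"
    by (intro nn_integral_cong, subst nn_integral_multc[symmetric])
       (auto intro!: nn_integral_cong simp: k_def indicator_def mult_ac)
  have f_swap: "(\<integral>\<^sup>+t. (\<integral>\<^sup>+s. f s t \<partial>pos_leb) \<partial>pos_leb) = (\<integral>\<^sup>+s. (\<integral>\<^sup>+t. f s t \<partial>pos_leb) \<partial>pos_leb)"
    by (rule pos_leb2.Fubini'[OF f_meas])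
  have k_swap: "(\<integral>\<^sup>+t. (\<integral>\<^sup>+s. k s t \<partial>pos_leb) \<partial>pos_leb) = (\<integral>\<^sup>+s. (\<integral>\<^sup>+t. k s t \<partial>pos_leb) \<partial>pos_leb)"
    by (rule pos_leb2.Fubini'[OF k_meas])
  \<comment> \<open>For fixed \<open>s\<close> the comparison can fail only at
    \<open>t = gen_inverse b s\<close>; the converse one, for fixed \<open>t\<close>, only at
    \<open>s = b t\<close>. Each is therefore made inside the integral in which the exceptional set
    is a point, and Tonelli joins them.\<close>
  have fk: "(\<integral>\<^sup>+t. f s t \<partial>pos_leb) \<le> (\<integral>\<^sup>+t. k s t \<partial>pos_leb)" for s
  proof (rule nn_integral_mono_AE)
    show "AE t in pos_leb. f s t \<le> k s t"
      using AE_pos_leb_neq[of "gen_inverse b s"] AE_space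
    proof eventually_elim
      case (elim t)
      then show ?case using le_gen_inverseI[OF b, of t s] by (auto simp: f_def k_def)
    qed
  qed
  have kf: "(\<integral>\<^sup>+s. k s t \<partial>pos_leb) \<le> (\<integral>\<^sup>+s. f s t \<partial>pos_leb)" if "0 < t" for t
  proof (rule nn_integral_mono_AE)
    show "AE s in pos_leb. k s t \<le> f s t"
      using AE_pos_leb_neq[of "ereal (b t)"]
    proof eventually_elim
      case (elim s)
      then show ?case using less_gen_inverseD[OF b that, of s] by (auto simp: f_def k_def)
    qed
  qed
  show ?thesis
    unfolding L R
  proof (rule antisym)
    show "(\<integral>\<^sup>+t. (\<integral>\<^sup>+s. f s t \<partial>pos_leb) \<partial>pos_leb) \<le> (\<integral>\<^sup>+s. (\<integral>\<^sup>+t. k s t \<partial>pos_leb) \<partial>pos_leb)"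
      unfolding f_swap by (rule nn_integral_mono) (rule fk)
    show "(\<integral>\<^sup>+s. (\<integral>\<^sup>+t. k s t \<partial>pos_leb) \<partial>pos_leb) \<le> (\<integral>\<^sup>+t. (\<integral>\<^sup>+s. f s t \<partial>pos_leb) \<partial>pos_leb)"
      unfolding k_swap[symmetric] by (rule nn_integral_mono) (simp add: kf)
  qed
qed

lemma nn_integral_head_integral_swap:
  assumes b: "antimono_on {0<..} b"
  shows "(\<integral>\<^sup>+t. head_integral u (ereal (b t)) * decr v t \<partial>pos_leb) =
    (\<integral>\<^sup>+s. head_integral v (gen_inverse b s) * decr u s \<partial>pos_leb)"
  unfolding head_integral_def by (rule nn_integral_gen_inverse_swap[OF b]) measurable

lemma (in ri_fn_norm) decr_eq: "u \<in> borel_measurable pos_leb \<Longrightarrow> N (decr u) = N u"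
  by (intro rearr_invariant) auto

lemma (in ri_fn_norm) assoc_decr_eq:
  assumes "u \<in> borel_measurable pos_leb"
  shows "assoc N (decr u) = assoc N u"
proof -
  interpret A: ri_fn_norm "assoc N" by (rule ri_fn_norm_assoc)
  show ?thesis using assms by (rule A.decr_eq)
qed

text \<open>The constant is 1: after the swap, the Hoelder inequality is applied to
  \<open>decr u\<close>, which has the same norm as \<open>u\<close>.\<close>

lemma head_integral_bounded:
  assumes N: "ri_fn_norm N" and b: "antimono_on {0<..} b"
    and u [measurable]: "u \<in> borel_measurable pos_leb" and fin: "N u < \<infinity>"
  shows "assoc (\<lambda>v. assoc N (\<lambda>s. head_integral v (gen_inverse b s))) (\<lambda>t. head_integral u (ereal (b t))) \<le> N u"
proof (rule assoc_least)
  interpret ri_fn_norm N by fact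
  fix v assume v [measurable]: "v \<in> borel_measurable pos_leb"
    and le1: "assoc N (\<lambda>s. head_integral v (gen_inverse b s)) \<le> 1"
  have inv_meas: "(\<lambda>s. head_integral v (gen_inverse b s)) \<in> borel_measurable pos_leb"
    by (intro measurable_head_integral_antimono gen_inverse_antimono[OF b])
  have "(\<integral>\<^sup>+t. v t * head_integral u (ereal (b t)) \<partial>pos_leb) \<le> (\<integral>\<^sup>+t. head_integral u (ereal (b t)) * decr v t \<partial>pos_leb)"
    unfolding mult.commute[of "v _"] using b
    by (intro Hardy_Littlewood_antimono head_integral_mono_arg v) (auto simp: monotone_on_def)
  also have "\<dots> = (\<integral>\<^sup>+s. head_integral v (gen_inverse b s) * decr u s \<partial>pos_leb)"
    by (rule nn_integral_head_integral_swap[OF b])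
  also have "\<dots> = (\<integral>\<^sup>+s. decr u s * head_integral v (gen_inverse b s) \<partial>pos_leb)"
    by (simp add: mult.commute)
  also have "\<dots> \<le> N (decr u) * assoc N (\<lambda>s. head_integral v (gen_inverse b s))"
    using fin decr_eq[OF u] inv_meas by (intro Hoelder) auto
  also have "\<dots> \<le> N u * 1"
    unfolding decr_eq[OF u] by (intro mult_left_mono le1) simp
  finally show "(\<integral>\<^sup>+t. v t * head_integral u (ereal (b t)) \<partial>pos_leb) \<le> N u" by simp
qed

text \<open>Both optimality and nonexistence rest on this estimate; in the latter the left side is
  infinite for an indicator whose right side is finite.\<close>

lemma head_integral_gen_inverse_le_assoc:
  assumes N: "ri_fn_norm N" and M: "ri_fn_norm M" and b: "antimono_on {0<..} b" and C: "C < \<infinity>"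
    and bounded: "\<And>u. u \<in> borel_measurable pos_leb \<Longrightarrow> N u < \<infinity> \<Longrightarrow> M (\<lambda>t. head_integral u (ereal (b t))) \<le> C * N u"
    and v [measurable]: "v \<in> borel_measurable pos_leb"
  shows "assoc N (\<lambda>s. head_integral v (gen_inverse b s)) \<le> C * assoc M v"
proof (rule assoc_least)
  interpret N: ri_fn_norm N by fact
  interpret M: ri_fn_norm M by fact
  fix u assume u [measurable]: "u \<in> borel_measurable pos_leb" and le1: "N u \<le> 1"
  have b_meas: "(\<lambda>t. head_integral u (ereal (b t))) \<in> borel_measurable pos_leb"
    using b by (intro measurable_head_integral_antimono) (auto simp: monotone_on_def)
  have "M (\<lambda>t. head_integral u (ereal (b t))) \<le> C * N u"
    using le1 by (intro bounded u) (auto intro: le_less_trans)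
  also have "\<dots> \<le> C * 1" by (intro mult_left_mono le1) simp
  finally have M_le: "M (\<lambda>t. head_integral u (ereal (b t))) \<le> C" by simp
  have "(\<integral>\<^sup>+s. u s * head_integral v (gen_inverse b s) \<partial>pos_leb) \<le> (\<integral>\<^sup>+s. head_integral v (gen_inverse b s) * decr u s \<partial>pos_leb)"
    unfolding mult.commute[of "u _"]
    by (intro Hardy_Littlewood_antimono head_integral_mono_arg gen_inverse_antimono[OF b] u)
  also have "\<dots> = (\<integral>\<^sup>+t. head_integral u (ereal (b t)) * decr v t \<partial>pos_leb)"
    by (rule nn_integral_head_integral_swap[OF b, symmetric])
  also have "\<dots> \<le> M (\<lambda>t. head_integral u (ereal (b t))) * assoc M (decr v)"
    using M_le C by (intro M.Hoelder b_meas) auto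
  also have "\<dots> \<le> C * assoc M v"
    unfolding M.assoc_decr_eq[OF v] by (intro mult_right_mono M_le) simp
  finally show "(\<integral>\<^sup>+s. u s * head_integral v (gen_inverse b s) \<partial>pos_leb) \<le> C * assoc M v" .
qed

lemma min_le_head_integral_indicator: "min 1 (e2ennreal y) \<le> head_integral (indicator {0<..<1}) y"
proof -
  have ind: "1 \<le> decr (indicator {0<..<1}) s" if "s < 1" for s :: real
  proof (rule dense_le)
    fix t :: ennreal assume "t < 1"
    then have "{x. 0 < x \<and> t < indicator {0<..<1} x} = {0<..<1::real}"
      by (auto simp: indicator_def split: if_splits)
    then have "ennreal s < distr_fn (indicator {0<..<1}) t"
      using that by (simp add: distr_fn_def emeasure_pos_leb_Ioo ennreal_less_one_iff)
    then show "t \<le> decr (indicator {0<..<1}) s"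
      by (simp add: less_decr_iff less_imp_le)
  qed
  have "min 1 (e2ennreal y) = e2ennreal (min 1 y)"
    by (rule e2ennreal_min_one[symmetric])
  also have "\<dots> = (\<integral>\<^sup>+s\<in>{s. ereal s < min 1 y}. 1 \<partial>pos_leb)"
    using nn_integral_const_less[where y = "min 1 y" and c = 1] by simp
  also have "\<dots> \<le> head_integral (indicator {0<..<1}) y"
    unfolding head_integral_def using ind by (intro nn_integral_mono) (auto simp: indicator_def)
  finally show ?thesis .
qed

lemma represents_bounded_op:
  assumes N: "represents N X" and M: "represents M Y" and \<beta>: "\<And>x y. 0 < x \<Longrightarrow> x \<le> y \<Longrightarrow> \<beta> y \<le> \<beta> x"
  shows "bounded_op (T_op \<beta>) X Y \<longleftrightarrow>
    (\<exists>C>0. \<forall>u\<in>borel_measurable pos_leb. N u < \<infinity> \<longrightarrow> M (\<lambda>t. head_integral u (\<beta> t)) \<le> ennreal C * N u)"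
proof -
  have Y: "Y (T_op \<beta> f) = M (\<lambda>t. head_integral (\<lambda>x. e2ennreal \<bar>f x\<bar>) (\<beta> t))" if "f \<in> meas_fns" for f
    using represents_Upsilon[OF M \<beta>] that by (simp add: represents_def Upsilon_def)
  show ?thesis
  proof
    assume "bounded_op (T_op \<beta>) X Y"
    then obtain C where C: "0 < C" "\<And>f. f \<in> elems X \<Longrightarrow> Y (T_op \<beta> f) \<le> ennreal C * X f"
      by (auto simp: bounded_op_def)
    have "M (\<lambda>t. head_integral u (\<beta> t)) \<le> ennreal C * N u" if u: "u \<in> borel_measurable pos_leb" "N u < \<infinity>" for u
      using C(2)[of "\<lambda>x. enn2ereal (u x)"] Y[OF meas_fns_enn2ereal[OF u(1)]] u meas_fns_enn2ereal[OF u(1)]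
      by (simp add: elems_def represents_enn2ereal[OF N])
    then show "\<exists>C>0. \<forall>u\<in>borel_measurable pos_leb. N u < \<infinity> \<longrightarrow> M (\<lambda>t. head_integral u (\<beta> t)) \<le> ennreal C * N u"
      using C(1) by blast
  next
    assume "\<exists>C>0. \<forall>u\<in>borel_measurable pos_leb. N u < \<infinity> \<longrightarrow> M (\<lambda>t. head_integral u (\<beta> t)) \<le> ennreal C * N u"
    then obtain C where C: "0 < C"
      "\<forall>u\<in>borel_measurable pos_leb. N u < \<infinity> \<longrightarrow> M (\<lambda>t. head_integral u (\<beta> t)) \<le> ennreal C * N u" by blast
    have "Y (T_op \<beta> f) \<le> ennreal C * X f" if "f \<in> elems X" for f
      using that C(2) N Y[of f] measurable_e2ennreal_abs[of f] by (auto simp: elems_def represents_def)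
    then show "bounded_op (T_op \<beta>) X Y" using C(1) by (auto simp: bounded_op_def)
  qed
qed

theorem theorem4p8:
  fixes b :: "real \<Rightarrow> real" and X :: fn_space
  assumes b_nonneg: "\<forall>t>0. 0 \<le> b t"
    and b_noninc: "antimono_on {0<..} b"
    and b_nonzero: "\<exists>t>0. b t \<noteq> 0"
    and X: "ri_space X"
  shows "((\<lambda>t. min 1 (gen_inverse b t)) \<in> elems (associate X) \<longrightarrow>
           bounded_op (T_op (\<lambda>t. ereal (b t))) X
             (associate (Upsilon (gen_inverse b) (associate X))) \<and>
           optimal_range_partner {Y. ri_space Y} (T_op (\<lambda>t. ereal (b t))) X
             (associate (Upsilon (gen_inverse b) (associate X)))) \<and>
         ((\<lambda>t. min 1 (gen_inverse b t)) \<notin> elems (associate X) \<longrightarrow>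
           \<not> (\<exists>Y. ri_space Y \<and> range_partner (T_op (\<lambda>t. ereal (b t))) X Y))"
proof -
  let ?T = "T_op (\<lambda>t. ereal (b t))" and ?\<beta> = "gen_inverse b"
  let ?Y = "associate (Upsilon ?\<beta> (associate X))"
  have b_anti: "ereal (b y) \<le> ereal (b x)" if "0 < x" "x \<le> y" for x y
    using b_noninc that by (auto simp: monotone_on_def)
  have \<beta>_anti: "?\<beta> y \<le> ?\<beta> x" if "0 < x" "x \<le> y" for x y
    using that by (intro gen_inverse_antimono[OF b_noninc])
  obtain N where N: "ri_fn_norm N" and NX: "represents N X" using X by (auto simp: ri_space_iff)
  interpret N: ri_fn_norm N by fact
  interpret N': ri_fn_norm "assoc N" by (rule N.ri_fn_norm_assoc)
  \<comment> \<open>\<open>K\<close> is the norm of \<Upsilon> built from the generalized inverse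
    and the associate space of \<open>X\<close>.\<close>
  define K where "K = (\<lambda>u. assoc N (\<lambda>s. head_integral u (?\<beta> s)))"
  have KY: "represents (assoc K) ?Y"
    unfolding K_def by (intro represents_associate represents_Upsilon NX \<beta>_anti)
  have bounded_iff: "bounded_op ?T X Z \<longleftrightarrow> (\<exists>C>0. \<forall>u\<in>borel_measurable pos_leb. N u < \<infinity> \<longrightarrow>
      M (\<lambda>t. head_integral u (ereal (b t))) \<le> ennreal C * N u)" if "represents M Z" for M Z
    by (rule represents_bounded_op[OF NX that b_anti])
  let ?m = "\<lambda>t. min 1 (e2ennreal (?\<beta> t))"
  have \<beta>_meas: "?\<beta> \<in> borel_measurable pos_leb"
    using \<beta>_anti by (rule borel_measurable_pos_leb_antimono)
  have m_meas: "(\<lambda>t. min 1 (?\<beta> t)) \<in> meas_fns"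
    unfolding meas_fns_def using \<beta>_meas by measurable
  have m_eq: "e2ennreal \<bar>min 1 (?\<beta> t)\<bar> = ?m t" for t
  proof -
    have "0 \<le> min 1 (?\<beta> t)" using gen_inverse_nonneg[OF b_noninc, of t] by simp
    then have "\<bar>min 1 (?\<beta> t)\<bar> = min 1 (?\<beta> t)" by simp
    then show ?thesis by (simp add: e2ennreal_min_one)
  qed
  have elem_iff: "(\<lambda>t. min 1 (?\<beta> t)) \<in> elems (associate X) \<longleftrightarrow> assoc N ?m < \<infinity>"
    using represents_associate[OF NX] m_meas by (simp add: elems_def represents_def m_eq)
  have partner: "\<exists>C<\<infinity>. \<forall>v\<in>borel_measurable pos_leb. K v \<le> C * assoc M v"
    if M: "ri_fn_norm M" "represents M Z" and Z: "range_partner ?T X Z" for M Z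
  proof -
    obtain C where C: "\<And>u. u \<in> borel_measurable pos_leb \<Longrightarrow> N u < \<infinity> \<Longrightarrow>
        M (\<lambda>t. head_integral u (ereal (b t))) \<le> ennreal C * N u"
      using Z bounded_iff[OF M(2)] by (auto simp: range_partner_def)
    have "K v \<le> ennreal C * assoc M v" if "v \<in> borel_measurable pos_leb" for v
      unfolding K_def using that C by (intro head_integral_gen_inverse_le_assoc[OF N M(1) b_noninc]) auto
    then show ?thesis by (intro exI[of _ "ennreal C"]) simp
  qed
  show ?thesis
  proof (intro conjI impI)
    assume "(\<lambda>t. min 1 (?\<beta> t)) \<in> elems (associate X)"
    then have fin: "assoc N ?m < \<infinity>" using elem_iff by simp
    obtain s0 where s0: "0 < s0" "0 < b s0" using b_nonneg b_nonzero by (metis order_less_le)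
    \<comment> \<open>Halving makes the argument strictly smaller than \<open>b s0\<close>, so the
      inverse there is at least \<open>s0\<close>. This is the point of positivity needed for
      \<open>K\<close> to be a norm.\<close>
    have "0 < ?\<beta> (b s0 / 2)"
      using le_gen_inverseI[OF b_noninc s0(1), of "b s0 / 2"] s0 by (auto intro: less_le_trans[of _ "ereal s0"])
    then have K: "ri_fn_norm K"
      unfolding K_def using s0 fin by (intro N'.ri_fn_norm_head_integral[where \<beta> = ?\<beta>] \<beta>_anti) auto
    interpret K: ri_fn_norm K by (rule K)
    show bounded: "bounded_op ?T X ?Y"
      unfolding bounded_iff[OF KY] using head_integral_bounded[OF N b_noninc] by (intro exI[of _ 1]) (auto simp: K_def)
    show "optimal_range_partner {Y. ri_space Y} ?T X ?Y"
      unfolding optimal_range_partner_def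
    proof (intro conjI ballI impI)
      show "?Y \<in> {Y. ri_space Y}" using K.ri_fn_norm_assoc KY by (auto simp: ri_space_iff)
      show "range_partner ?T X ?Y" using bounded by (simp add: range_partner_def)
      fix Z assume "Z \<in> {Y. ri_space Y}" and Z: "range_partner ?T X Z"
      then obtain M where M: "ri_fn_norm M" "represents M Z" by (auto simp: ri_space_iff)
      interpret M: ri_fn_norm M by fact
      obtain C where C: "C < \<infinity>" "\<forall>v\<in>borel_measurable pos_leb. K v \<le> C * assoc M v"
        using partner[OF M Z] by blast
      have "M w \<le> C * assoc K w" if w: "w \<in> borel_measurable pos_leb" for w
      proof -
        \<comment> \<open>Test functions in the unit ball of the associate of \<open>M\<close> have
          \<open>K\<close>-norm at most \<open>C\<close>, so the Hoelder inequality for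
          \<open>K\<close> bounds the second associate norm.\<close>
        have "M w \<le> assoc (assoc M) w" by (rule M.le_assoc_assoc[OF w])
        also have "\<dots> \<le> C * assoc K w"
        proof (rule assoc_least)
          fix v assume v: "v \<in> borel_measurable pos_leb" and le1: "assoc M v \<le> 1"
          have "K v \<le> C * assoc M v" using C(2) v by blast
          also have "\<dots> \<le> C * 1" by (intro mult_left_mono le1) simp
          finally have Kv: "K v \<le> C" by simp
          have "(\<integral>\<^sup>+x. v x * w x \<partial>pos_leb) \<le> K v * assoc K w"
            using Kv C(1) by (intro K.Hoelder v w) auto
          also have "\<dots> \<le> C * assoc K w" by (intro mult_right_mono Kv) simp
          finally show "(\<integral>\<^sup>+x. v x * w x \<partial>pos_leb) \<le> C * assoc K w" .
        qed
        finally show ?thesis .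
      qed
      moreover have "C \<le> ennreal (enn2real C + 1)"
        using C(1) by (cases C) (auto intro: ennreal_leI)
      ultimately have le: "M w \<le> ennreal (enn2real C + 1) * assoc K w" if "w \<in> borel_measurable pos_leb" for w
        using that by (meson mult_right_mono order_trans zero_le)
      show "embeds ?Y Z"
        unfolding embeds_def
      proof (intro exI[of _ "enn2real C + 1"] conjI ballI)
        fix f assume "f \<in> elems ?Y"
        then have f: "f \<in> meas_fns" by (simp add: elems_def)
        show "Z f \<le> ennreal (enn2real C + 1) * ?Y f"
          using le[OF measurable_e2ennreal_abs[OF f]] f M(2) KY by (simp add: represents_def)
      qed (simp add: add_nonneg_pos)
    qed
  next
    assume "(\<lambda>t. min 1 (?\<beta> t)) \<notin> elems (associate X)"
    then have inf: "\<not> assoc N ?m < \<infinity>" using elem_iff by simp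
    show "\<not> (\<exists>Y. ri_space Y \<and> range_partner ?T X Y)"
    proof
      assume "\<exists>Y. ri_space Y \<and> range_partner ?T X Y"
      then obtain Z M where M: "ri_fn_norm M" "represents M Z" and Z: "range_partner ?T X Z"
        by (auto simp: ri_space_iff)
      interpret M: ri_fn_norm M by fact
      interpret M': ri_fn_norm "assoc M" by (rule M.ri_fn_norm_assoc)
      obtain C where C: "C < \<infinity>" "\<forall>v\<in>borel_measurable pos_leb. K v \<le> C * assoc M v"
        using partner[OF M Z] by blast
      \<comment> \<open>A range partner would make the right side finite, because indicators of sets
        of finite measure have finite associate norm.\<close>
      have "assoc N ?m \<le> K (indicator {0<..<1})"
        unfolding K_def using \<beta>_meas \<beta>_anti
        by (intro N'.mono min_le_head_integral_indicator measurable_head_integral_antimono) auto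
      also have "\<dots> \<le> C * assoc M (indicator {0<..<1})" using C(2) by simp
      also have "\<dots> < \<infinity>"
        using C(1) M'.indicator_finite[of "{0<..<1}"] by (simp add: ennreal_mult_less_top emeasure_pos_leb_Ioo)
      finally show False using inf by simp
    qed
  qed
qed

end
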